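(* The function field $G$ over $\mathbb{F}_{11^2}$ is maximal, i.e. it attains the Hasse--Weil bound: $N_1(G) = 11^2+1+2\cdot 11\cdot g(G)$, where $N_1(G)$ is the number of $\mathbb{F}_{11^2}$-rational places of $G$ and $g(G)$ is the genus of $G$.
   Context: Let $\alpha\in\mathbb{F}_{11^2}$ be an element with $\alpha^2=-1$, and let $f(X)=(X+1)(X^2+X+1)\in\mathbb{F}_{11^2}[X]$. The function field $G=\mathbb{F}_{11^2}(x,y,z)$ (of transcendence degree one over $\mathbb{F}_{11^2}$, with $x$ transcendental) is defined by the equations $(y^2-1)^2=1-x^{12}$ and $z^2=(\alpha+1)f(x)f(\alpha x)$. For a function field $F$ of transcendence degree one with full constant field $\mathbb{F}_q$, let $N_1(F)$ denote its number of $\mathbb{F}_q$-rational places (places of degree one) and $g(F)$ its genus; the Hasse--Weil bound states $N_1(F)\le q+1+2\sqrt{q}\,g(F)$. A function field of positive genus attaining this bound is called maximal. *)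

theory Defs
  imports Complex_Main "HOL-Computational_Algebra.Polynomial" "HOL-Library.Poly_Mapping"
begin

text \<open>
  A field extension \<open>F / K\<close> is a homomorphism \<open>\<kappa>\<close> from the field \<open>'k\<close> to the field \<open>'f\<close>;
  the base field \<open>K\<close> is identified with the range of \<open>\<kappa>\<close>.
\<close>

locale field_extension =
  fixes \<kappa> :: "'k::field \<Rightarrow> 'f::field"
  assumes hom_one: "\<kappa> 1 = 1"
    and hom_add: "\<kappa> (a + b) = \<kappa> a + \<kappa> b"
    and hom_mult: "\<kappa> (a * b) = \<kappa> a * \<kappa> b"

sublocale field_extension \<subseteq> vector_space "\<lambda>c v. \<kappa> c * v"
  by unfold_locales (simp_all add: hom_one hom_add hom_mult algebra_simps)

context field_extension
begin

definition transcendental :: "'f \<Rightarrow> bool" where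
  "transcendental u \<longleftrightarrow> (\<forall>p :: 'k poly. p \<noteq> 0 \<longrightarrow> poly (map_poly \<kappa> p) u \<noteq> 0)"

definition intermediate_field :: "'f set \<Rightarrow> bool" where
  "intermediate_field M \<longleftrightarrow> range \<kappa> \<subseteq> M \<and>
     (\<forall>a\<in>M. \<forall>b\<in>M. a + b \<in> M \<and> a - b \<in> M \<and> a * b \<in> M \<and> inverse a \<in> M)"

definition adjoin :: "'f set \<Rightarrow> 'f set" where
  "adjoin S = \<Inter> {M. intermediate_field M \<and> S \<subseteq> M}"

definition function_field :: bool where
  "function_field \<longleftrightarrow> (\<exists>t. transcendental t \<and>
     (\<exists>B. finite B \<and> (\<forall>u. \<exists>c. (\<forall>b\<in>B. c b \<in> adjoin {t}) \<and> u = (\<Sum>b\<in>B. c b * b))))"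

definition full_constant_field :: bool where
  "full_constant_field \<longleftrightarrow> {u. \<not> transcendental u} = range \<kappa>"

definition valuation_ring :: "'f set \<Rightarrow> bool" where
  "valuation_ring R \<longleftrightarrow> range \<kappa> \<subset> R \<and> R \<subset> UNIV \<and>
     (\<forall>a\<in>R. \<forall>b\<in>R. a + b \<in> R \<and> a - b \<in> R \<and> a * b \<in> R) \<and>
     (\<forall>u. u \<noteq> 0 \<longrightarrow> u \<in> R \<or> inverse u \<in> R)"

definition ring_units :: "'f set \<Rightarrow> 'f set" where
  "ring_units R = {u \<in> R. \<exists>v\<in>R. u * v = 1}"

text \<open>A place is the maximal ideal, i.e. the set of non-units, of a valuation ring.\<close>

definition places :: "'f set set" where
  "places = {R - ring_units R | R. valuation_ring R}"

text \<open>
  The valuation ring is recovered from its maximal ideal \<open>P\<close> as \<open>{u. inverse u \<notin> P}\<close>, where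
  \<open>u = 0\<close> has to be listed separately because \<open>inverse 0 = 0\<close> in HOL.
\<close>

definition place_ring :: "'f set \<Rightarrow> 'f set" where
  "place_ring P = {u. u = 0 \<or> inverse u \<notin> P}"

text \<open>
  The dimension of the quotient \<open>U / W\<close> of two \<open>K\<close>-subspaces \<open>W \<subseteq> U\<close>: \<open>B\<close> below is a set of
  representatives of a basis of \<open>U / W\<close>.  As for \<^const>\<open>dim\<close>, the value is \<open>0\<close> if the quotient is
  infinite-dimensional.
\<close>

definition basis_mod :: "'f set \<Rightarrow> 'f set \<Rightarrow> 'f set \<Rightarrow> bool" where
  "basis_mod U W B \<longleftrightarrow>
     B \<subseteq> U \<and> independent B \<and> span B \<inter> W = {0} \<and> U = {b + w | b w. b \<in> span B \<and> w \<in> W}"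

definition quotient_dim :: "'f set \<Rightarrow> 'f set \<Rightarrow> nat" where
  "quotient_dim U W = card (SOME B. basis_mod U W B)"

text \<open>The degree of \<open>P\<close> is the dimension over \<open>K\<close> of the residue class field.\<close>

definition place_degree :: "'f set \<Rightarrow> nat" where
  "place_degree P = quotient_dim (place_ring P) P"

text \<open>
  The normalized discrete valuation of \<open>P\<close> at \<open>u \<noteq> 0\<close>: the exponent \<open>n\<close> in \<open>u = t\<^sup>n * e\<close>, where
  \<open>t\<close> generates the ideal \<open>P\<close> and \<open>e\<close> is a unit.
\<close>

definition valuation :: "'f set \<Rightarrow> 'f \<Rightarrow> int" where
  "valuation P u = (THE n. \<exists>t e. P = (*) t ` place_ring P \<and>
     e \<in> ring_units (place_ring P) \<and> u = t powi n * e)"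

definition divisors :: "('f set \<Rightarrow>\<^sub>0 int) set" where
  "divisors = {A. Poly_Mapping.keys A \<subseteq> places}"

definition divisor_degree :: "('f set \<Rightarrow>\<^sub>0 int) \<Rightarrow> int" where
  "divisor_degree A = (\<Sum>P\<in>Poly_Mapping.keys A. Poly_Mapping.lookup A P * int (place_degree P))"

definition riemann_roch_space :: "('f set \<Rightarrow>\<^sub>0 int) \<Rightarrow> 'f set" where
  "riemann_roch_space A =
     {u. u = 0 \<or> (\<forall>P\<in>places. valuation P u \<ge> - Poly_Mapping.lookup A P)}"

text \<open>
  By Riemann's theorem the set below is bounded above for a function field, and hence its supremum
  in the integers is a maximum.
\<close>

definition genus :: int where
  "genus = (SUP A\<in>divisors. divisor_degree A - int (dim (riemann_roch_space A)) + 1)"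

definition rational_places :: "'f set set" where
  "rational_places = {P \<in> places. place_degree P = 1}"

definition num_rational_places :: nat where
  "num_rational_places = card rational_places"

text \<open>The cardinality of a finite \<open>K\<close> is the \<open>q\<close> of the Hasse--Weil bound.\<close>

definition maximal_function_field :: bool where
  "maximal_function_field \<longleftrightarrow>
     finite (UNIV :: 'k set) \<and> function_field \<and> full_constant_field \<and> genus > 0 \<and>
     finite rational_places \<and>
     real num_rational_places =
       real (card (UNIV :: 'k set)) + 1 +
       2 * sqrt (real (card (UNIV :: 'k set))) * real_of_int genus"

end

end

theory Submission
  imports Defs
begin

text \<open>
  Put \<open>a = y + x\<^sup>6 / y\<close> and \<open>b = y - x\<^sup>6 / y\<close>. Then \<open>a\<^sup>2 = 2 + 2 x\<^sup>6\<close> and \<open>b\<^sup>2 = 2 - 2 x\<^sup>6\<close>, so \<open>G = K(x)(a, b, z)\<close> is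
  Galois over \<open>K(x)\<close> with group \<open>(Z/2)\<^sup>3\<close>, and it has a \<open>K(x)\<close>-basis of square roots \<open>w i\<close> of squarefree
  polynomials \<open>D i\<close> of degrees \<open>0\<close>, \<open>12\<close> and six times \<open>6\<close>. Since \<open>2\<close> is invertible, projecting onto the
  eigenspaces of the Galois group shows that the functions whose only poles lie over infinity, with order
  at most that of \<open>x\<^sup>n\<close>, are the sums of \<open>h i * w i\<close> with polynomials \<open>h i\<close> such that
  \<open>deg (h i) + deg (D i) / 2 \<le> n\<close>. They have dimension \<open>8 n - 16\<close> for \<open>n \<ge> 6\<close>. Riemann's argument, which
  needs only that a rational function of \<open>x\<close> of degree \<open>d\<close> has at most \<open>8 d\<close> zeros, turns this into \<open>g(G) = 17\<close>.

  For \<open>s \<in> K\<close> at most \<open>8\<close> rational places lie over \<open>x = s\<close>, and the Galois group moves one place to all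
  others. If \<open>a\<^sup>2\<close>, \<open>b\<^sup>2\<close>, \<open>z\<^sup>2\<close> take nonzero square values at \<open>s\<close>, which happens for \<open>56\<close> elements, then there
  are \<open>8\<close>; over each of the twelve roots of \<open>s\<^sup>1\<^sup>2 = 1\<close> the ramification index is \<open>2\<close> and there are \<open>4\<close>. There are
  no others; in particular none lies over infinity, because \<open>(\<alpha> + 1) \<alpha>\<^sup>3\<close> is not a square. Hence
  \<open>N\<^sub>1(G) = 8 * 56 + 4 * 12 = 496 = 122 + 2 * 11 * 17\<close>.
\<close>

section \<open>Dimensions of quotient spaces\<close>

text \<open>The degree of a place, its valuation and the genus are defined by a choice, a definite
  description and a supremum, so nothing can be computed before finiteness and discreteness are
  known. One bound provides both: \<open>indep_mod_rational_bound\<close>. If r maps a space S into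
  itself, elements of S that are independent modulo r S stay independent after multiplication by
  powers of r; clearing denominators puts these products into spaces whose dimension grows like 8 n.
  The resulting bound 8 d, with d the degree of r as a fraction in x, makes places discrete and
  residue fields finite-dimensional, and it bounds the zeros of r counted with multiplicity. The
  complementary inputs are existence statements: \<open>exists_valuation_ring\<close> supplies
  valuation rings that omit a given element. It shows that a rational function of x without finite
  poles is a polynomial, and that there are places over infinity and over each s in K. The supremum
  that defines the genus is then reached at a multiple of the pole divisor of x.\<close>

context field_extension
begin

lemma hom_zero: "\<kappa> 0 = 0"
  by (metis hom_add add.right_neutral add_left_imp_eq)

lemma hom_minus: "\<kappa> (- a) = - \<kappa> a"
  using hom_add[of a "- a"] hom_zero by (simp add: eq_neg_iff_add_eq_0 add.commute)

lemma hom_diff: "\<kappa> (a - b) = \<kappa> a - \<kappa> b"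
  using hom_add[of a "- b"] hom_minus by simp

lemma hom_sum: "\<kappa> (\<Sum>i\<in>I. g i) = (\<Sum>i\<in>I. \<kappa> (g i))"
  by (induction I rule: infinite_finite_induct) (simp_all add: hom_zero hom_add)

lemma hom_inverse: "\<kappa> (inverse a) = inverse (\<kappa> a)"
proof (cases "a = 0")
  case False
  then have "\<kappa> a * \<kappa> (inverse a) = 1"
    by (simp flip: hom_mult add: hom_one)
  then show ?thesis
    by (metis inverse_unique)
qed (simp add: hom_zero)

lemma hom_eq_0_iff [simp]: "\<kappa> a = 0 \<longleftrightarrow> a = 0"
  using hom_mult[of a "inverse a"] hom_one hom_zero by (cases "a = 0") auto

text \<open>Linear independence in the quotient by W. It concerns families rather than sets, so a
  repeated value counts as a dependence.\<close>

definition indep_mod :: "'f set \<Rightarrow> 'i set \<Rightarrow> ('i \<Rightarrow> 'f) \<Rightarrow> bool" where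
  "indep_mod W I v \<longleftrightarrow> (\<forall>c. (\<Sum>i\<in>I. \<kappa> (c i) * v i) \<in> W \<longrightarrow> (\<forall>i\<in>I. c i = 0))"

text \<open>A relation and not a function: it also asserts that the quotient is finite-dimensional,
  which a value of \<open>quotient_dim\<close> cannot express because of its default 0.\<close>

definition codim :: "'f set \<Rightarrow> 'f set \<Rightarrow> nat \<Rightarrow> bool" where
  "codim U W n \<longleftrightarrow> (\<exists>v. v ` {..<n} \<subseteq> U \<and> indep_mod W {..<n} v \<and>
     (\<forall>u\<in>U. \<exists>c. u - (\<Sum>i<n. \<kappa> (c i) * v i) \<in> W))"

lemma codimI:
  assumes "v ` {..<n} \<subseteq> U" "indep_mod W {..<n} v"
    and "\<And>u. u \<in> U \<Longrightarrow> \<exists>c. u - (\<Sum>i<n. \<kappa> (c i) * v i) \<in> W"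
  shows "codim U W n"
  unfolding codim_def using assms by (intro exI[of _ v]) simp

lemma indep_modD:
  "indep_mod W I v \<Longrightarrow> (\<Sum>i\<in>I. \<kappa> (c i) * v i) \<in> W \<Longrightarrow> i \<in> I \<Longrightarrow> c i = 0"
  unfolding indep_mod_def by blast

lemma indep_mod_mono: "indep_mod W I v \<Longrightarrow> W' \<subseteq> W \<Longrightarrow> indep_mod W' I v"
  unfolding indep_mod_def by blast

lemma subspace_sum_mem:
  "subspace U \<Longrightarrow> (\<And>i. i \<in> I \<Longrightarrow> v i \<in> U) \<Longrightarrow> (\<Sum>i\<in>I. \<kappa> (c i) * v i) \<in> U"
  by (rule subspace_sum) (auto simp: subspace_def)

lemma indep_mod_inj_on:
  assumes "indep_mod W I v" "finite I" "0 \<in> W"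
  shows "inj_on v I"
proof (rule inj_onI, rule ccontr)
  fix i j assume ij: "i \<in> I" "j \<in> I" "v i = v j" "i \<noteq> j"
  let ?c = "\<lambda>k. if k = i then 1 else if k = j then -1 else (0::'k)"
  have "(\<Sum>k\<in>I. \<kappa> (?c k) * v k) = (\<Sum>k\<in>{i, j}. \<kappa> (?c k) * v k)"
    using ij assms(2) by (intro sum.mono_neutral_right) (auto simp: hom_zero)
  also have "\<dots> = 0"
    using ij by (simp add: hom_one hom_minus)
  finally show False
    using indep_modD[OF assms(1), of ?c i] assms(3) ij by simp
qed

lemma indep_mod_0_iff:
  assumes "finite I"
  shows "indep_mod {0} I v \<longleftrightarrow> inj_on v I \<and> independent (v ` I)"
proof safe
  assume ind: "indep_mod {0} I v"
  then show inj: "inj_on v I"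
    using assms by (intro indep_mod_inj_on) auto
  assume "dependent (v ` I)"
  moreover have "independent (v ` I)"
  proof (rule independent_if_scalars_zero)
    fix f u assume s: "(\<Sum>u\<in>v ` I. \<kappa> (f u) * u) = 0" and u: "u \<in> v ` I"
    have "(\<Sum>i\<in>I. \<kappa> (f (v i)) * v i) \<in> {0}"
      using s inj by (simp add: sum.reindex)
    then show "f u = 0"
      using indep_modD[OF ind, of "\<lambda>i. f (v i)"] u by auto
  qed (use assms in auto)
  ultimately show False by blast
next
  assume inj: "inj_on v I" and ind: "independent (v ` I)"
  show "indep_mod {0} I v"
    unfolding indep_mod_def
  proof safe
    fix c i assume s: "(\<Sum>i\<in>I. \<kappa> (c i) * v i) = 0" and i: "i \<in> I"
    let ?f = "\<lambda>u. c (the_inv_into I v u)"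
    have "(\<Sum>u\<in>v ` I. \<kappa> (?f u) * u) = 0"
      using s inj by (simp add: sum.reindex the_inv_into_f_f)
    then show "c i = 0"
      using independentD[OF ind finite_imageI[OF assms] subset_refl, where u = ?f and v = "v i"] i inj
      by (simp add: the_inv_into_f_f)
  qed
qed

lemma indep_mod_le_card_span:
  assumes "indep_mod {0} I v" "finite I" "finite T" "v ` I \<subseteq> span T"
  shows "card I \<le> card T"
  using assms independent_span_bound[of T "v ` I"] card_image[of v I]
  by (auto simp: indep_mod_0_iff)

text \<open>Replacing each \<open>v i\<close> by its component \<open>p i\<close> along a basis of U
  modulo W does not change relations modulo W. This reduces the claim to the exchange lemma in the
  span of n vectors.\<close>

lemma codim_bound:
  assumes W: "subspace W" and cd: "codim U W n"
    and I: "finite I" and vU: "v ` I \<subseteq> U" and ind: "indep_mod W I v"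
  shows "card I \<le> n"
proof -
  obtain b where b: "b ` {..<n} \<subseteq> U"
    "\<And>u. u \<in> U \<Longrightarrow> \<exists>c. u - (\<Sum>i<n. \<kappa> (c i) * b i) \<in> W"
    using cd unfolding codim_def by blast
  have "\<exists>c. v i - (\<Sum>k<n. \<kappa> (c k) * b k) \<in> W" if "i \<in> I" for i
    using b(2) vU that by blast
  then obtain c where c: "\<And>i. i \<in> I \<Longrightarrow> v i - (\<Sum>k<n. \<kappa> (c i k) * b k) \<in> W"
    by metis
  define p where "p i = (\<Sum>k<n. \<kappa> (c i k) * b k)" for i
  have "indep_mod {0} I p"
    unfolding indep_mod_def
  proof safe
    fix d i assume s: "(\<Sum>i\<in>I. \<kappa> (d i) * p i) = 0" and i: "i \<in> I"
    have "(\<Sum>i\<in>I. \<kappa> (d i) * v i) = (\<Sum>i\<in>I. \<kappa> (d i) * (v i - p i))"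
      using s by (simp add: algebra_simps sum_subtractf)
    also have "\<dots> \<in> W"
      using W c unfolding p_def by (intro subspace_sum_mem) auto
    finally show "d i = 0"
      using indep_modD[OF ind, of d] i by blast
  qed
  moreover have "p ` I \<subseteq> span (b ` {..<n})"
    unfolding p_def by (auto intro!: span_sum span_scale intro: span_base)
  ultimately have "card I \<le> card (b ` {..<n})"
    using indep_mod_le_card_span I by blast
  then show ?thesis
    using card_image_le[of "{..<n}" b] by simp
qed

lemma codim_unique:
  assumes "subspace W" "codim U W n" "codim U W m"
  shows "n = m"
proof -
  have "k \<le> l" if "codim U W k" "codim U W l" for k l
    using that(1) codim_bound[OF assms(1) that(2), of "{..<k}"] unfolding codim_def by auto
  then show ?thesis
    using assms by (simp add: order_antisym)
qed

text \<open>A family of greatest length is a basis: adding u creates a relation modulo W, and the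
  coefficient of u in it cannot vanish.\<close>

lemma codim_exists:
  assumes U: "subspace U" and W: "subspace W"
    and bound: "\<And>(m::nat) v. v ` {..<m} \<subseteq> U \<Longrightarrow> indep_mod W {..<m} v \<Longrightarrow> m \<le> M"
  shows "\<exists>n\<le>M. codim U W n"
proof -
  let ?P = "\<lambda>m::nat. \<exists>v. v ` {..<m} \<subseteq> U \<and> indep_mod W {..<m} v"
  have P0: "?P 0"
    by (simp add: indep_mod_def)
  have le: "\<And>m. ?P m \<Longrightarrow> m \<le> M"
    using bound by blast
  have "?P (Greatest ?P)"
    by (rule GreatestI_nat[of ?P 0 M]) (fact P0, fact le)
  have gr: "\<And>m. ?P m \<Longrightarrow> m \<le> Greatest ?P"
    by (rule Greatest_le_nat[of ?P _ M]) (assumption, rule le)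
  define n where "n = Greatest ?P"
  then obtain v where v: "v ` {..<n} \<subseteq> U" "indep_mod W {..<n} v"
    using \<open>?P (Greatest ?P)\<close> by blast
  have "\<exists>c. u - (\<Sum>i<n. \<kappa> (c i) * v i) \<in> W" if u: "u \<in> U" for u
  proof -
    let ?v = "v(n := u)"
    have "\<not> indep_mod W {..<Suc n} ?v"
    proof
      assume "indep_mod W {..<Suc n} ?v"
      moreover have "?v ` {..<Suc n} \<subseteq> U"
        using v(1) u by (auto simp: less_Suc_eq)
      ultimately have "Suc n \<le> n"
        using gr[of "Suc n"] unfolding n_def[symmetric] by blast
      then show False by simp
    qed
    then obtain c i where c: "(\<Sum>i<Suc n. \<kappa> (c i) * ?v i) \<in> W" "i < Suc n" "c i \<noteq> 0"
      unfolding indep_mod_def by auto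
    have s: "(\<Sum>i<n. \<kappa> (c i) * v i) + \<kappa> (c n) * u \<in> W"
      using c(1) by simp
    have cn: "c n \<noteq> 0"
    proof
      assume "c n = 0"
      then have "\<forall>i<n. c i = 0"
        using s indep_modD[OF v(2), of c] by (auto simp: hom_zero)
      then show False
        using c(2,3) \<open>c n = 0\<close> by (auto simp: less_Suc_eq)
    qed
    have "\<kappa> (inverse (c n)) * ((\<Sum>i<n. \<kappa> (c i) * v i) + \<kappa> (c n) * u) \<in> W"
      using W s unfolding subspace_def by blast
    also have "\<kappa> (inverse (c n)) * ((\<Sum>i<n. \<kappa> (c i) * v i) + \<kappa> (c n) * u) =
        u - (\<Sum>i<n. \<kappa> (- inverse (c n) * c i) * v i)"
      using cn by (simp add: hom_minus hom_mult hom_inverse algebra_simps sum_distrib_left sum_negf)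
    finally show ?thesis
      by (intro exI[of _ "\<lambda>i. - inverse (c n) * c i"])
  qed
  with v have "codim U W n"
    by (intro codimI) auto
  then show ?thesis
    using le[of n] v by blast
qed

lemma sum_lessThan_add: "(\<Sum>i<m + n. h i) = (\<Sum>i<m. h i) + (\<Sum>i<n. h (m + i))"
  for h :: "nat \<Rightarrow> 'x::comm_monoid_add"
  by (induction n) (simp_all add: add.assoc)

lemma codim_trans:
  assumes sub: "subspace U" "subspace W" "subspace Z" "Z \<subseteq> W" "W \<subseteq> U"
    and "codim U W m" "codim W Z n"
  shows "codim U Z (m + n)"
proof -
  obtain v where v: "v ` {..<m} \<subseteq> U" "indep_mod W {..<m} v"
    "\<And>u. u \<in> U \<Longrightarrow> \<exists>c. u - (\<Sum>i<m. \<kappa> (c i) * v i) \<in> W"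
    using assms(6) unfolding codim_def by blast
  obtain w where w: "w ` {..<n} \<subseteq> W" "indep_mod Z {..<n} w"
    "\<And>u. u \<in> W \<Longrightarrow> \<exists>c. u - (\<Sum>i<n. \<kappa> (c i) * w i) \<in> Z"
    using assms(7) unfolding codim_def by blast
  define b where "b i = (if i < m then v i else w (i - m))" for i
  have b_sum: "(\<Sum>i<m + n. \<kappa> (c i) * b i) =
      (\<Sum>i<m. \<kappa> (c i) * v i) + (\<Sum>i<n. \<kappa> (c (m + i)) * w i)" for c
    by (simp add: sum_lessThan_add b_def)
  have "b ` {..<m + n} \<subseteq> U"
    using v(1) w(1) sub(5) by (auto simp: b_def image_subset_iff)
  moreover have "indep_mod Z {..<m + n} b"
    unfolding indep_mod_def
  proof (intro allI impI ballI)
    fix c i assume s: "(\<Sum>i<m + n. \<kappa> (c i) * b i) \<in> Z" and i: "i \<in> {..<m + n}"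
    have "(\<Sum>i<n. \<kappa> (c (m + i)) * w i) \<in> W"
      using w(1) sub(2) by (intro subspace_sum_mem) auto
    then have "(\<Sum>i<m. \<kappa> (c i) * v i) \<in> W"
      using subspace_diff[OF sub(2) subsetD[OF sub(4) s]] unfolding b_sum by fastforce
    then have c0: "\<forall>i<m. c i = 0"
      using indep_modD[OF v(2), of c] by blast
    then have "(\<Sum>i<n. \<kappa> (c (m + i)) * w i) \<in> Z"
      using s unfolding b_sum by (simp add: hom_zero)
    then have c1: "\<forall>i<n. c (m + i) = 0"
      using indep_modD[OF w(2), of "\<lambda>i. c (m + i)"] by blast
    show "c i = 0"
      using c0 c1[rule_format, of "i - m"] i by (cases "i < m") auto
  qed
  moreover have "\<exists>c. u - (\<Sum>i<m + n. \<kappa> (c i) * b i) \<in> Z" if u: "u \<in> U" for u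
  proof -
    obtain c where c: "u - (\<Sum>i<m. \<kappa> (c i) * v i) \<in> W"
      using v(3) u by blast
    obtain d where d: "u - (\<Sum>i<m. \<kappa> (c i) * v i) - (\<Sum>i<n. \<kappa> (d i) * w i) \<in> Z"
      using w(3)[OF c] by blast
    let ?c = "\<lambda>i. if i < m then c i else d (i - m)"
    have "u - (\<Sum>i<m + n. \<kappa> (?c i) * b i) = u - (\<Sum>i<m. \<kappa> (c i) * v i) - (\<Sum>i<n. \<kappa> (d i) * w i)"
      unfolding b_sum by simp
    then show ?thesis
      using d by (intro exI[of _ ?c]) (simp only:)
  qed
  ultimately show ?thesis
    by (intro codimI)
qed

text \<open>The quotient of U \<inter> S by W \<inter> S embeds into the quotient of U by W.\<close>

lemma codim_Int:
  assumes "subspace U" "subspace W" "subspace S" "codim U W n"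
  shows "\<exists>m\<le>n. codim (U \<inter> S) (W \<inter> S) m"
proof (rule codim_exists)
  fix m :: nat and v assume v: "v ` {..<m} \<subseteq> U \<inter> S" "indep_mod (W \<inter> S) {..<m} v"
  have "(\<Sum>i<m. \<kappa> (c i) * v i) \<in> S" for c
    using v(1) assms(3) by (intro subspace_sum_mem) auto
  then have "indep_mod W {..<m} v"
    using v(2) unfolding indep_mod_def by blast
  then show "m \<le> n"
    using codim_bound[OF assms(2,4), of "{..<m}" v] v(1) by auto
qed (use assms subspace_inter in auto)

text \<open>The hypothesis \<open>ap\<close> makes the embedding of \<open>codim_Int\<close>
  surjective; for valuation conditions it is an instance of weak approximation.\<close>

lemma codim_Int_eq:
  assumes sub: "subspace U" "subspace W" "subspace S" and cd: "codim U W n"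
    and ap: "\<And>u. u \<in> U \<Longrightarrow> \<exists>s\<in>U \<inter> S. u - s \<in> W"
  shows "codim (U \<inter> S) (W \<inter> S) n"
proof -
  obtain v where v: "v ` {..<n} \<subseteq> U" "indep_mod W {..<n} v"
    "\<And>u. u \<in> U \<Longrightarrow> \<exists>c. u - (\<Sum>i<n. \<kappa> (c i) * v i) \<in> W"
    using cd unfolding codim_def by blast
  have "\<exists>s. s \<in> U \<inter> S \<and> v i - s \<in> W" if "i < n" for i
    using ap[of "v i"] v(1) that by blast
  then obtain s where s: "\<And>i. i < n \<Longrightarrow> s i \<in> U \<inter> S" "\<And>i. i < n \<Longrightarrow> v i - s i \<in> W"
    by metis
  have dW: "(\<Sum>i<n. \<kappa> (c i) * v i) - (\<Sum>i<n. \<kappa> (c i) * s i) \<in> W" for c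
  proof -
    have "(\<Sum>i<n. \<kappa> (c i) * (v i - s i)) \<in> W"
      using s sub by (intro subspace_sum_mem) auto
    then show ?thesis
      by (simp add: algebra_simps sum_subtractf)
  qed
  have "indep_mod (W \<inter> S) {..<n} s"
    unfolding indep_mod_def
  proof (intro allI impI)
    fix c assume "(\<Sum>i<n. \<kappa> (c i) * s i) \<in> W \<inter> S"
    then have "(\<Sum>i<n. \<kappa> (c i) * v i) \<in> W"
      using subspace_add[OF sub(2) dW[of c], of "\<Sum>i<n. \<kappa> (c i) * s i"] by simp
    then show "\<forall>i\<in>{..<n}. c i = 0"
      using indep_modD[OF v(2), of c] by blast
  qed
  moreover have "\<exists>c. u - (\<Sum>i<n. \<kappa> (c i) * s i) \<in> W \<inter> S" if u: "u \<in> U \<inter> S" for u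
  proof -
    obtain c where "u - (\<Sum>i<n. \<kappa> (c i) * v i) \<in> W"
      using v(3) u by blast
    then have "u - (\<Sum>i<n. \<kappa> (c i) * s i) \<in> W"
      using subspace_add[OF sub(2) _ dW[of c], of "u - (\<Sum>i<n. \<kappa> (c i) * v i)"] by simp
    moreover have "(\<Sum>i<n. \<kappa> (c i) * s i) \<in> S"
      using s sub by (intro subspace_sum_mem) auto
    ultimately show ?thesis
      using u subspace_diff[OF sub(3)] by blast
  qed
  moreover have "s ` {..<n} \<subseteq> U \<inter> S"
    using s by blast
  ultimately show ?thesis
    by (intro codimI)
qed

lemma codim_mult_image:
  assumes "t \<noteq> 0" "codim U W n"
  shows "codim ((*) t ` U) ((*) t ` W) n"
proof -
  obtain v where v: "v ` {..<n} \<subseteq> U" "indep_mod W {..<n} v"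
    "\<And>u. u \<in> U \<Longrightarrow> \<exists>c. u - (\<Sum>i<n. \<kappa> (c i) * v i) \<in> W"
    using assms(2) unfolding codim_def by blast
  have s: "(\<Sum>i<n. \<kappa> (c i) * (t * v i)) = t * (\<Sum>i<n. \<kappa> (c i) * v i)" for c
    by (simp add: sum_distrib_left algebra_simps)
  have "indep_mod ((*) t ` W) {..<n} (\<lambda>i. t * v i)"
    using v(2) assms(1) unfolding indep_mod_def s by auto
  moreover have "\<exists>c. u - (\<Sum>i<n. \<kappa> (c i) * (t * v i)) \<in> (*) t ` W" if u: "u \<in> (*) t ` U" for u
  proof -
    obtain u' where u': "u = t * u'" "u' \<in> U"
      using u by blast
    then obtain c where "u' - (\<Sum>i<n. \<kappa> (c i) * v i) \<in> W"
      using v(3) by blast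
    then have "u - t * (\<Sum>i<n. \<kappa> (c i) * v i) \<in> (*) t ` W"
      using u'(1) by (auto simp flip: right_diff_distrib)
    then show ?thesis
      unfolding s by (intro exI[of _ c])
  qed
  moreover have "(\<lambda>i. t * v i) ` {..<n} \<subseteq> (*) t ` U"
    using v(1) by auto
  ultimately show ?thesis
    by (intro codimI)
qed

lemma codim_refl: "subspace U \<Longrightarrow> codim U U 0"
  unfolding codim_def indep_mod_def by (intro exI[of _ "\<lambda>_. 0"]) (simp add: subspace_def)

lemma subspace_mult_image: "subspace U \<Longrightarrow> subspace ((*) t ` U)"
  unfolding subspace_def
proof (intro conjI ballI allI)
  assume U: "0 \<in> U \<and> (\<forall>x\<in>U. \<forall>y\<in>U. x + y \<in> U) \<and> (\<forall>c. \<forall>x\<in>U. \<kappa> c * x \<in> U)"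
  then show "0 \<in> (*) t ` U"
    by (intro image_eqI[of _ _ 0]) simp_all
  fix p assume p: "p \<in> (*) t ` U"
  then obtain p' where p': "p = t * p'" "p' \<in> U" by blast
  then show "\<kappa> c * p \<in> (*) t ` U" for c
    using U by (intro image_eqI[of _ _ "\<kappa> c * p'"]) simp_all
  fix q assume "q \<in> (*) t ` U"
  then obtain q' where "q = t * q'" "q' \<in> U" by blast
  then show "p + q \<in> (*) t ` U"
    using U p' by (intro image_eqI[of _ _ "p' + q'"]) (simp_all add: distrib_left)
qed

lemma codim_of_family:
  assumes J: "finite J" and v: "v ` J \<subseteq> U" "indep_mod W J v"
    and sp: "\<And>u. u \<in> U \<Longrightarrow> \<exists>c. u - (\<Sum>i\<in>J. \<kappa> (c i) * v i) \<in> W"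
  shows "codim U W (card J)"
proof -
  obtain b where b: "bij_betw b {..<card J} J"
    using J by (metis ex_bij_betw_nat_finite lessThan_atLeast0)
  have sum_b: "(\<Sum>k<card J. \<kappa> (c (b k)) * v (b k)) = (\<Sum>i\<in>J. \<kappa> (c i) * v i)" for c
    using b by (intro sum.reindex_bij_betw)
  show ?thesis
  proof (rule codimI[of "\<lambda>k. v (b k)"])
    show "(\<lambda>k. v (b k)) ` {..<card J} \<subseteq> U"
      using v(1) b by (auto simp: bij_betw_def)
    show "indep_mod W {..<card J} (\<lambda>k. v (b k))"
      unfolding indep_mod_def
    proof (intro allI impI ballI)
      fix c k assume s: "(\<Sum>k<card J. \<kappa> (c k) * v (b k)) \<in> W" and k: "k \<in> {..<card J}"
      let ?c = "\<lambda>i. c (the_inv_into {..<card J} b i)"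
      have inv: "?c (b k) = c k" if "k \<in> {..<card J}" for k
        using b that by (simp add: the_inv_into_f_f bij_betw_def)
      have "(\<Sum>k<card J. \<kappa> (c k) * v (b k)) = (\<Sum>k<card J. \<kappa> (?c (b k)) * v (b k))"
        using inv by (intro sum.cong) simp_all
      then have "(\<Sum>i\<in>J. \<kappa> (?c i) * v i) \<in> W"
        using s sum_b[of ?c] by simp
      then have "?c (b k) = 0"
        using indep_modD[OF v(2), of ?c "b k"] b k by (auto simp: bij_betw_def)
      then show "c k = 0"
        using inv k by simp
    qed
    fix u assume "u \<in> U"
    then obtain c where c: "u - (\<Sum>i\<in>J. \<kappa> (c i) * v i) \<in> W"
      using sp by blast
    then show "\<exists>c. u - (\<Sum>i<card J. \<kappa> (c i) * v (b i)) \<in> W"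
      unfolding sum_b[symmetric] by (intro exI[of _ "\<lambda>k. c (b k)"])
  qed
qed

text \<open>The choice in \<open>quotient_dim\<close> is harmless, because a basis exists and all
  bases have n elements. A basis is not finite by definition, but each of its finite subsets has at
  most n elements.\<close>

lemma quotient_dim_eq:
  assumes U: "subspace U" and W: "subspace W" "W \<subseteq> U" and cd: "codim U W n"
  shows "quotient_dim U W = n"
proof -
  have card: "card B = n" if B: "basis_mod U W B" for B
  proof -
    have BU: "B \<subseteq> U" "independent B" "span B \<inter> W = {0}"
      and UBW: "U = {b + w | b w. b \<in> span B \<and> w \<in> W}"
      using B unfolding basis_mod_def by auto
    have fin_indep: "indep_mod W C id" if C: "C \<subseteq> B" "finite C" for C
      unfolding indep_mod_def
    proof (intro allI impI ballI)
      fix c i assume s: "(\<Sum>i\<in>C. \<kappa> (c i) * id i) \<in> W" and i: "i \<in> C"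
      have "(\<Sum>i\<in>C. \<kappa> (c i) * i) \<in> span B"
        using C by (auto intro!: span_sum span_scale intro: span_base)
      then have "(\<Sum>i\<in>C. \<kappa> (c i) * i) = 0"
        using s BU(3) by auto
      then show "c i = 0"
        using independentD[OF BU(2) C(2,1)] i by blast
    qed
    have le: "card C \<le> n" if C: "C \<subseteq> B" "finite C" for C
      using codim_bound[OF W(1) cd C(2), of id] fin_indep[OF C] C BU(1) by auto
    have fB: "finite B"
    proof (rule ccontr)
      assume "infinite B"
      then obtain C where "C \<subseteq> B" "finite C" "card C = Suc n"
        using infinite_arbitrarily_large by blast
      then show False using le[of C] by simp
    qed
    have "codim U W (card B)"
    proof (rule codim_of_family[OF fB _ fin_indep[OF subset_refl fB]])
      fix u assume "u \<in> U"
      then obtain b w where bw: "u = b + w" "b \<in> span B" "w \<in> W"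
        using UBW by blast
      obtain d where "b = (\<Sum>u\<in>B. \<kappa> (d u) * u)"
        using bw(2) span_finite[OF fB] by auto
      then show "\<exists>c. u - (\<Sum>i\<in>B. \<kappa> (c i) * id i) \<in> W"
        using bw by (intro exI[of _ d]) simp
    qed (use BU(1) in simp)
    then show ?thesis
      using codim_unique[OF W(1) cd] by simp
  qed
  obtain v where v: "v ` {..<n} \<subseteq> U" "indep_mod W {..<n} v"
    "\<And>u. u \<in> U \<Longrightarrow> \<exists>c. u - (\<Sum>i<n. \<kappa> (c i) * v i) \<in> W"
    using cd unfolding codim_def by blast
  let ?B = "v ` {..<n}"
  have ind0: "indep_mod {0} {..<n} v"
    using v(2) W(1) indep_mod_mono[of W _ v "{0}"] unfolding subspace_def by blast
  have inj: "inj_on v {..<n}" and indB: "independent ?B"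
    using ind0 by (simp_all add: indep_mod_0_iff)
  have spB: "\<exists>c. b = (\<Sum>i<n. \<kappa> (c i) * v i)" if b: "b \<in> span ?B" for b
  proof -
    obtain d where "b = (\<Sum>u\<in>?B. \<kappa> (d u) * u)"
      using b span_finite[of ?B] by auto
    then have "b = (\<Sum>i<n. \<kappa> (d (v i)) * v i)"
      using inj by (simp add: sum.reindex)
    then show ?thesis
      by (intro exI[of _ "\<lambda>i. d (v i)"])
  qed
  have in_sp: "(\<Sum>i<n. \<kappa> (c i) * v i) \<in> span ?B" for c
    by (auto intro!: span_sum span_scale intro: span_base)
  have "basis_mod U W ?B"
    unfolding basis_mod_def
  proof (intro conjI)
    show "span ?B \<inter> W = {0}"
    proof -
      have "b = 0" if b: "b \<in> span ?B" "b \<in> W" for b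
      proof -
        obtain c where c: "b = (\<Sum>i<n. \<kappa> (c i) * v i)"
          using spB b by blast
        then have "\<forall>i<n. c i = 0"
          using indep_modD[OF v(2), of c] b by blast
        then show ?thesis
          using c by (simp add: hom_zero)
      qed
      moreover have "0 \<in> W"
        using W(1) unfolding subspace_def by blast
      ultimately show ?thesis
        using span_zero by blast
    qed
    show "U = {b + w | b w. b \<in> span ?B \<and> w \<in> W}"
    proof (intro equalityI subsetI)
      fix u assume "u \<in> U"
      then obtain c where c: "u - (\<Sum>i<n. \<kappa> (c i) * v i) \<in> W"
        using v(3) by blast
      have "u = (\<Sum>i<n. \<kappa> (c i) * v i) + (u - (\<Sum>i<n. \<kappa> (c i) * v i))"
        by simp
      then show "u \<in> {b + w | b w. b \<in> span ?B \<and> w \<in> W}"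
        using c in_sp by blast
    next
      fix u assume "u \<in> {b + w | b w. b \<in> span ?B \<and> w \<in> W}"
      moreover have "span ?B \<subseteq> U"
        using v(1) U by (rule span_minimal)
      ultimately show "u \<in> U"
        using U W(2) unfolding subspace_def by blast
    qed
  qed (use v indB in auto)
  then have "basis_mod U W (SOME B. basis_mod U W B)"
    by (rule someI)
  then show ?thesis
    unfolding quotient_dim_def by (rule card)
qed

lemma dim_eq_codim:
  assumes "subspace U" "codim U {0} n"
  shows "dim U = n"
proof -
  obtain v where v: "v ` {..<n} \<subseteq> U" "indep_mod {0} {..<n} v"
    "\<And>u. u \<in> U \<Longrightarrow> \<exists>c. u - (\<Sum>i<n. \<kappa> (c i) * v i) \<in> {0}"
    using assms(2) unfolding codim_def by blast
  have inj: "inj_on v {..<n}" and indB: "independent (v ` {..<n})"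
    using v(2) by (simp_all add: indep_mod_0_iff)
  have "U \<subseteq> span (v ` {..<n})"
  proof
    fix u assume "u \<in> U"
    then obtain c where "u = (\<Sum>i<n. \<kappa> (c i) * v i)"
      using v(3) by auto
    then show "u \<in> span (v ` {..<n})"
      by (auto intro!: span_sum span_scale intro: span_base)
  qed
  then show ?thesis
    using dim_unique[OF v(1) _ indB, of n] inj by (simp add: card_image)
qed

end

section \<open>Valuation rings\<close>

context field_extension
begin

section \<open>Evaluation of polynomials over K\<close>

definition ev :: "'f \<Rightarrow> 'k poly \<Rightarrow> 'f" where
  "ev u p = poly (map_poly \<kappa> p) u"

lemma ev_0 [simp]: "ev u 0 = 0"
  by (simp add: ev_def)

lemma ev_pCons [simp]: "ev u (pCons a p) = \<kappa> a + u * ev u p"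
  by (simp add: ev_def map_poly_pCons hom_zero)

lemma ev_add [simp]: "ev u (p + q) = ev u p + ev u q"
  unfolding ev_def poly_add[symmetric]
  by (intro arg_cong[where f = "\<lambda>p. poly p u"] poly_eqI) (simp add: coeff_map_poly hom_zero hom_add)

lemma ev_smult [simp]: "ev u (smult a p) = \<kappa> a * ev u p"
  by (induction p) (simp_all add: hom_mult algebra_simps)

lemma ev_mult [simp]: "ev u (p * q) = ev u p * ev u q"
  by (induction p) (simp_all add: hom_zero algebra_simps)

lemma ev_minus [simp]: "ev u (- p) = - ev u p"
  using ev_add[of u p "- p"] by (simp add: eq_neg_iff_add_eq_0 add.commute del: ev_add)

lemma ev_diff [simp]: "ev u (p - q) = ev u p - ev u q"
  using ev_add[of u p "- q"] by (simp del: ev_add)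

lemma ev_1 [simp]: "ev u 1 = 1"
  unfolding one_pCons by (simp add: hom_one)

lemma ev_power [simp]: "ev u (p ^ n) = ev u p ^ n"
  by (induction n) simp_all

lemma ev_sum: "ev u (\<Sum>i\<in>I. p i) = (\<Sum>i\<in>I. ev u (p i))"
  by (induction I rule: infinite_finite_induct) simp_all

lemma ev_monom [simp]: "ev u (monom a n) = \<kappa> a * u ^ n"
  by (induction n) (simp_all add: monom_0 monom_Suc hom_zero)

lemma ev_altdef: "ev u p = (\<Sum>i\<le>degree p. \<kappa> (coeff p i) * u ^ i)"
  by (subst poly_as_sum_of_monoms[symmetric]) (simp add: ev_sum)

lemma transcendental_ev_eq_0_iff: "transcendental u \<Longrightarrow> ev u p = 0 \<longleftrightarrow> p = 0"
  unfolding transcendental_def ev_def by auto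

lemma ev_pcompose: "ev u (pcompose p q) = ev (ev u q) p"
  by (induction p) (simp_all add: pcompose_pCons)

section \<open>Subrings over K and Chevalley's extension theorem\<close>

definition subring :: "'f set \<Rightarrow> bool" where
  "subring B \<longleftrightarrow> range \<kappa> \<subseteq> B \<and> (\<forall>a\<in>B. \<forall>b\<in>B. a + b \<in> B \<and> a - b \<in> B \<and> a * b \<in> B)"

lemma subringD:
  assumes "subring B"
  shows subring_hom: "\<kappa> c \<in> B" and subring_0: "0 \<in> B" and subring_1: "1 \<in> B"
    and subring_add: "a \<in> B \<Longrightarrow> b \<in> B \<Longrightarrow> a + b \<in> B"
    and subring_diff: "a \<in> B \<Longrightarrow> b \<in> B \<Longrightarrow> a - b \<in> B"
    and subring_mult: "a \<in> B \<Longrightarrow> b \<in> B \<Longrightarrow> a * b \<in> B"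
    and subring_neg: "a \<in> B \<Longrightarrow> - a \<in> B"
proof -
  show hom: "\<kappa> c \<in> B" for c
    using assms unfolding subring_def by blast
  show zero: "0 \<in> B" and "1 \<in> B"
    using hom[of 0] hom[of 1] by (simp_all add: hom_zero hom_one)
  show "a \<in> B \<Longrightarrow> b \<in> B \<Longrightarrow> a + b \<in> B" "a \<in> B \<Longrightarrow> b \<in> B \<Longrightarrow> a * b \<in> B"
    and diff: "a \<in> B \<Longrightarrow> b \<in> B \<Longrightarrow> a - b \<in> B" for a b
    using assms unfolding subring_def by blast+
  show "a \<in> B \<Longrightarrow> - a \<in> B"
    using diff[of 0 a] zero by simp
qed

lemma subring_power: "subring B \<Longrightarrow> a \<in> B \<Longrightarrow> a ^ n \<in> B"
  by (induction n) (auto intro: subring_1 subring_mult)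

lemma subring_sum: "subring B \<Longrightarrow> (\<And>i. i \<in> I \<Longrightarrow> v i \<in> B) \<Longrightarrow> (\<Sum>i\<in>I. v i) \<in> B"
  by (induction I rule: infinite_finite_induct) (auto intro: subring_0 subring_add)

lemma subring_ev: "subring B \<Longrightarrow> u \<in> B \<Longrightarrow> ev u p \<in> B"
  by (induction p) (auto intro: subring_0 subring_hom subring_add subring_mult)

lemma subring_range_ev: "subring (range (ev u))"
  unfolding subring_def
proof (intro conjI ballI subsetI)
  fix a assume "a \<in> range \<kappa>"
  then obtain c where "a = ev u [:c:]" by auto
  then show "a \<in> range (ev u)" by blast
next
  fix a b assume "a \<in> range (ev u)" "b \<in> range (ev u)"
  then obtain p q where "a = ev u p" "b = ev u q" by blast
  then have "a + b = ev u (p + q)" "a - b = ev u (p - q)" "a * b = ev u (p * q)"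
    by simp_all
  then show "a + b \<in> range (ev u)" "a - b \<in> range (ev u)" "a * b \<in> range (ev u)"
    by blast+
qed

lemma subring_subspace: "subring B \<Longrightarrow> subspace B"
  unfolding subspace_def by (auto intro: subring_0 subring_add subring_mult subring_hom)

text \<open>The ring B[u] filtered by degree. The degree is kept as a parameter because the
  extension theorem below is an induction on degrees in u and in \<open>inverse u\<close>.\<close>

definition polys_le :: "'f set \<Rightarrow> nat \<Rightarrow> 'f \<Rightarrow> 'f set" where
  "polys_le B n u = {(\<Sum>i\<le>n. a i * u ^ i) | a. \<forall>i. a i \<in> B}"

lemma polys_le_0: "polys_le B 0 u = B"
proof
  show "B \<subseteq> polys_le B 0 u"
  proof
    fix b assume "b \<in> B"
    then show "b \<in> polys_le B 0 u"
      unfolding polys_le_def by (intro CollectI exI[of _ "\<lambda>_. b"]) simp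
  qed
qed (auto simp: polys_le_def)

lemma polys_le_add:
  assumes "subring B" "s \<in> polys_le B n u" "s' \<in> polys_le B n u"
  shows "s + s' \<in> polys_le B n u"
proof -
  obtain a b where "s = (\<Sum>i\<le>n. a i * u ^ i)" "s' = (\<Sum>i\<le>n. b i * u ^ i)"
    "\<forall>i. a i \<in> B" "\<forall>i. b i \<in> B"
    using assms(2,3) unfolding polys_le_def by blast
  then have "s + s' = (\<Sum>i\<le>n. (a i + b i) * u ^ i)" "\<forall>i. a i + b i \<in> B"
    using subring_add[OF assms(1)] by (auto simp: sum.distrib distrib_right)
  then show ?thesis
    unfolding polys_le_def by (intro CollectI exI[of _ "\<lambda>i. a i + b i"]) simp
qed

lemma polys_le_mult:
  assumes "subring B" "s \<in> polys_le B n u" "b \<in> B"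
  shows "b * s \<in> polys_le B n u"
proof -
  obtain a where "s = (\<Sum>i\<le>n. a i * u ^ i)" "\<forall>i. a i \<in> B"
    using assms(2) unfolding polys_le_def by blast
  then have "b * s = (\<Sum>i\<le>n. (b * a i) * u ^ i)" "\<forall>i. b * a i \<in> B"
    using subring_mult[OF assms(1,3)] by (auto simp: sum_distrib_left mult.assoc)
  then show ?thesis
    unfolding polys_le_def by (intro CollectI exI[of _ "\<lambda>i. b * a i"]) simp
qed

lemma polys_le_monom:
  assumes "subring B" "b \<in> B" "i \<le> n"
  shows "b * u ^ i \<in> polys_le B n u"
proof -
  have "(\<Sum>j\<le>n. (if j = i then b else 0) * u ^ j) = (\<Sum>j\<in>{i}. b * u ^ j)"
    using assms(3) by (intro sum.mono_neutral_cong_right) auto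
  then show ?thesis
    unfolding polys_le_def
    using assms subring_0 by (intro CollectI exI[of _ "\<lambda>j. if j = i then b else 0"]) simp
qed

lemma polys_le_sum:
  assumes "subring B" "\<And>i. i \<in> I \<Longrightarrow> s i \<in> polys_le B n u"
  shows "(\<Sum>i\<in>I. s i) \<in> polys_le B n u"
  using assms(2)
proof (induction I rule: infinite_finite_induct)
  case empty
  show ?case
    using polys_le_monom[OF assms(1) subring_0[OF assms(1)], of 0 n u] by simp
next
  case (infinite A)
  then show ?case
    using polys_le_monom[OF assms(1) subring_0[OF assms(1)], of 0 n u] by simp
qed (auto intro: polys_le_add[OF assms(1)])

lemma polys_le_mono:
  assumes "subring B" "m \<le> n"
  shows "polys_le B m u \<subseteq> polys_le B n u"
  unfolding polys_le_def[of B m]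
  using assms by (auto intro!: polys_le_sum polys_le_monom)

text \<open>Let z = \<open>inverse m\<close>. Multiplying its expression in powers of
  \<open>inverse u\<close> by m u^(n+1) gives u^(n+1) (1 - m b_0) = m s with s of degree at most n
  in u. Inserting the expression of z in powers of u on the right of z = b_0 + (1 - m b_0) z then
  turns the term of degree n + 1 into one of lower degree.\<close>

lemma polys_le_reduce:
  assumes B: "subring B" and m: "m \<in> B" "m \<noteq> 0" and u: "u \<noteq> 0"
    and n: "inverse m \<in> polys_le B (Suc n) u"
    and k: "inverse m \<in> polys_le B k (inverse u)" "k \<le> Suc n"
  shows "inverse m \<in> polys_le B n u"
proof -
  define z where "z = inverse m"
  have mz: "m * z = 1"
    using m by (simp add: z_def)
  obtain a where a: "z = (\<Sum>i\<le>Suc n. a i * u ^ i)" "\<forall>i. a i \<in> B"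
    using n unfolding polys_le_def z_def by blast
  obtain b where b: "z = (\<Sum>i\<le>k. b i * inverse u ^ i)" "\<forall>i. b i \<in> B"
    using k(1) unfolding polys_le_def z_def by blast
  define p where "p = (\<Sum>i\<le>n. a i * u ^ i)"
  have p: "p \<in> polys_le B n u"
    using a(2) unfolding p_def polys_le_def by blast
  have zp: "z = p + a (Suc n) * u ^ Suc n"
    using a(1) by (simp add: p_def)
  define s where "s = (\<Sum>i\<in>{1..k}. b i * u ^ (Suc n - i))"
  have s: "s \<in> polys_le B n u"
    unfolding s_def using b(2) by (intro polys_le_sum[OF B] polys_le_monom[OF B]) auto
  have "u ^ Suc n * z = (\<Sum>i\<le>k. b i * u ^ (Suc n - i))"
    unfolding b(1) sum_distrib_left
    using u k(2) by (intro sum.cong refl) (simp add: power_diff field_simps power_inverse)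
  also have "\<dots> = b 0 * u ^ Suc n + s"
  proof -
    have "{..k} = insert 0 {1..k}" by auto
    then show ?thesis unfolding s_def by simp
  qed
  finally have "m * s = u ^ Suc n * (m * z) - m * b 0 * u ^ Suc n"
    by (simp add: algebra_simps)
  then have uz: "u ^ Suc n * (1 - m * b 0) = m * s"
    unfolding mz by (simp add: algebra_simps)
  have "(1 - m * b 0) * z = z - b 0 * (m * z)"
    by (simp add: algebra_simps)
  then have "z = b 0 + (1 - m * b 0) * z"
    unfolding mz by simp
  also have "\<dots> = b 0 + (1 - m * b 0) * p + a (Suc n) * (u ^ Suc n * (1 - m * b 0))"
    unfolding arg_cong[OF zp, of "\<lambda>z. (1 - m * b 0) * z"] by (simp add: algebra_simps)
  also have "\<dots> = b 0 * u ^ 0 + ((1 - m * b 0) * p + (a (Suc n) * m) * s)"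
    unfolding uz by (simp add: algebra_simps)
  also have "\<dots> \<in> polys_le B n u"
    using a(2) b(2) m p s subringD[OF B]
    by (intro polys_le_add[OF B] polys_le_monom[OF B] polys_le_mult[OF B]) auto
  finally show ?thesis
    unfolding z_def .
qed

text \<open>The roles of u and \<open>inverse u\<close> are symmetric, so
  \<open>polys_le_reduce\<close> can always lower the larger of the two degrees. At degree 0 the
  element lies in B.\<close>

lemma polys_le_unit_imp:
  assumes B: "subring B" and m: "m \<in> B" "m \<noteq> 0" and u: "u \<noteq> 0"
    and n: "inverse m \<in> polys_le B n u" and k: "inverse m \<in> polys_le B k (inverse u)"
  shows "inverse m \<in> B"
  using n k u
proof (induction "n + k" arbitrary: n k u rule: less_induct)
  case less
  have *: ?case if "k \<le> n" "inverse m \<in> polys_le B n u" "inverse m \<in> polys_le B k (inverse u)"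
    "u \<noteq> 0" "\<And>n' k' u. n' + k' < n + k \<Longrightarrow> inverse m \<in> polys_le B n' u \<Longrightarrow>
       inverse m \<in> polys_le B k' (inverse u) \<Longrightarrow> u \<noteq> 0 \<Longrightarrow> inverse m \<in> B" for n k u
  proof (cases n)
    case 0
    then show ?thesis using that(2) by (simp add: polys_le_0)
  next
    case (Suc n')
    then have "inverse m \<in> polys_le B n' u"
      using polys_le_reduce[OF B m that(4)] that by blast
    then show ?thesis
      using that(5)[of n' k u] Suc that by simp
  qed
  show ?case
  proof (cases "k \<le> n")
    case True
    show ?thesis
      by (rule *[OF True less.prems(1,2,3) less.hyps])
  next
    case False
    have 1: "inverse m \<in> polys_le B n (inverse (inverse u))" and 2: "inverse u \<noteq> 0"
      using less.prems by simp_all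
    have 3: "inverse m \<in> B" if "n' + k' < k + n" "inverse m \<in> polys_le B n' v"
      "inverse m \<in> polys_le B k' (inverse v)" "v \<noteq> 0" for n' k' v
      by (rule less.hyps[OF _ that(2-4)]) (use that(1) in simp)
    show ?thesis
      by (rule *[OF _ less.prems(2) 1 2 3]) (use False in simp)
  qed
qed

lemma subring_polys: "subring B \<Longrightarrow> subring (\<Union>n. polys_le B n u)"
  unfolding subring_def[of "\<Union>n. polys_le B n u"]
proof (intro conjI ballI subsetI)
  assume B: "subring B"
  show "c \<in> range \<kappa> \<Longrightarrow> c \<in> (\<Union>n. polys_le B n u)" for c
    using polys_le_0[of B u] subring_hom[OF B] by blast
  fix a b assume "a \<in> (\<Union>n. polys_le B n u)" "b \<in> (\<Union>n. polys_le B n u)"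
  then obtain n k where nk: "a \<in> polys_le B n u" "b \<in> polys_le B k u" by blast
  then have ab: "a \<in> polys_le B (n + k) u" "b \<in> polys_le B (n + k) u"
    using polys_le_mono[OF B, of n "n + k" u] polys_le_mono[OF B, of k "n + k" u] by auto
  then show "a + b \<in> (\<Union>n. polys_le B n u)"
    using polys_le_add[OF B] by blast
  have "- b \<in> polys_le B (n + k) u"
    using polys_le_mult[OF B ab(2), of "- 1"] subring_neg[OF B subring_1[OF B]] by simp
  then show "a - b \<in> (\<Union>n. polys_le B n u)"
    using polys_le_add[OF B ab(1)] by fastforce
  obtain c d where cd: "a = (\<Sum>i\<le>n. c i * u ^ i)" "b = (\<Sum>i\<le>k. d i * u ^ i)"
    "\<forall>i. c i \<in> B" "\<forall>i. d i \<in> B"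
    using nk unfolding polys_le_def by blast
  have "a * b = (\<Sum>i\<le>n. \<Sum>j\<le>k. (c i * d j) * u ^ (i + j))"
    unfolding cd by (simp add: sum_product power_add algebra_simps)
  also have "\<dots> \<in> polys_le B (n + k) u"
    using cd subring_mult[OF B] by (intro polys_le_sum[OF B] polys_le_monom[OF B]) auto
  finally show "a * b \<in> (\<Union>n. polys_le B n u)" by blast
qed

lemma valuation_ring_subring: "valuation_ring R \<Longrightarrow> subring R"
  unfolding valuation_ring_def subring_def by blast

text \<open>A subring that is maximal among those in which \<open>m\<close> is not invertible is a valuation ring.\<close>

lemma exists_valuation_ring:
  assumes A: "subring A" and m: "m \<in> A" "m \<noteq> 0" "inverse m \<notin> A"
  shows "\<exists>R. valuation_ring R \<and> A \<subseteq> R \<and> inverse m \<notin> R"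
proof -
  define \<A> where "\<A> = {B. subring B \<and> A \<subseteq> B \<and> inverse m \<notin> B}"
  have "\<exists>M\<in>\<A>. \<forall>X\<in>\<A>. M \<subseteq> X \<longrightarrow> X = M"
  proof (rule subset_Zorn_nonempty)
    show "\<A> \<noteq> {}"
      using A m unfolding \<A>_def by blast
    fix C assume C: "C \<noteq> {}" "subset.chain \<A> C"
    have CA: "subring X" "A \<subseteq> X" "inverse m \<notin> X" if "X \<in> C" for X
      using C(2) that unfolding subset_chain_def \<A>_def by auto
    have chain: "X \<subseteq> Y \<or> Y \<subseteq> X" if "X \<in> C" "Y \<in> C" for X Y
      using C(2) that unfolding subset_chain_def by blast
    have "subring (\<Union> C)"
      unfolding subring_def
    proof (intro conjI ballI subsetI)
      fix c assume "c \<in> range \<kappa>"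
      then show "c \<in> \<Union> C"
        using C(1) CA(1) subring_hom by auto
    next
      fix a b assume "a \<in> \<Union> C" "b \<in> \<Union> C"
      then obtain X Y where XY: "X \<in> C" "Y \<in> C" "a \<in> X" "b \<in> Y" by blast
      then obtain Z where Z: "Z \<in> C" "a \<in> Z" "b \<in> Z"
        using chain[of X Y] by blast
      then show "a + b \<in> \<Union> C" "a - b \<in> \<Union> C" "a * b \<in> \<Union> C"
        using subring_add[OF CA(1)[OF Z(1)] Z(2,3)] subring_diff[OF CA(1)[OF Z(1)] Z(2,3)]
          subring_mult[OF CA(1)[OF Z(1)] Z(2,3)] by auto
    qed
    moreover have "A \<subseteq> \<Union> C" "inverse m \<notin> \<Union> C"
      using C(1) CA(2,3) by (meson UnionE Union_upper all_not_in_conv order_trans)+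
    ultimately show "\<Union> C \<in> \<A>"
      unfolding \<A>_def by simp
  qed
  then obtain R where R: "subring R" "A \<subseteq> R" "inverse m \<notin> R"
    and max: "\<And>X. subring X \<Longrightarrow> inverse m \<notin> X \<Longrightarrow> R \<subseteq> X \<Longrightarrow> X = R"
    unfolding \<A>_def using order_trans[of A] by auto
  have mR: "m \<in> R"
    using m R by blast
  \<comment> \<open>By maximality, the strictly larger ring R[u] must contain the inverse of
    m.\<close>
  have adj: "\<exists>n. inverse m \<in> polys_le R n u" if u: "u \<notin> R" for u
  proof (rule ccontr)
    assume "\<nexists>n. inverse m \<in> polys_le R n u"
    then have "(\<Union>n. polys_le R n u) = R"
      using polys_le_0[of R u] by (intro max[OF subring_polys[OF R(1)]]) auto
    moreover have "u \<in> polys_le R 1 u"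
      using polys_le_monom[OF R(1) subring_1[OF R(1)], of 1 1 u] by simp
    ultimately show False
      using u by blast
  qed
  have "u \<in> R \<or> inverse u \<in> R" if u: "u \<noteq> 0" for u
    using adj[of u] adj[of "inverse u"] polys_le_unit_imp[OF R(1) mR m(2) u] R(3) by auto
  \<comment> \<open>A valuation ring has to contain K properly. The element m is a witness, as the
    inverse of a constant would lie in R.\<close>
  moreover have "m \<notin> range \<kappa>"
    using R(3) subring_hom[OF R(1)] by (auto simp flip: hom_inverse)
  ultimately have "valuation_ring R"
    using R(1,3) mR unfolding valuation_ring_def subring_def by auto
  then show ?thesis
    using R by blast
qed

section \<open>A valuation ring and its maximal ideal\<close>

context
  fixes R assumes R: "valuation_ring R"
begin

lemma ring_units_iff: "u \<in> ring_units R \<longleftrightarrow> u \<noteq> 0 \<and> u \<in> R \<and> inverse u \<in> R"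
proof -
  have "v = inverse u" if "u * v = 1" for v
    using inverse_unique[OF that] by simp
  then show ?thesis
    unfolding ring_units_def by force
qed

lemma valuation_ring_cases: "u \<noteq> 0 \<Longrightarrow> u \<in> R \<or> inverse u \<in> R"
  using R unfolding valuation_ring_def by blast

lemma place_ring_nonunits: "place_ring (R - ring_units R) = R"
  using valuation_ring_cases subring_0[OF valuation_ring_subring[OF R]]
  unfolding place_ring_def by (auto simp: ring_units_iff) (metis inverse_inverse_eq)

lemma nonunits_in_places: "R - ring_units R \<in> places"
  using R unfolding places_def by blast

end

context
  fixes P assumes P: "P \<in> places"
begin

lemma place_valuation_ring: "valuation_ring (place_ring P)"
  using P place_ring_nonunits unfolding places_def by auto

lemma place_eq_nonunits: "P = place_ring P - ring_units (place_ring P)"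
  using P place_ring_nonunits unfolding places_def by auto

lemma subring_place_ring: "subring (place_ring P)"
  using place_valuation_ring valuation_ring_subring by blast

lemma place_iff: "u \<in> P \<longleftrightarrow> u = 0 \<or> u \<in> place_ring P \<and> inverse u \<notin> place_ring P"
proof -
  have "u \<in> P \<longleftrightarrow> u \<in> place_ring P - ring_units (place_ring P)"
    using place_eq_nonunits by simp
  then show ?thesis
    using ring_units_iff[OF place_valuation_ring] subring_0[OF subring_place_ring] by auto
qed

lemma place_ring_cases: "u \<noteq> 0 \<Longrightarrow> u \<in> place_ring P \<or> inverse u \<in> P"
  unfolding place_ring_def by blast

lemma place_subset: "P \<subseteq> place_ring P"
  using place_eq_nonunits by blast

lemma one_notin_place: "1 \<notin> P"
  using place_iff[of 1] subring_1[OF subring_place_ring] by simp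

lemma place_mult: assumes "u \<in> place_ring P" "v \<in> P" shows "u * v \<in> P"
proof (cases "u * v = 0")
  case False
  have "inverse (u * v) \<notin> place_ring P"
  proof
    assume "inverse (u * v) \<in> place_ring P"
    then have "u * inverse (u * v) \<in> place_ring P"
      using assms subring_mult[OF subring_place_ring] by blast
    moreover have "u * inverse (u * v) = inverse v"
      using False by (simp add: mult.assoc[symmetric])
    ultimately show False
      using assms False place_iff[of v] by (metis mult_zero_right)
  qed
  then show ?thesis
    using assms place_subset place_iff[of "u * v"] subring_mult[OF subring_place_ring] by blast
qed (simp add: place_iff)

text \<open>One of u / v and v / u lies in the valuation ring, so the sum is a ring multiple of one
  of the summands.\<close>

lemma place_add: assumes "u \<in> P" "v \<in> P" shows "u + v \<in> P"
proof -
  have aux: "a + b \<in> P" if "a \<in> P" "b \<in> P" "b \<noteq> 0" "a / b \<in> place_ring P" for a b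
  proof -
    have "(a / b + 1) * b \<in> P"
      using that subring_add[OF subring_place_ring] subring_1[OF subring_place_ring]
      by (intro place_mult) auto
    then show ?thesis
      using that by (simp add: distrib_right)
  qed
  show ?thesis
  proof (cases "u = 0 \<or> v = 0")
    case False
    then show ?thesis
      using aux[of u v] aux[of v u] assms valuation_ring_cases[OF place_valuation_ring, of "u / v"]
      by (auto simp: add.commute)
  qed (use assms in auto)
qed

lemma place_minus: "u \<in> P \<Longrightarrow> - u \<in> P"
  using place_mult[of "- 1" u] subring_neg[OF subring_place_ring subring_1[OF subring_place_ring]]
  by simp

lemma place_diff: "u \<in> P \<Longrightarrow> v \<in> P \<Longrightarrow> u - v \<in> P"
  using place_add[of u "- v"] place_minus[of v] by simp

lemma place_sum: "(\<And>i. i \<in> I \<Longrightarrow> v i \<in> P) \<Longrightarrow> (\<Sum>i\<in>I. v i) \<in> P"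
  using place_iff[of 0] by (induction I rule: infinite_finite_induct) (auto intro: place_add)

lemma place_prime: "u * v \<in> P \<Longrightarrow> u \<in> place_ring P \<Longrightarrow> u \<notin> P \<Longrightarrow> v \<in> P"
  using place_mult[of "inverse u" "u * v"] place_iff[of u] by (auto simp: field_simps)

lemma hom_in_place_iff: "\<kappa> c \<in> P \<longleftrightarrow> c = 0"
  using place_iff[of "\<kappa> c"] subring_hom[OF subring_place_ring, of "inverse c"]
  by (auto simp: hom_inverse)

lemma subspace_place_ring: "subspace (place_ring P)"
  using subring_subspace subring_place_ring by blast

lemma subspace_place: "subspace P"
  unfolding subspace_def
  using place_add place_mult subring_hom[OF subring_place_ring] place_iff[of 0] by auto

end

end

section \<open>Independence over rational functions\<close>

text \<open>The ideal generated by p and q is generated by its nonzero element d of least degree;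
  cancelling d leaves a Bezout identity for the cofactors.\<close>

lemma poly_bezout_decomposition:
  fixes p q :: "'k::field poly"
  assumes "q \<noteq> 0"
  shows "\<exists>d p' q' s t. p = d * p' \<and> q = d * q' \<and> s * p' + t * q' = 1"
proof -
  define J where "J = {s * p + t * q | s t. True}"
  have "q \<in> J"
    unfolding J_def by (intro CollectI exI[of _ 0] exI[of _ 1]) simp
  then obtain d where d: "d \<in> J" "d \<noteq> 0" and min: "\<And>e. e \<in> J \<Longrightarrow> e \<noteq> 0 \<Longrightarrow> degree d \<le> degree e"
    using ex_has_least_nat[of "\<lambda>d. d \<in> J \<and> d \<noteq> 0" q degree] assms by blast
  obtain s t where st: "d = s * p + t * q"
    using d(1) unfolding J_def by blast
  have dvd: "d dvd e" if "e \<in> J" for e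
  proof -
    obtain s' t' where e: "e = s' * p + t' * q"
      using \<open>e \<in> J\<close> unfolding J_def by blast
    have "e mod d = e - (e div d) * d"
      by (simp add: minus_div_mult_eq_mod)
    also have "\<dots> = (s' - (e div d) * s) * p + (t' - (e div d) * t) * q"
      unfolding st[of] by (subst (1) e) (simp add: algebra_simps)
    finally have "e mod d \<in> J"
      unfolding J_def by blast
    then have "e mod d = 0"
      using min degree_mod_less[OF d(2), of e] by fastforce
    then show ?thesis
      by (simp add: dvd_eq_mod_eq_0)
  qed
  have "p \<in> J"
    unfolding J_def by (intro CollectI exI[of _ 1] exI[of _ 0]) simp
  then obtain p' q' where pq: "p = d * p'" "q = d * q'"
    using dvd \<open>q \<in> J\<close> by (meson dvdE)
  have "d * (s * p' + t * q') = d * 1"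
    using st pq by (simp add: algebra_simps)
  then have "s * p' + t * q' = 1"
    using d(2) by (simp only: mult_cancel_left) simp
  then show ?thesis
    using pq by blast
qed

context field_extension
begin

text \<open>An automorphism over K(u) of order at most two. In a group of type (Z/2)^3 every element
  has this form, and the last clause also provides bijectivity.\<close>

definition involution_fixing :: "'f \<Rightarrow> ('f \<Rightarrow> 'f) \<Rightarrow> bool" where
  "involution_fixing u \<tau> \<longleftrightarrow> (\<forall>a b. \<tau> (a + b) = \<tau> a + \<tau> b \<and> \<tau> (a * b) = \<tau> a * \<tau> b) \<and>
     (\<forall>c. \<tau> (\<kappa> c) = \<kappa> c) \<and> \<tau> u = u \<and> (\<forall>a. \<tau> (\<tau> a) = a)"

definition rational_functions :: "'f \<Rightarrow> 'f set" where
  "rational_functions u = {ev u p / ev u q | p q. q \<noteq> 0}"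

lemma ev_sum_coeff:
  assumes "degree p \<le> n"
  shows "ev u p = (\<Sum>j\<le>n. \<kappa> (coeff p j) * u ^ j)"
  unfolding ev_altdef using assms
  by (intro sum.mono_neutral_left) (auto simp: coeff_eq_0 hom_zero)

end

section \<open>The rational function field K(x)\<close>

locale transcendental_extension = field_extension \<kappa> for \<kappa> :: "'k::field \<Rightarrow> 'f::field" +
  fixes x :: 'f
  assumes transcendental_x: "transcendental x"
begin

lemma ev_eq_0_iff [simp]: "ev x p = 0 \<longleftrightarrow> p = 0"
  using transcendental_ev_eq_0_iff transcendental_x .

lemma ev_eq_iff: "ev x p = ev x q \<longleftrightarrow> p = q"
  using ev_eq_0_iff[of "p - q"] by (simp del: ev_eq_0_iff)

lemma x_neq_0: "x \<noteq> 0"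
  using ev_eq_0_iff[of "[:0, 1:]"] by (simp del: ev_eq_0_iff add: hom_one hom_zero)

abbreviation Kx :: "'f set" where "Kx \<equiv> rational_functions x"

lemma KxI: "q \<noteq> 0 \<Longrightarrow> ev x p / ev x q \<in> Kx"
  unfolding rational_functions_def by blast

lemma KxE:
  assumes "r \<in> Kx"
  obtains p q where "q \<noteq> 0" "r = ev x p / ev x q"
  using assms unfolding rational_functions_def by blast

lemma ev_in_Kx: "ev x p \<in> Kx"
  using KxI[of 1 p] by simp

lemma Kx_mult: assumes "r \<in> Kx" "s \<in> Kx" shows "r * s \<in> Kx"
proof -
  obtain p q p' q' where "q \<noteq> 0" "r = ev x p / ev x q" "q' \<noteq> 0" "s = ev x p' / ev x q'"
    using assms by (elim KxE)
  then show ?thesis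
    using KxI[of "q * q'" "p * p'"] by simp
qed

lemma Kx_add: assumes "r \<in> Kx" "s \<in> Kx" shows "r + s \<in> Kx"
proof -
  obtain p q p' q' where "q \<noteq> 0" "r = ev x p / ev x q" "q' \<noteq> 0" "s = ev x p' / ev x q'"
    using assms by (elim KxE)
  then show ?thesis
    using KxI[of "q * q'" "p * q' + p' * q"] by (simp add: add_frac_eq)
qed

lemma Kx_inverse: assumes "r \<in> Kx" shows "inverse r \<in> Kx"
proof -
  obtain p q where "q \<noteq> 0" "r = ev x p / ev x q"
    using assms by (elim KxE)
  then show ?thesis
    using KxI[of p q] ev_in_Kx[of 0] by (cases "p = 0") auto
qed

lemma Kx_coprime:
  assumes "r \<in> Kx"
  shows "\<exists>p q s t. q \<noteq> 0 \<and> r = ev x p / ev x q \<and> s * p + t * q = 1"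
proof -
  obtain p q where pq: "q \<noteq> 0" "r = ev x p / ev x q"
    using assms by (elim KxE)
  obtain d p' q' s t where "p = d * p'" "q = d * q'" "s * p' + t * q' = 1"
    using poly_bezout_decomposition[OF pq(1)] by blast
  then show ?thesis
    using pq by (intro exI[of _ p'] exI[of _ q'] exI[of _ s] exI[of _ t]) auto
qed

text \<open>Integral closedness in disguise: if h = p / q in lowest terms, then the square of q
  divides p^2 D and hence D, which for squarefree D makes q a unit.\<close>

lemma Kx_square_integral:
  assumes h: "h \<in> Kx" and D: "\<And>q. q ^ 2 dvd D \<Longrightarrow> q dvd 1" and m: "h ^ 2 * ev x D = ev x m"
  shows "\<exists>p. h = ev x p"
proof -
  obtain p q s t where pq: "q \<noteq> 0" "h = ev x p / ev x q" "s * p + t * q = 1"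
    using Kx_coprime[OF h] by blast
  have "ev x (p ^ 2 * D) = ev x (q ^ 2 * m)"
    using m pq by (simp add: power_divide field_simps)
  then have e: "p ^ 2 * D = q ^ 2 * m"
    using ev_eq_iff by blast
  \<comment> \<open>The third power is chosen because each term of its expansion is divisible by p^2
    or by q^2.\<close>
  have "D = (s * p + t * q) ^ 3 * D"
    using pq(3) by simp
  also have "\<dots> = (s ^ 3 * p + 3 * s ^ 2 * t * q) * (p ^ 2 * D) + q ^ 2 * (3 * s * p * t ^ 2 + t ^ 3 * q) * D"
    by (simp add: algebra_simps power2_eq_square power3_eq_cube)
  also have "\<dots> = q ^ 2 * ((s ^ 3 * p + 3 * s ^ 2 * t * q) * m + (3 * s * p * t ^ 2 + t ^ 3 * q) * D)"
    unfolding e by (simp add: algebra_simps)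
  finally have "q ^ 2 dvd D"
    by (rule dvdI)
  then have "q dvd 1"
    using D by blast
  then obtain b where b: "1 = q * b" by (elim dvdE)
  have "ev x q * ev x b = 1"
    using arg_cong[OF b, of "ev x"] by simp
  then have "inverse (ev x q) = ev x b"
    by (rule inverse_unique)
  then have "h = ev x (p * b)"
    using pq(2) by (simp add: divide_inverse)
  then show ?thesis by blast
qed

text \<open>A root would be a polynomial p with D = p^2. Squarefreeness makes p a unit, against the
  positive degree of D.\<close>

lemma ev_not_square:
  assumes D: "\<And>q. q ^ 2 dvd D \<Longrightarrow> q dvd 1" "0 < degree D" and r: "r \<in> Kx"
  shows "r ^ 2 \<noteq> ev x D"
proof
  assume eq: "r ^ 2 = ev x D"
  have "q dvd 1" if "q ^ 2 dvd (1 :: 'k poly)" for q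
    using that by (rule dvd_trans[rotated]) (simp add: power2_eq_square)
  then obtain p where p: "r = ev x p"
    using Kx_square_integral[OF r, of 1 D] eq by auto
  then have "ev x D = ev x (p ^ 2)"
    using eq by simp
  then have "D = p ^ 2"
    by (simp only: ev_eq_iff)
  moreover have "p dvd 1"
    by (rule D(1)) (simp add: \<open>D = p ^ 2\<close>)
  ultimately have "D dvd 1"
    using mult_dvd_mono[of p 1 p 1] by (simp add: power2_eq_square)
  then show False
    using D(2) by (auto simp: is_unit_poly_iff)
qed

end

text \<open>The structure of G over K(x) on which genus and places depend. The \<open>w i\<close>
  are simultaneous eigenvectors of the involutions, and \<open>separating\<close> says that distinct
  indices have distinct characters; linear independence over K(x) follows from this in
  \<open>component_eq_0\<close>. Degrees are even so that \<open>w i\<close> has at most the pole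
  order of x^(g i) at infinity.\<close>

locale multiquadratic = transcendental_extension \<kappa> x
  for \<kappa> :: "'k::field \<Rightarrow> 'f::field" and x :: 'f +
  fixes I :: "'i set" and w :: "'i \<Rightarrow> 'f" and D :: "'i \<Rightarrow> 'k poly" and g :: "'i \<Rightarrow> nat"
  assumes two_neq_0: "(2::'k) \<noteq> 0"
    and finite_I: "finite I"
    and w_square: "i \<in> I \<Longrightarrow> w i ^ 2 = ev x (D i)"
    and D_squarefree: "i \<in> I \<Longrightarrow> q ^ 2 dvd D i \<Longrightarrow> q dvd 1"
    and degree_D: "i \<in> I \<Longrightarrow> degree (D i) = 2 * g i"
    and spanning: "\<exists>h. (\<forall>i\<in>I. h i \<in> rational_functions x) \<and> u = (\<Sum>i\<in>I. h i * w i)"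
    and separating: "i \<in> I \<Longrightarrow> j \<in> I \<Longrightarrow> i \<noteq> j \<Longrightarrow> \<exists>\<tau> s. involution_fixing x \<tau> \<and>
       (\<forall>k\<in>I. s k \<in> {1, - 1} \<and> \<tau> (w k) = s k * w k) \<and> s i \<noteq> s j"
begin

text \<open>A filtration of the K[x]-span of the \<open>w i\<close> by the degrees of the
  coefficients. It serves only for an upper bound on growth: its n-th space is spanned by card I *
  (n + 1) elements.\<close>

definition regular :: "nat \<Rightarrow> 'f set" where
  "regular n = {(\<Sum>i\<in>I. ev x (h i) * w i) | h. \<forall>i\<in>I. degree (h i) \<le> n}"

lemma regular_add:
  assumes "u \<in> regular n" "v \<in> regular n" shows "u + v \<in> regular n"
proof -
  obtain h h' where "u = (\<Sum>i\<in>I. ev x (h i) * w i)" "\<forall>i\<in>I. degree (h i) \<le> n"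
    "v = (\<Sum>i\<in>I. ev x (h' i) * w i)" "\<forall>i\<in>I. degree (h' i) \<le> n"
    using assms unfolding regular_def by blast
  then have "u + v = (\<Sum>i\<in>I. ev x (h i + h' i) * w i)" "\<forall>i\<in>I. degree (h i + h' i) \<le> n"
    by (auto simp: sum.distrib distrib_right intro: degree_add_le)
  then show ?thesis
    unfolding regular_def by (intro CollectI exI[of _ "\<lambda>i. h i + h' i"]) simp
qed

lemma regular_mult:
  assumes "u \<in> regular n" "degree p + n \<le> m" shows "ev x p * u \<in> regular m"
proof -
  obtain h where "u = (\<Sum>i\<in>I. ev x (h i) * w i)" "\<forall>i\<in>I. degree (h i) \<le> n"
    using assms unfolding regular_def by blast
  then have "ev x p * u = (\<Sum>i\<in>I. ev x (p * h i) * w i)" "\<forall>i\<in>I. degree (p * h i) \<le> m"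
    using assms(2) by (auto simp: sum_distrib_left mult.assoc intro!: order_trans[OF degree_mult_le])
  then show ?thesis
    unfolding regular_def by (intro CollectI exI[of _ "\<lambda>i. p * h i"]) simp
qed

lemma regular_0: "0 \<in> regular n"
  unfolding regular_def by (intro CollectI exI[of _ "\<lambda>_. 0"]) simp

lemma regular_w:
  assumes "i \<in> I" shows "ev x p * w i \<in> regular (degree p)"
proof -
  have "(\<Sum>k\<in>I. ev x (if k = i then p else 0) * w k) = (\<Sum>k\<in>{i}. ev x p * w k)"
    using assms finite_I by (intro sum.mono_neutral_cong_right) auto
  then show ?thesis
    unfolding regular_def by (intro CollectI exI[of _ "\<lambda>k. if k = i then p else 0"]) simp
qed

lemma regular_subset_span: "regular n \<subseteq> span ((\<lambda>(i, j). x ^ j * w i) ` (I \<times> {..n}))"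
proof
  fix u assume "u \<in> regular n"
  then obtain h where h: "u = (\<Sum>i\<in>I. ev x (h i) * w i)" "\<forall>i\<in>I. degree (h i) \<le> n"
    unfolding regular_def by blast
  have "u = (\<Sum>i\<in>I. \<Sum>j\<le>n. \<kappa> (coeff (h i) j) * (x ^ j * w i))"
    unfolding h(1) using h(2)
    by (intro sum.cong refl) (simp add: ev_sum_coeff[of _ n] sum_distrib_right mult.assoc)
  also have "\<dots> \<in> span ((\<lambda>(i, j). x ^ j * w i) ` (I \<times> {..n}))"
    by (intro span_sum span_scale span_base) auto
  finally show "u \<in> span ((\<lambda>(i, j). x ^ j * w i) ` (I \<times> {..n}))" .
qed

lemma denominator_add:
  assumes "G \<noteq> 0" "ev x G * u \<in> regular n" "G' \<noteq> 0" "ev x G' * v \<in> regular n'"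
  shows "\<exists>H m. H \<noteq> 0 \<and> ev x H * (u + v) \<in> regular m"
proof -
  let ?m = "n + n' + degree G + degree G'"
  have "ev x G' * (ev x G * u) \<in> regular ?m" "ev x G * (ev x G' * v) \<in> regular ?m"
    using assms by (auto intro: regular_mult)
  then have "ev x G' * (ev x G * u) + ev x G * (ev x G' * v) \<in> regular ?m"
    by (rule regular_add)
  then have "ev x (G * G') * (u + v) \<in> regular ?m"
    by (simp add: algebra_simps)
  then show ?thesis
    using assms by (intro exI[of _ "G * G'"] exI[of _ ?m]) simp
qed

lemma denominator: "\<exists>G n. G \<noteq> 0 \<and> ev x G * u \<in> regular n"
proof -
  obtain h where h: "\<forall>i\<in>I. h i \<in> Kx" "u = (\<Sum>i\<in>I. h i * w i)"
    using spanning by blast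
  have "\<exists>G n. G \<noteq> 0 \<and> ev x G * (\<Sum>i\<in>J. h i * w i) \<in> regular n" if "J \<subseteq> I" for J
    using finite_subset[OF that finite_I] that
  proof (induction J rule: finite_induct)
    case empty
    then show ?case
      using regular_0 by (auto intro!: exI[of _ 1])
  next
    case (insert i J)
    then obtain G n where G: "G \<noteq> 0" "ev x G * (\<Sum>i\<in>J. h i * w i) \<in> regular n"
      by blast
    obtain p q where pq: "q \<noteq> 0" "h i = ev x p / ev x q"
      using h(1) insert.prems KxE[of "h i"] by blast
    then have "ev x q * (h i * w i) \<in> regular (degree p)"
      using regular_w[of i p] insert.prems by simp
    then show ?case
      using denominator_add[OF pq(1) _ G] insert.hyps by simp
  qed
  then show ?thesis
    unfolding h(2) by blast
qed

lemma common_denominator: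
  assumes "finite X"
  shows "\<exists>G n. G \<noteq> 0 \<and> (\<forall>u\<in>X. ev x G * u \<in> regular n)"
  using assms
proof (induction X rule: finite_induct)
  case empty
  then show ?case
    by (auto intro!: exI[of _ 1])
next
  case (insert u X)
  then obtain G n G' n' where G: "G \<noteq> 0" "\<forall>v\<in>X. ev x G * v \<in> regular n"
    "G' \<noteq> 0" "ev x G' * u \<in> regular n'"
    using denominator[of u] by blast
  let ?m = "n + n' + degree G + degree G'"
  have "ev x (G * G') * v \<in> regular ?m" if v: "v \<in> insert u X" for v
  proof (cases "v = u")
    case True
    have "ev x G * (ev x G' * u) \<in> regular ?m"
      using G by (auto intro: regular_mult)
    then show ?thesis
      using True by (simp add: mult.assoc)
  next
    case False
    then have "ev x G' * (ev x G * v) \<in> regular ?m"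
      using G v by (auto intro: regular_mult)
    then show ?thesis
      by (simp add: mult_ac)
  qed
  then show ?case
    using G by (intro exI[of _ "G * G'"] exI[of _ ?m]) simp
qed

text \<open>
  The classical bound \<open>[F : K(r)]\<close> for the number of elements that are independent over \<open>K[r]\<close>,
  read off from the growth of the spaces \<^term>\<open>regular n\<close>.
\<close>

lemma powers_indep:
  assumes S: "subspace S" "(*) r ` S \<subseteq> S" "r \<noteq> 0"
    and J: "finite J" "v ` J \<subseteq> S" "indep_mod ((*) r ` S) J v"
  shows "(\<Sum>j\<in>J. \<Sum>k\<le>n. \<kappa> (c j k) * (r ^ k * v j)) = 0 \<Longrightarrow> j \<in> J \<Longrightarrow> k \<le> n \<Longrightarrow> c j k = 0"
proof (induction n arbitrary: c j k)
  have 0: "0 \<in> (*) r ` S"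
    using S(1) unfolding subspace_def by (intro image_eqI[of _ _ 0]) auto
  case 0
  then show ?case
    using indep_modD[OF J(3), of "\<lambda>j. c j 0" j] \<open>0 \<in> (*) r ` S\<close> by simp
next
  case (Suc n)
  have rS: "r ^ k * s \<in> S" if "s \<in> S" for k s
    using that S(2) by (induction k) (auto simp: mult.assoc)
  \<comment> \<open>All terms with k > 0 are collected in r T. The terms with k = 0 then lie in r S
    and vanish by independence, and division by r leaves a relation with one power less.\<close>
  define T where "T = (\<Sum>j\<in>J. \<Sum>k\<le>n. \<kappa> (c j (Suc k)) * (r ^ k * v j))"
  have "T \<in> S"
    unfolding T_def using J(2) rS S(1)
    by (intro subspace_sum[OF S(1)] subspace_scale[OF S(1)] rS) auto
  have eq: "(\<Sum>j\<in>J. \<Sum>k\<le>Suc n. \<kappa> (c j k) * (r ^ k * v j)) = (\<Sum>j\<in>J. \<kappa> (c j 0) * v j) + r * T"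
    unfolding T_def sum.atMost_Suc_shift
    by (simp add: sum.distrib sum_distrib_left mult_ac)
  then have "(\<Sum>j\<in>J. \<kappa> (c j 0) * v j) = r * (- T)"
    using Suc.prems(1) by (simp add: eq_neg_iff_add_eq_0)
  moreover have "- T \<in> S"
    using subspace_neg[OF S(1) \<open>T \<in> S\<close>] .
  ultimately have "(\<Sum>j\<in>J. \<kappa> (c j 0) * v j) \<in> (*) r ` S"
    by blast
  then have c0: "c j 0 = 0" if "j \<in> J" for j
    using indep_modD[OF J(3), of "\<lambda>j. c j 0" j] that by simp
  then have "r * T = 0"
    using eq Suc.prems(1) by (simp add: hom_zero)
  then have "T = 0"
    using S(3) by simp
  then have "c j (Suc k) = 0" if "j \<in> J" "k \<le> n" for j k
    using Suc.IH[of "\<lambda>j k. c j (Suc k)"] that unfolding T_def by blast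
  then show ?case
    using c0 Suc.prems by (cases k) auto
qed

lemma indep_mod_rational_bound:
  assumes S: "subspace S" "(*) r ` S \<subseteq> S"
    and r: "r = ev x p / ev x q" "p \<noteq> 0" "q \<noteq> 0" "degree p \<le> d" "degree q \<le> d"
    and J: "finite J" "v ` J \<subseteq> S" "indep_mod ((*) r ` S) J v"
  shows "card J \<le> card I * d"
proof -
  have r0: "r \<noteq> 0"
    using r by simp
  obtain G E where G: "G \<noteq> 0" "\<forall>u\<in>v ` J. ev x G * u \<in> regular E"
    using common_denominator[of "v ` J"] J(1) by blast
  \<comment> \<open>The products r^k \<open>v j\<close> with k \<le> n are independent over K. The
    common factor G q^n moves them into \<open>regular (E + d * n)\<close>, whose dimension is
    bounded.\<close>
  have *: "card J * (n + 1) \<le> card I * (E + d * n + 1)" for n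
  proof -
    let ?b = "\<lambda>(j, k). r ^ k * v j * (ev x G * ev x q ^ n)"
    have "indep_mod {0} (J \<times> {..n}) ?b"
      unfolding indep_mod_def
    proof (intro allI impI ballI)
      fix c i assume s: "(\<Sum>i\<in>J \<times> {..n}. \<kappa> (c i) * ?b i) \<in> {0}" and i: "i \<in> J \<times> {..n}"
      have "(\<Sum>i\<in>J \<times> {..n}. \<kappa> (c i) * ?b i) =
          (\<Sum>j\<in>J. \<Sum>k\<le>n. \<kappa> (c (j, k)) * (r ^ k * v j)) * (ev x G * ev x q ^ n)"
        by (simp only: sum.cartesian_product sum_distrib_right) (auto intro!: sum.cong simp: mult_ac)
      then have "(\<Sum>j\<in>J. \<Sum>k\<le>n. \<kappa> (c (j, k)) * (r ^ k * v j)) = 0"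
        using s G r by simp
      then show "c i = 0"
        using powers_indep[OF S r0 J, where n = n and c = "\<lambda>j k. c (j, k)"] i by auto
    qed
    moreover have "r ^ k * v j * (ev x G * ev x q ^ n) \<in> regular (E + d * n)"
      if jk: "j \<in> J" "k \<in> {..n}" for j k
    proof -
      have "r ^ k * ev x q ^ n = (r * ev x q) ^ k * ev x q ^ (n - k)"
        using jk by (simp add: power_mult_distrib mult.assoc flip: power_add)
      then have "r ^ k * v j * (ev x G * ev x q ^ n) = ev x (p ^ k * q ^ (n - k)) * (ev x G * v j)"
        using r by (simp add: mult_ac)
      also have "\<dots> \<in> regular (E + d * n)"
      proof (rule regular_mult)
        have "degree (p ^ k * q ^ (n - k)) \<le> d * k + d * (n - k)"
          using degree_power_le[of p k] degree_power_le[of q "n - k"] r(4,5)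
          by (intro order_trans[OF degree_mult_le] add_mono)
             (auto intro: order_trans simp: mult.commute[of d] dest: mult_le_mono1)
        also have "\<dots> = d * n"
          using jk by (simp flip: distrib_left)
        finally show "degree (p ^ k * q ^ (n - k)) + E \<le> E + d * n" by simp
      qed (use G jk in auto)
      finally show ?thesis .
    qed
    then have "?b ` (J \<times> {..n}) \<subseteq> regular (E + d * n)"
      by auto
    ultimately have "card (J \<times> {..n}) \<le> card ((\<lambda>(i, j). x ^ j * w i) ` (I \<times> {..E + d * n}))"
      using J(1) finite_I regular_subset_span[of "E + d * n"]
      by (intro indep_mod_le_card_span[of _ ?b]) auto
    also have "\<dots> \<le> card (I \<times> {..E + d * n})"
      using finite_I by (intro card_image_le) auto
    finally show ?thesis
      using J(1) finite_I by (simp add: card_cartesian_product)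
  qed
  show ?thesis
  proof (rule ccontr)
    assume "\<not> card J \<le> card I * d"
    then have "(card I * d + 1) * (n + 1) \<le> card J * (n + 1)" for n
      by (intro mult_le_mono1) simp
    \<comment> \<open>Here n = card I * (E + 1). Beyond the common term card I * d * n the right
      side contributes exactly this n, the left side more.\<close>
    then have "(card I * d + 1) * (card I * (E + 1) + 1) \<le> card I * (E + d * (card I * (E + 1)) + 1)"
      using *[of "card I * (E + 1)"] order_trans by blast
    then show False
      by (simp add: algebra_simps)
  qed
qed

end

section \<open>Places are discrete\<close>

context multiquadratic
begin

context
  fixes P assumes P: "P \<in> places"
begin

private abbreviation "R \<equiv> place_ring P"

lemma square_in_place_ring: "u ^ 2 \<in> R \<Longrightarrow> u \<in> R"
proof (cases "u = 0")
  case False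
  assume u: "u ^ 2 \<in> R"
  show "u \<in> R"
  proof (rule ccontr)
    assume "u \<notin> R"
    then have "inverse u \<in> R"
      using False valuation_ring_cases[OF place_valuation_ring[OF P]] by blast
    then have "u ^ 2 * inverse u \<in> R"
      using u subring_mult[OF subring_place_ring[OF P]] by blast
    then show False
      using \<open>u \<notin> R\<close> False by (simp add: power2_eq_square mult.assoc)
  qed
qed (simp add: subring_0[OF subring_place_ring[OF P]])

text \<open>Each \<open>w i\<close> lies in B: if it is not in R then its inverse is, and
  \<open>w i\<close> equals \<open>ev x (D i)\<close> times this inverse.\<close>

lemma overring_eq_UNIV:
  assumes B: "subring B" "R \<subseteq> B" "Kx \<subseteq> B"
  shows "B = UNIV"
proof -
  have "w i \<in> B" if i: "i \<in> I" for i
  proof (cases "w i \<in> R")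
    case False
    then have "inverse (w i) \<in> R"
      using place_ring_cases[OF P, of "w i"] place_subset[OF P] subring_0[OF subring_place_ring[OF P]]
      by (cases "w i = 0") auto
    then have "ev x (D i) * inverse (w i) \<in> B"
      using B ev_in_Kx subring_mult[OF B(1)] by blast
    moreover have "ev x (D i) * inverse (w i) = w i"
      unfolding w_square[OF i, symmetric] power2_eq_square by (cases "w i = 0") simp_all
    ultimately show ?thesis by simp
  qed (use B in blast)
  note w = this
  have "u \<in> B" for u
  proof -
    obtain h where h: "\<forall>i\<in>I. h i \<in> Kx" "u = (\<Sum>i\<in>I. h i * w i)"
      using spanning by blast
    show ?thesis
      unfolding h(2) using h(1) B(3) w
      by (intro subring_sum[OF B(1)] subring_mult[OF B(1)]) auto
  qed
  then show ?thesis by blast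
qed

text \<open>A valuation ring that contains K(x) would be the whole field by
  \<open>overring_eq_UNIV\<close>. So every place contains a nonzero rational function, to which the
  degree bound applies.\<close>

lemma rational_in_place: "\<exists>r\<in>Kx. r \<in> P \<and> r \<noteq> 0"
proof -
  have "\<not> Kx \<subseteq> R"
    using overring_eq_UNIV[of R] place_valuation_ring[OF P] subring_place_ring[OF P]
    unfolding valuation_ring_def by blast
  then obtain r where r: "r \<in> Kx" "r \<notin> R" by blast
  then have "r \<noteq> 0" "inverse r \<in> P"
    using place_ring_cases[OF P, of r] subring_0[OF subring_place_ring[OF P]] by auto
  then show ?thesis
    using Kx_inverse[OF r(1)] by (intro bexI[of _ "inverse r"]) auto
qed

lemma place_ring_indep_bound:
  assumes r: "r \<in> Kx" "r \<in> P" "r \<noteq> 0"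
  shows "\<exists>M. \<forall>(J::'j set) v. finite J \<longrightarrow> v ` J \<subseteq> R \<longrightarrow> indep_mod ((*) r ` R) J v \<longrightarrow> card J \<le> M"
proof -
  obtain p q where pq: "q \<noteq> 0" "r = ev x p / ev x q"
    using r(1) by (elim KxE)
  have rR: "(*) r ` R \<subseteq> R"
    using r(2) place_subset[OF P] subring_mult[OF subring_place_ring[OF P]] by blast
  have "card J \<le> card I * (degree p + degree q)"
    if "finite J" "v ` J \<subseteq> R" "indep_mod ((*) r ` R) J v" for J :: "'j set" and v
    using pq r(3) that rR subspace_place_ring[OF P]
    by (intro indep_mod_rational_bound[of R r p q]) auto
  then show ?thesis by blast
qed

text \<open>Each member is a proper divisor in R of all earlier ones. In terms of the valuation that
  is yet to be constructed, the values decrease strictly.\<close>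

private definition divisor_chain :: "nat \<Rightarrow> (nat \<Rightarrow> 'f) \<Rightarrow> bool" where
  "divisor_chain m s \<longleftrightarrow> (\<forall>j\<le>m. s j \<in> R \<and> s j \<noteq> 0) \<and> (\<forall>j\<le>m. \<forall>i<j. s i / s j \<in> P)"

text \<open>The members after r are independent modulo r R: dividing a relation by
  \<open>s k\<close>, with k the largest index of a nonzero coefficient, would put a nonzero
  constant into P.\<close>

lemma chain_bound:
  assumes r: "r \<in> Kx" "r \<in> P" "r \<noteq> 0"
  shows "\<exists>M. \<forall>m s. s 0 = r \<longrightarrow> divisor_chain m s \<longrightarrow> m \<le> M"
proof -
  obtain M where M: "\<And>J v. finite (J :: nat set) \<Longrightarrow> v ` J \<subseteq> R \<Longrightarrow> indep_mod ((*) r ` R) J v \<Longrightarrow> card J \<le> M"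
    using place_ring_indep_bound[OF r] by blast
  have "m \<le> M" if s0: "s 0 = r" "divisor_chain m s" for m s
  proof -
    have s: "s 0 = r" "\<forall>j\<le>m. s j \<in> R \<and> s j \<noteq> 0" "\<forall>j\<le>m. \<forall>i<j. s i / s j \<in> P"
      using s0 unfolding divisor_chain_def by auto
    have "indep_mod ((*) r ` R) {1..m} s"
      unfolding indep_mod_def
    proof (intro allI impI, rule ccontr)
      fix c assume c: "(\<Sum>i\<in>{1..m}. \<kappa> (c i) * s i) \<in> (*) r ` R" "\<not> (\<forall>i\<in>{1..m}. c i = 0)"
      define k where "k = Max {i\<in>{1..m}. c i \<noteq> 0}"
      have k: "k \<in> {i\<in>{1..m}. c i \<noteq> 0}"
        unfolding k_def using c(2) by (intro Max_in) auto
      have zero: "c i = 0" if i: "i \<in> {1..m}" "k < i" for i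
      proof (rule ccontr)
        assume "c i \<noteq> 0"
        then have "i \<le> k"
          unfolding k_def using i by (intro Max_ge) auto
        then show False using i by simp
      qed
      obtain y where y: "y \<in> R" "(\<Sum>i\<in>{1..m}. \<kappa> (c i) * s i) = r * y"
        using c(1) by blast
      have "(\<Sum>i\<in>{1..m}. \<kappa> (c i) * s i) = (\<Sum>i\<in>{1..k}. \<kappa> (c i) * s i)"
        using k zero by (intro sum.mono_neutral_right) (auto simp: hom_zero)
      also have "{1..k} = insert k {1..<k}"
        using k by auto
      finally have "r * y = \<kappa> (c k) * s k + (\<Sum>i\<in>{1..<k}. \<kappa> (c i) * s i)"
        unfolding y(2) by (subst (asm) sum.insert) auto
      then have "\<kappa> (c k) * s k = r * y - (\<Sum>i\<in>{1..<k}. \<kappa> (c i) * s i)"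
        by simp
      then have "\<kappa> (c k) = (r * y - (\<Sum>i\<in>{1..<k}. \<kappa> (c i) * s i)) / s k"
        using s(2) k by (intro eq_divide_imp) auto
      also have "\<dots> = y * (s 0 / s k) - (\<Sum>i\<in>{1..<k}. \<kappa> (c i) * (s i / s k))"
        using s(1) by (simp add: diff_divide_distrib sum_divide_distrib)
      also have "\<dots> \<in> P"
        using s(3) k y subring_hom[OF subring_place_ring[OF P]]
        by (intro place_diff[OF P] place_mult[OF P] place_sum[OF P]) auto
      finally show False
        using k hom_in_place_iff[OF P] by simp
    qed
    then have "card {1..m} \<le> M"
      using s(2) by (intro M) auto
    then show ?thesis by simp
  qed
  then show ?thesis by blast
qed

text \<open>If P were not principal, every nonzero element of P would have a proper divisor in P.
  Iterating from a rational function r gives chains of any length, against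
  \<open>chain_bound\<close>.\<close>

lemma place_principal: "\<exists>t. t \<noteq> 0 \<and> P = (*) t ` R"
proof (rule ccontr)
  assume np: "\<nexists>t. t \<noteq> 0 \<and> P = (*) t ` R"
  obtain r where r: "r \<in> Kx" "r \<in> P" "r \<noteq> 0"
    using rational_in_place by blast
  obtain M where M: "\<And>m s. s 0 = r \<Longrightarrow> divisor_chain m s \<Longrightarrow> m \<le> M"
    using chain_bound[OF r] by blast
  have "\<exists>t'. t' \<in> P \<and> t' \<noteq> 0 \<and> t / t' \<in> P" if t: "t \<in> P" "t \<noteq> 0" for t
  proof -
    have "(*) t ` R \<subseteq> P"
      using t place_mult[OF P] by (auto simp: mult.commute)
    then obtain t' where t': "t' \<in> P" "t' \<notin> (*) t ` R"
      using np t(2) by blast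
    have "t' / t \<notin> R"
    proof
      assume "t' / t \<in> R"
      then have "t' \<in> (*) t ` R"
        using t(2) by (intro image_eqI[of _ _ "t' / t"]) auto
      then show False using t' by blast
    qed
    moreover have "t' \<noteq> 0"
      using t'(2) subring_0[OF subring_place_ring[OF P]] by force
    ultimately have "inverse (t' / t) \<in> P"
      using t(2) place_ring_cases[OF P, of "t' / t"] by auto
    then show ?thesis
      using t' \<open>t' \<noteq> 0\<close> by (auto simp: field_simps)
  qed
  then obtain next' where nx: "\<And>t. t \<in> P \<Longrightarrow> t \<noteq> 0 \<Longrightarrow> next' t \<in> P \<and> next' t \<noteq> 0 \<and> t / next' t \<in> P"
    by metis
  define s where "s n = (next' ^^ n) r" for n
  have s: "s n \<in> P \<and> s n \<noteq> 0" for n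
    unfolding s_def using r nx by (induction n) auto
  have step: "s n / s (Suc n) \<in> P" for n
    using nx s unfolding s_def by simp
  have "s i / s (i + Suc k) \<in> P" for i k
  proof (induction k)
    case (Suc k)
    have "s i / s (i + Suc k) * (s (i + Suc k) / s (Suc (i + Suc k))) \<in> P"
      using Suc step place_subset[OF P] by (intro place_mult[OF P]) auto
    then show ?case
      using s by simp
  qed (use step in simp)
  then have "s i / s j \<in> P" if "i < j" for i j
    using less_imp_Suc_add[OF that] by auto
  then have "Suc M \<le> M"
    using s place_subset[OF P] by (intro M[of s]) (auto simp: s_def divisor_chain_def)
  then show False by simp
qed

context
  fixes t assumes t: "t \<noteq> 0" "P = (*) t ` R"
begin

lemma uniformizer_in_place: "t \<in> P"
  using t(2) subring_1[OF subring_place_ring[OF P]] by force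

lemma uniformizer_power_in_place_ring: "t ^ n \<in> R"
  using subring_power[OF subring_place_ring[OF P]] uniformizer_in_place place_subset[OF P] by blast

lemma uniformizer_power_in_place: "0 < n \<Longrightarrow> t ^ n \<in> P"
  using place_mult[OF P uniformizer_power_in_place_ring[of "n - 1"] uniformizer_in_place]
  by (cases n) (simp_all add: mult.commute)

lemma unit_power_decomposition:
  assumes u: "u \<in> R" "u \<noteq> 0" and bound: "\<And>n y. y \<in> R \<Longrightarrow> u = t ^ n * y \<Longrightarrow> n \<le> M"
  shows "\<exists>n e. e \<in> ring_units R \<and> u = t ^ n * e"
proof -
  let ?Q = "\<lambda>n. \<exists>y\<in>R. u = t ^ n * y"
  have "?Q (Greatest ?Q)"
    by (rule GreatestI_nat[of ?Q 0 M]) (use u bound in auto)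
  then obtain n y where n: "n = Greatest ?Q" and y: "y \<in> R" "u = t ^ n * y" by blast
  have "y \<notin> P"
  proof
    assume "y \<in> P"
    then obtain y' where "y = t * y'" "y' \<in> R"
      using t(2) by blast
    then have "?Q (Suc n)"
      using y by (auto simp: mult_ac)
    then have "Suc n \<le> n"
      unfolding n by (rule Greatest_le_nat[of ?Q _ M]) (use bound in blast)
    then show False by simp
  qed
  then have "y \<in> ring_units R"
    using place_iff[OF P, of y] ring_units_iff[OF place_valuation_ring[OF P]] y by auto
  then show ?thesis
    using y by blast
qed

lemma rational_decomposition:
  assumes r: "r \<in> Kx" "r \<in> P" "r \<noteq> 0"
  shows "\<exists>n e. e \<in> ring_units R \<and> r = t ^ n * e"
proof -
  obtain M where M: "\<And>m s. s 0 = r \<Longrightarrow> divisor_chain m s \<Longrightarrow> m \<le> M"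
    using chain_bound[OF r] by blast
  have "n \<le> M" if y: "y \<in> R" "r = t ^ n * y" for n y
  proof -
    \<comment> \<open>The chain r, t^(n-1), ..., t, 1 has n steps, so \<open>chain_bound\<close>
      limits n.\<close>
    let ?s = "\<lambda>j. if j = 0 then r else t ^ (n - j)"
    have "r / t ^ (n - j) \<in> P" if j: "0 < j" "j \<le> n" for j
    proof -
      have "r / t ^ (n - j) = y * t ^ j"
        using y(2) t(1) j by (simp add: power_diff)
      then show ?thesis
        using place_mult[OF P y(1) uniformizer_power_in_place[OF j(1)]] by simp
    qed
    moreover have "t ^ (n - i) / t ^ (n - j) \<in> P" if "i < j" "j \<le> n" for i j
    proof -
      have "t ^ (n - i) / t ^ (n - j) = t ^ (j - i)"
        using that t(1) by (simp add: power_diff[symmetric])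
      then show ?thesis
        using uniformizer_power_in_place that by simp
    qed
    ultimately have "\<forall>j\<le>n. \<forall>i<j. ?s i / ?s j \<in> P"
      by auto
    moreover have "\<forall>j\<le>n. ?s j \<in> R \<and> ?s j \<noteq> 0"
      using r place_subset[OF P] uniformizer_power_in_place_ring t by auto
    ultimately have "divisor_chain n ?s"
      unfolding divisor_chain_def by blast
    then show ?thesis
      by (intro M[of ?s]) simp_all
  qed
  then show ?thesis
    using r place_subset[OF P] by (intro unit_power_decomposition) auto
qed

text \<open>The set B is the ring R[1/t]. It contains K(x) by \<open>rational_decomposition\<close>
  and is therefore the whole field; this carries discreteness from K(x) to all functions.\<close>

lemma uniformizer_multiple: "\<exists>n. t ^ n * u \<in> R"
proof -
  define B where "B = {u. \<exists>n. t ^ n * u \<in> R}"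
  have RB: "R \<subseteq> B"
    unfolding B_def by (auto intro!: exI[of _ 0])
  have "subring B"
    unfolding subring_def
  proof (intro conjI ballI)
    show "range \<kappa> \<subseteq> B"
      using RB subring_hom[OF subring_place_ring[OF P]] by blast
    fix a b assume "a \<in> B" "b \<in> B"
    then obtain n m where nm: "t ^ n * a \<in> R" "t ^ m * b \<in> R"
      unfolding B_def by blast
    have "t ^ m * (t ^ n * a) \<in> R" "t ^ n * (t ^ m * b) \<in> R"
      using nm subring_mult[OF subring_place_ring[OF P]] uniformizer_power_in_place_ring by auto
    then have ab: "t ^ (n + m) * a \<in> R" "t ^ (n + m) * b \<in> R"
      by (simp_all add: power_add mult_ac)
    show "a + b \<in> B"
      unfolding B_def using subring_add[OF subring_place_ring[OF P] ab]
      by (auto simp flip: distrib_left)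
    show "a - b \<in> B"
      unfolding B_def using subring_diff[OF subring_place_ring[OF P] ab]
      by (auto simp flip: right_diff_distrib)
    show "a * b \<in> B"
      unfolding B_def using subring_mult[OF subring_place_ring[OF P] nm]
      by (auto intro!: exI[of _ "n + m"] simp: power_add mult_ac)
  qed
  moreover have "Kx \<subseteq> B"
  proof
    fix r assume r: "r \<in> Kx"
    show "r \<in> B"
    proof (cases "r \<in> R")
      case False
      then have "r \<noteq> 0" "inverse r \<in> P"
        using place_ring_cases[OF P, of r] subring_0[OF subring_place_ring[OF P]] by auto
      then obtain n e where e: "e \<in> ring_units R" "inverse r = t ^ n * e"
        using rational_decomposition[OF Kx_inverse[OF r]] by auto
      then have "t ^ n * r = inverse e"
        using \<open>r \<noteq> 0\<close> ring_units_iff[OF place_valuation_ring[OF P]] t(1)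
        by (auto simp: field_simps) 
      then show ?thesis
        using e ring_units_iff[OF place_valuation_ring[OF P]] unfolding B_def
        by (intro CollectI exI[of _ n]) auto
    qed (use RB in blast)
  qed
  ultimately have "B = UNIV"
    using overring_eq_UNIV RB by blast
  then show ?thesis
    unfolding B_def by blast
qed

lemma decomposition:
  assumes "u \<noteq> 0"
  shows "\<exists>n e. e \<in> ring_units R \<and> u = t powi n * e"
proof -
  obtain n where n: "t ^ n * u \<in> R"
    using uniformizer_multiple by blast
  obtain m where m: "t ^ m * inverse u \<in> R"
    using uniformizer_multiple by blast
  \<comment> \<open>A power of t that divides t^n u is limited by the exponent m that brings the
    inverse of u into R; otherwise 1 would lie in P.\<close>
  have "j \<le> n + m" if y: "y \<in> R" "t ^ n * u = t ^ j * y" for j y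
  proof (rule ccontr)
    assume "\<not> j \<le> n + m"
    have "t ^ (n + m) = t ^ j * (y * (t ^ m * inverse u))"
      using y(2) assms by (simp add: power_add field_simps)
    also have "t ^ j = t ^ (n + m) * t ^ (j - (n + m))"
      using \<open>\<not> j \<le> n + m\<close> by (simp flip: power_add)
    finally have "1 = y * (t ^ m * inverse u) * t ^ (j - (n + m))"
      using t(1) by (simp add: mult_ac)
    also have "\<dots> \<in> P"
      using \<open>\<not> j \<le> n + m\<close> uniformizer_power_in_place y(1) m subring_mult[OF subring_place_ring[OF P]]
      by (intro place_mult[OF P]) auto
    finally show False
      using one_notin_place[OF P] by blast
  qed
  then obtain k e where e: "e \<in> ring_units R" "t ^ n * u = t ^ k * e"
    using unit_power_decomposition[of "t ^ n * u" "n + m"] n assms t(1) by auto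
  have "u = t powi (int k - int n) * e"
    using e(2) t(1) by (simp add: power_int_diff field_simps)
  then show ?thesis
    using e(1) by blast
qed

end

end

end

section \<open>Valuations and approximation\<close>

context multiquadratic
begin

text \<open>\<open>0\<close> is listed separately because \<^term>\<open>valuation P 0\<close> is unspecified.\<close>

definition ideal_power :: "'f set \<Rightarrow> int \<Rightarrow> 'f set" where
  "ideal_power P n = {u. u = 0 \<or> n \<le> valuation P u}"

context
  fixes P assumes P: "P \<in> places"
begin

lemma units_mult: "e \<in> ring_units (place_ring P) \<Longrightarrow> e' \<in> ring_units (place_ring P) \<Longrightarrow> e * e' \<in> ring_units (place_ring P)"
  using subring_mult[OF subring_place_ring[OF P]] ring_units_iff[OF place_valuation_ring[OF P]] by auto

lemma units_inverse: "e \<in> ring_units (place_ring P) \<Longrightarrow> inverse e \<in> ring_units (place_ring P)"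
  using ring_units_iff[OF place_valuation_ring[OF P]] by auto

lemma units_power_int: "e \<in> ring_units (place_ring P) \<Longrightarrow> e powi n \<in> ring_units (place_ring P)"
proof -
  assume e: "e \<in> ring_units (place_ring P)"
  have "e ^ k \<in> ring_units (place_ring P)" for k
    using units_mult[OF e] subring_1[OF subring_place_ring[OF P]]
    by (induction k) (auto simp: ring_units_iff[OF place_valuation_ring[OF P], of 1])
  then show ?thesis
    using units_inverse by (simp add: power_int_def power_inverse)
qed

lemma unit_iff: "e \<in> ring_units (place_ring P) \<longleftrightarrow> e \<in> place_ring P \<and> e \<notin> P"
  using place_eq_nonunits[OF P] unfolding ring_units_def by blast

lemma place_neq_0: "P \<noteq> {0}"
  using rational_in_place[OF P] by blast

lemma uniformizer_ratio:
  assumes "P = (*) t ` place_ring P" "P = (*) t' ` place_ring P"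
  shows "\<exists>e\<in>ring_units (place_ring P). t' = t * e"
proof -
  have t: "t \<noteq> 0" "t' \<noteq> 0"
    using assms place_neq_0 subring_1[OF subring_place_ring[OF P]] by auto
  have "t \<in> P" "t' \<in> P"
    using uniformizer_in_place[OF P] assms t by blast+
  then obtain a b where ab: "t' = t * a" "a \<in> place_ring P" "t = t' * b" "b \<in> place_ring P"
    using assms by blast
  then have "a * b = 1"
    using t by (metis mult.assoc mult_cancel_left1)
  then have "a \<in> ring_units (place_ring P)"
    unfolding ring_units_def using ab by blast
  then show ?thesis
    using ab by blast
qed

text \<open>The description in \<open>valuation\<close> is unique: two generators of P differ by a
  unit, so two different exponents would make a positive power of t a unit.\<close>

lemma valuation_eqI:
  assumes t: "P = (*) t ` place_ring P" and e: "e \<in> ring_units (place_ring P)" and u: "u = t powi n * e"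
  shows "valuation P u = n"
  unfolding valuation_def
proof (rule the_equality)
  show "\<exists>t e. P = (*) t ` place_ring P \<and> e \<in> ring_units (place_ring P) \<and> u = t powi n * e"
    using assms by blast
  fix n' assume "\<exists>t e. P = (*) t ` place_ring P \<and> e \<in> ring_units (place_ring P) \<and> u = t powi n' * e"
  then obtain t' e' where t': "P = (*) t' ` place_ring P" "e' \<in> ring_units (place_ring P)" "u = t' powi n' * e'" by blast
  obtain a where a: "a \<in> ring_units (place_ring P)" "t' = t * a"
    using uniformizer_ratio[OF t t'(1)] by blast
  have t0: "t \<noteq> 0"
    using t place_neq_0 subring_1[OF subring_place_ring[OF P]] by auto
  have nz: "e \<noteq> 0" "e' \<noteq> 0" "a \<noteq> 0"
    using e t' a ring_units_iff[OF place_valuation_ring[OF P]] by auto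
  define b where "b = a powi n' * e' * inverse e"
  have b: "b \<in> ring_units (place_ring P)"
    unfolding b_def using a e t' by (intro units_mult units_inverse units_power_int)
  have eq: "t powi (n - n') = b"
  proof -
    have "t powi n * e = t powi n' * a powi n' * e'"
      using u t' a by (simp add: power_int_mult_distrib)
    then show ?thesis
      using t0 nz unfolding b_def by (simp add: power_int_diff field_simps)
  qed
  have pos: "t powi k \<in> P" if "0 < k" for k
    using uniformizer_power_in_place[OF P t0 t, of "nat k"] that by (simp add: power_int_def)
  show "n' = n"
  proof (rule ccontr)
    assume "n' \<noteq> n"
    then consider "0 < n - n'" | "0 < n' - n" by linarith
    then show False
    proof cases
      case 1
      then show False
        using pos eq b unit_iff by metis
    next
      case 2
      have "t powi (n' - n) = inverse b"
        using eq by (metis minus_diff_eq power_int_minus)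
      then show False
        using pos[OF 2] units_inverse[OF b] unit_iff by metis
    qed
  qed
qed

lemma uniformizer_exists:
  "\<exists>t. t \<noteq> 0 \<and> P = (*) t ` place_ring P \<and>
    (\<forall>u. u \<noteq> 0 \<longrightarrow> (\<exists>e\<in>ring_units (place_ring P). u = t powi valuation P u * e))"
proof -
  obtain t where t: "t \<noteq> 0" "P = (*) t ` place_ring P"
    using place_principal[OF P] by blast
  have "\<exists>e\<in>ring_units (place_ring P). u = t powi valuation P u * e" if u: "u \<noteq> 0" for u
  proof -
    obtain n e where "e \<in> ring_units (place_ring P)" "u = t powi n * e"
      using decomposition[OF P t u] by blast
    then show ?thesis
      using valuation_eqI[OF t(2)] by auto
  qed
  then show ?thesis
    using t by blast
qed

lemma valuation_mult:
  assumes "u \<noteq> 0" "v \<noteq> 0" shows "valuation P (u * v) = valuation P u + valuation P v"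
proof -
  obtain t where t: "t \<noteq> 0" "P = (*) t ` place_ring P"
    "\<And>u. u \<noteq> 0 \<Longrightarrow> \<exists>e\<in>ring_units (place_ring P). u = t powi valuation P u * e"
    using uniformizer_exists by blast
  obtain e e' where e: "e \<in> ring_units (place_ring P)" "u = t powi valuation P u * e"
    "e' \<in> ring_units (place_ring P)" "v = t powi valuation P v * e'"
    using t(3)[OF assms(1)] t(3)[OF assms(2)] by blast
  have "u * v = (t powi valuation P u * e) * (t powi valuation P v * e')"
    using e by simp
  also have "\<dots> = t powi (valuation P u + valuation P v) * (e * e')"
    using t(1) by (simp add: power_int_add mult_ac)
  finally show ?thesis
    using valuation_eqI[OF t(2) units_mult[OF e(1,3)]] by blast
qed

lemma valuation_unit: "e \<in> ring_units (place_ring P) \<Longrightarrow> valuation P e = 0"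
  using place_principal[OF P] valuation_eqI[of _ e e 0] by auto

lemma valuation_hom: "c \<noteq> 0 \<Longrightarrow> valuation P (\<kappa> c) = 0"
  using subring_hom[OF subring_place_ring[OF P]] hom_in_place_iff[OF P]
  by (intro valuation_unit) (simp add: unit_iff)

lemma valuation_1: "valuation P 1 = 0"
  using valuation_hom[of 1] by (simp add: hom_one)

lemma valuation_inverse: "u \<noteq> 0 \<Longrightarrow> valuation P (inverse u) = - valuation P u"
  using valuation_mult[of u "inverse u"] valuation_1 by simp

lemma valuation_divide: "u \<noteq> 0 \<Longrightarrow> v \<noteq> 0 \<Longrightarrow> valuation P (u / v) = valuation P u - valuation P v"
  using valuation_mult[of u "inverse v"] valuation_inverse[of v] by (simp add: divide_inverse)

lemma valuation_power: "u \<noteq> 0 \<Longrightarrow> valuation P (u ^ n) = int n * valuation P u"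
  by (induction n) (simp_all add: valuation_1 valuation_mult algebra_simps)

lemma valuation_uniformizer: "P = (*) t ` place_ring P \<Longrightarrow> valuation P (t powi n) = n"
  using valuation_eqI[of t 1 "t powi n" n] subring_1[OF subring_place_ring[OF P]]
    one_notin_place[OF P] unit_iff by simp

lemma place_ring_iff_valuation:
  assumes u: "u \<noteq> 0" shows "u \<in> place_ring P \<longleftrightarrow> 0 \<le> valuation P u"
proof -
  obtain t where t: "t \<noteq> 0" "P = (*) t ` place_ring P"
    "\<And>u. u \<noteq> 0 \<Longrightarrow> \<exists>e\<in>ring_units (place_ring P). u = t powi valuation P u * e"
    using uniformizer_exists by blast
  have *: "v \<in> place_ring P" if v: "v \<noteq> 0" "0 \<le> valuation P v" for v
  proof -
    obtain e where e: "e \<in> ring_units (place_ring P)" "v = t powi valuation P v * e"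
      using t(3)[OF v(1)] by blast
    have "t powi valuation P v * e \<in> place_ring P"
      using uniformizer_power_in_place_ring[OF P t(1,2), of "nat (valuation P v)"] v(2) e(1) unit_iff
      by (intro subring_mult[OF subring_place_ring[OF P]]) (auto simp: power_int_def)
    then show ?thesis
      using e(2) by simp
  qed
  show ?thesis
  proof
    assume uR: "u \<in> place_ring P"
    show "0 \<le> valuation P u"
    proof (rule ccontr)
      assume neg: "\<not> 0 \<le> valuation P u"
      then have "inverse u \<in> place_ring P"
        using * [of "inverse u"] u valuation_inverse[OF u] by simp
      then have "u \<in> ring_units (place_ring P)"
        using uR u ring_units_iff[OF place_valuation_ring[OF P]] by blast
      then show False
        using valuation_unit neg by simp
    qed
  qed (use * u in blast)
qed

lemma place_iff_valuation:
  assumes u: "u \<noteq> 0" shows "u \<in> P \<longleftrightarrow> 0 < valuation P u"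
  using place_iff[OF P, of u] place_ring_iff_valuation[of u] place_ring_iff_valuation[of "inverse u"]
    valuation_inverse[of u] u by auto

lemma ideal_power_0: "ideal_power P 0 = place_ring P"
proof (rule set_eqI)
  fix u show "u \<in> ideal_power P 0 \<longleftrightarrow> u \<in> place_ring P"
    using place_ring_iff_valuation[of u] subring_0[OF subring_place_ring[OF P]]
    by (cases "u = 0") (auto simp: ideal_power_def)
qed

lemma ideal_power_1: "ideal_power P 1 = P"
proof (rule set_eqI)
  fix u show "u \<in> ideal_power P 1 \<longleftrightarrow> u \<in> P"
    using place_iff_valuation[of u] place_iff[OF P, of 0] by (cases "u = 0") (auto simp: ideal_power_def)
qed

lemma ideal_power_image:
  assumes a: "a \<noteq> 0" shows "(*) a ` ideal_power P n = ideal_power P (n + valuation P a)"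
proof (intro equalityI subsetI)
  fix u assume "u \<in> (*) a ` ideal_power P n"
  then obtain v where "u = a * v" "v = 0 \<or> n \<le> valuation P v"
    unfolding ideal_power_def by blast
  then show "u \<in> ideal_power P (n + valuation P a)"
    using a valuation_mult[OF a, of v] by (cases "v = 0") (simp_all add: ideal_power_def)
next
  fix u assume u: "u \<in> ideal_power P (n + valuation P a)"
  have "u = a * (u / a)"
    using a by simp
  moreover have "u / a \<in> ideal_power P n"
    using u a valuation_divide[of u a] by (cases "u = 0") (auto simp: ideal_power_def)
  ultimately show "u \<in> (*) a ` ideal_power P n" by blast
qed

lemma element_of_valuation: "\<exists>a. a \<noteq> 0 \<and> valuation P a = n"
proof -
  obtain t where "t \<noteq> 0" "P = (*) t ` place_ring P"
    using uniformizer_exists by blast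
  then show ?thesis
    using valuation_uniformizer[of t n] by (intro exI[of _ "t powi n"]) simp
qed

lemma subspace_ideal_power: "subspace (ideal_power P n)"
proof -
  obtain a where "a \<noteq> 0" "valuation P a = n"
    using element_of_valuation by blast
  then show ?thesis
    using subspace_mult_image[OF subspace_place_ring[OF P], of a] ideal_power_image[of a 0]
    by (simp add: ideal_power_0)
qed

lemma ideal_power_mono: "m \<le> n \<Longrightarrow> ideal_power P n \<subseteq> ideal_power P m"
  unfolding ideal_power_def by auto

lemma ideal_power_mult:
  "u \<in> ideal_power P m \<Longrightarrow> v \<in> ideal_power P n \<Longrightarrow> u * v \<in> ideal_power P (m + n)"
  unfolding ideal_power_def by (cases "u = 0"; cases "v = 0") (auto simp: valuation_mult)

lemma add_notin_place_ring:
  assumes ab: "a \<noteq> 0" "b \<noteq> 0" "valuation P a < valuation P b" "valuation P a < 0"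
  shows "a + b \<notin> place_ring P"
proof
  assume "a + b \<in> place_ring P"
  define n where "n = min 0 (valuation P b)"
  have "a + b \<in> ideal_power P n" "b \<in> ideal_power P n"
    using \<open>a + b \<in> place_ring P\<close> ideal_power_mono[of n 0] unfolding ideal_power_0[symmetric]
    by (auto simp: n_def ideal_power_def)
  then have "(a + b) - b \<in> ideal_power P n"
    using subspace_diff[OF subspace_ideal_power] by blast
  then show False
    using ab unfolding ideal_power_def n_def by auto
qed

lemma valuation_1_add:
  assumes "a \<noteq> 0" "valuation P a < 0"
  shows "1 + a \<noteq> 0" "valuation P (1 + a) \<le> valuation P a"
proof -
  have "a + 1 \<notin> place_ring P"
    using assms by (intro add_notin_place_ring) (auto simp: valuation_1)
  then show nz: "1 + a \<noteq> 0"
    using subring_0[OF subring_place_ring[OF P]] by (metis add.commute)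
  show "valuation P (1 + a) \<le> valuation P a"
  proof (rule ccontr)
    assume "\<not> valuation P (1 + a) \<le> valuation P a"
    then have "1 + a \<in> ideal_power P (valuation P a + 1)" "1 \<in> ideal_power P (valuation P a + 1)"
      using assms by (auto simp: ideal_power_def valuation_1)
    then have "(1 + a) - 1 \<in> ideal_power P (valuation P a + 1)"
      using subspace_diff[OF subspace_ideal_power] by blast
    then show False
      using assms(1) unfolding ideal_power_def by simp
  qed
qed

text \<open>Independence modulo P implies independence modulo r R for a rational r in P, and such
  families are bounded. Hence degrees are finite and \<open>place_degree\<close> is not a default
  value.\<close>

lemma codim_place: "codim (place_ring P) P (place_degree P)"
proof -
  obtain r where r: "r \<in> Kx" "r \<in> P" "r \<noteq> 0"
    using rational_in_place[OF P] by blast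
  obtain M where M: "\<And>(J::nat set) v. finite J \<Longrightarrow> v ` J \<subseteq> place_ring P \<Longrightarrow> indep_mod ((*) r ` place_ring P) J v \<Longrightarrow> card J \<le> M"
    using place_ring_indep_bound[OF P r] by blast
  have "(*) r ` place_ring P \<subseteq> P"
    using place_mult[OF P] r(2) by (auto simp: mult.commute)
  then have "m \<le> M" if "v ` {..<m} \<subseteq> place_ring P" "indep_mod P {..<m} v" for m v
    using M[of "{..<m}" v] indep_mod_mono[OF that(2)] that(1) by simp
  then have "\<exists>n\<le>M. codim (place_ring P) P n"
    by (intro codim_exists subspace_place_ring[OF P] subspace_place[OF P])
  then obtain n where "codim (place_ring P) P n" by blast
  then show ?thesis
    using quotient_dim_eq[OF subspace_place_ring[OF P] subspace_place[OF P] place_subset[OF P], of n]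
    unfolding place_degree_def by simp
qed

lemma place_degree_pos: "0 < place_degree P"
proof (rule ccontr)
  assume "\<not> 0 < place_degree P"
  then have "codim (place_ring P) P 0"
    using codim_place by simp
  then show False
    using subring_1[OF subring_place_ring[OF P]] one_notin_place[OF P] 
    by (force simp: codim_def)
qed

lemma codim_ideal_power: "codim (ideal_power P n) (ideal_power P (n + 1)) (place_degree P)"
proof -
  obtain a where a: "a \<noteq> 0" "valuation P a = n"
    using element_of_valuation by blast
  then show ?thesis
    using codim_mult_image[OF a(1) codim_place] ideal_power_image[OF a(1), of 0]
      ideal_power_image[OF a(1), of 1]
    by (simp add: ideal_power_0 ideal_power_1 add.commute)
qed

end

section \<open>Weak approximation\<close>

lemma place_ring_not_subset:
  assumes P: "P \<in> places" and Q: "Q \<in> places" and "P \<noteq> Q"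
  shows "\<exists>u. u \<in> place_ring P \<and> u \<notin> place_ring Q"
proof (rule ccontr)
  assume "\<not> ?thesis"
  then have sub: "place_ring P \<subseteq> place_ring Q" by blast
  have "place_ring P \<noteq> place_ring Q"
    using place_eq_nonunits[OF P] place_eq_nonunits[OF Q] assms(3) by metis
  then obtain u where u: "u \<in> place_ring Q" "u \<notin> place_ring P"
    using sub by blast
  have u0: "u \<noteq> 0"
    using u subring_0[OF subring_place_ring[OF P]] by blast
  have vu: "valuation P u < 0"
    using place_ring_iff_valuation[OF P u0] u by simp
  then have "inverse u \<in> place_ring Q"
    using place_ring_iff_valuation[OF P, of "inverse u"] valuation_inverse[OF P u0] u0 sub by auto
  then have vQ: "valuation Q u = 0"
    using u u0 place_ring_iff_valuation[OF Q] valuation_inverse[OF Q u0] by force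
  obtain s where s: "s \<in> Q" "s \<noteq> 0"
    using rational_in_place[OF Q] by blast
  have vs: "0 < valuation Q s"
    using s place_iff_valuation[OF Q] by blast
  \<comment> \<open>For this N the function s u^N has a pole at P but a zero at Q. Its inverse then
    lies in the smaller ring and not in the larger one.\<close>
  define N where "N = nat (valuation P s) + 1"
  have sN: "valuation P s < int N"
    unfolding N_def by simp
  have "int N * valuation P u \<le> int N * (- 1)"
    using vu by (intro mult_left_mono) auto
  then have "valuation P (s * u ^ N) < 0"
    using valuation_mult[OF P s(2), of "u ^ N"] valuation_power[OF P u0, of N] u0 sN by simp
  then have "inverse (s * u ^ N) \<in> place_ring P"
    using place_ring_iff_valuation[OF P, of "inverse (s * u ^ N)"]
      valuation_inverse[OF P, of "s * u ^ N"] s u0 by simp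
  then have "inverse (s * u ^ N) \<in> place_ring Q"
    using sub by blast
  moreover have "valuation Q (s * u ^ N) > 0"
    using valuation_mult[OF Q s(2), of "u ^ N"] valuation_power[OF Q u0, of N] u0 vQ vs by simp
  ultimately show False
    using place_ring_iff_valuation[OF Q, of "inverse (s * u ^ N)"]
      valuation_inverse[OF Q, of "s * u ^ N"] s u0 by simp
qed

lemma separating_element:
  assumes P: "P \<in> places" and S: "finite S" "S \<subseteq> places" "P \<notin> S"
  shows "\<exists>z\<in>P. \<forall>Q\<in>S. z \<notin> place_ring Q"
  using S
proof (induction S rule: finite_induct)
  case empty
  then show ?case
    using place_iff[OF P, of 0] by blast
next
  case (insert Q S)
  have Q: "Q \<in> places" and "P \<noteq> Q"
    using insert by auto
  obtain a b where ab: "a \<in> place_ring P" "a \<notin> place_ring Q" "b \<in> place_ring Q" "b \<notin> place_ring P"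
    using place_ring_not_subset[OF P Q] place_ring_not_subset[OF Q P] \<open>P \<noteq> Q\<close> by metis
  have ab0: "a \<noteq> 0" "b \<noteq> 0"
    using ab subring_0[OF subring_place_ring[OF P]] subring_0[OF subring_place_ring[OF Q]] by auto
  define y where "y = a / b"
  have y0: "y \<noteq> 0"
    using ab0 by (simp add: y_def)
  have yP: "0 < valuation P y"
    using valuation_divide[OF P ab0] ab ab0 place_ring_iff_valuation[OF P] unfolding y_def by force
  have yQ: "valuation Q y < 0"
    using valuation_divide[OF Q ab0] ab ab0 place_ring_iff_valuation[OF Q] unfolding y_def by force
  obtain z where z: "z \<in> P" "\<forall>T\<in>S. z \<notin> place_ring T"
    using insert by auto
  show ?case
  proof (cases "z = 0")
    case True
    then have "S = {}"
      using z(2) insert.prems subring_0[OF subring_place_ring] by blast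
    then show ?thesis
      using yP yQ y0 place_iff_valuation[OF P y0] place_ring_iff_valuation[OF Q y0] by auto
  next
    case False
    \<comment> \<open>N exceeds all |v_T(z)|. At every T where y or z has a pole, z and y^N
      therefore have different valuations, and the pole survives in their sum.\<close>
    define N where "N = nat (\<Sum>T\<in>insert Q S. \<bar>valuation T z\<bar>) + 1"
    have N: "\<bar>valuation T z\<bar> < int N" if "T \<in> insert Q S" for T
    proof -
      have "\<bar>valuation T z\<bar> \<le> (\<Sum>T\<in>insert Q S. \<bar>valuation T z\<bar>)"
        using that insert.hyps by (intro member_le_sum) auto
      then show ?thesis
        unfolding N_def by linarith
    qed
    have "0 < N"
      by (simp add: N_def)
    have neq: "int N * valuation T y \<noteq> valuation T z" if "T \<in> insert Q S" "valuation T z \<noteq> 0 \<or> valuation T y \<noteq> 0" for T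
    proof
      assume eq: "int N * valuation T y = valuation T z"
      then have "valuation T y \<noteq> 0"
        using that by auto
      then have "int N * 1 \<le> int N * \<bar>valuation T y\<bar>"
        by (intro mult_left_mono) auto
      also have "\<dots> = \<bar>valuation T z\<bar>"
        unfolding eq[symmetric] by (simp add: abs_mult)
      finally show False
        using N[OF that(1)] by simp
    qed
    have notin: "z + y ^ N \<notin> place_ring T"
      if T: "T \<in> places" "T \<in> insert Q S" "valuation T z < 0 \<or> valuation T y < 0" for T
    proof -
      have v: "valuation T (y ^ N) = int N * valuation T y"
        using valuation_power[OF T(1) y0] .
      have N0: "0 < N"
        by (simp add: N_def)
      have ne: "valuation T (y ^ N) \<noteq> valuation T z"
        unfolding v using neq[OF T(2)] T(3) by auto
      have neg: "valuation T z < 0 \<or> valuation T (y ^ N) < 0"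
        unfolding v using T(3) N0 by (auto simp: mult_pos_neg)
      show ?thesis
      proof (cases "valuation T z < valuation T (y ^ N)")
        case True
        then show ?thesis
          using add_notin_place_ring[OF T(1) False, of "y ^ N"] y0 neg by auto
      next
        case False
        then have "y ^ N + z \<notin> place_ring T"
          using ne neg y0 \<open>z \<noteq> 0\<close> by (intro add_notin_place_ring[OF T(1)]) auto
        then show ?thesis
          by (simp add: add.commute)
      qed
    qed
    have "z + y ^ N \<notin> place_ring T" if T: "T \<in> insert Q S" for T
    proof (rule notin)
      show "T \<in> places"
        using T insert.prems by blast
      show "valuation T z < 0 \<or> valuation T y < 0"
        using T yQ z(2) place_ring_iff_valuation[OF _ False] insert.prems by force
    qed (fact T)
    moreover have "y ^ N \<in> P"
      using place_iff_valuation[OF P, of "y ^ N"] valuation_power[OF P y0, of N] y0 yP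
      by (simp add: \<open>0 < N\<close>)
    then have "z + y ^ N \<in> P"
      using z(1) place_add[OF P] by blast
    ultimately show ?thesis by blast
  qed
qed

text \<open>The function is a = 1 / (1 + z^(N+1)) with z vanishing at P and having poles at all
  places of S: it is congruent to 1 at P and has zeros of order at least N elsewhere.\<close>

lemma approximate_one:
  assumes P: "P \<in> places" and S: "finite S" "S \<subseteq> places" "P \<notin> S"
  shows "\<exists>a. a - 1 \<in> P \<and> (\<forall>Q\<in>S. a \<in> ideal_power Q (int N))"
proof -
  obtain z where z: "z \<in> P" "\<And>Q. Q \<in> S \<Longrightarrow> z \<notin> place_ring Q"
    using separating_element[OF assms] by blast
  define v where "v = z ^ Suc N"
  have vP: "v \<in> P"
    unfolding v_def using place_mult[OF P subring_power[OF subring_place_ring[OF P]] z(1)] z(1) place_subset[OF P]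
    by (auto simp: mult.commute)
  have nP: "1 + v \<notin> P"
    using place_diff[OF P, of "1 + v" v] vP one_notin_place[OF P] by auto
  have n0: "1 + v \<noteq> 0"
    using nP place_iff[OF P, of 0] by metis
  have "1 + v \<in> place_ring P"
    using vP place_subset[OF P] subring_add[OF subring_place_ring[OF P]] subring_1[OF subring_place_ring[OF P]] by blast
  then have "inverse (1 + v) \<in> place_ring P"
    using nP place_iff[OF P, of "1 + v"] by blast
  then have "inverse (1 + v) * (- v) \<in> P"
    using vP place_minus[OF P] by (intro place_mult[OF P])
  moreover have "inverse (1 + v) * (- v) = inverse (1 + v) - 1"
    using n0 by (simp add: field_simps)
  ultimately have "inverse (1 + v) - 1 \<in> P" by simp
  moreover have "inverse (1 + v) \<in> ideal_power Q (int N)" if Q: "Q \<in> S" for Q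
  proof -
    have QP: "Q \<in> places"
      using Q S by blast
    have z0: "z \<noteq> 0"
      using z(2)[OF Q] subring_0[OF subring_place_ring[OF QP]] by blast
    have vz: "valuation Q z < 0"
      using z(2)[OF Q] place_ring_iff_valuation[OF QP z0] by simp
    have "valuation Q v = int (Suc N) * valuation Q z"
      unfolding v_def using valuation_power[OF QP z0] .
    also have "\<dots> \<le> int (Suc N) * (- 1)"
      using vz by (intro mult_left_mono) auto
    finally have vv: "valuation Q v \<le> - int N - 1" by simp
    have "v \<noteq> 0"
      using z0 by (simp add: v_def)
    then have "valuation Q (1 + v) \<le> valuation Q v"
      using valuation_1_add[OF QP, of v] vv by simp
    then show ?thesis
      using valuation_inverse[OF QP n0] vv unfolding ideal_power_def by simp
  qed
  ultimately show ?thesis by blast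
qed

end

section \<open>Involutions and local conditions\<close>

context field_extension
begin

lemma involution_fixingD:
  assumes "involution_fixing u \<tau>"
  shows "\<tau> (a + b) = \<tau> a + \<tau> b" "\<tau> (a * b) = \<tau> a * \<tau> b" "\<tau> (\<kappa> c) = \<kappa> c" "\<tau> u = u" "\<tau> (\<tau> a) = a"
  using assms unfolding involution_fixing_def by blast+

lemma involution_0: "involution_fixing u \<tau> \<Longrightarrow> \<tau> 0 = 0"
  using involution_fixingD(3)[of u \<tau> 0] by (simp add: hom_zero)

lemma involution_eq_iff: "involution_fixing u \<tau> \<Longrightarrow> \<tau> a = \<tau> b \<longleftrightarrow> a = b"
  using involution_fixingD(5) by metis

lemma involution_minus: "involution_fixing u \<tau> \<Longrightarrow> \<tau> (- a) = - \<tau> a"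
  using involution_fixingD(1)[of u \<tau> "- a" a, symmetric] involution_0[of u \<tau>]
  by (simp add: eq_neg_iff_add_eq_0)

lemma involution_diff: "involution_fixing u \<tau> \<Longrightarrow> \<tau> (a - b) = \<tau> a - \<tau> b"
  using involution_fixingD(1)[of u \<tau> a "- b"] involution_minus[of u \<tau> b] by simp

lemma involution_inverse:
  assumes \<tau>: "involution_fixing u \<tau>" shows "\<tau> (inverse a) = inverse (\<tau> a)"
proof (cases "a = 0")
  case False
  then have "\<tau> a * \<tau> (inverse a) = \<tau> (\<kappa> 1)"
    by (simp flip: involution_fixingD(2)[OF \<tau>] add: hom_one)
  then have "\<tau> a * \<tau> (inverse a) = 1"
    unfolding involution_fixingD(3)[OF \<tau>] by (simp add: hom_one)
  then show ?thesis
    using inverse_unique[of "\<tau> a" "\<tau> (inverse a)"] by simp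
qed (simp add: involution_0[OF \<tau>])

lemma involution_divide: "involution_fixing u \<tau> \<Longrightarrow> \<tau> (a / b) = \<tau> a / \<tau> b"
  by (simp add: divide_inverse involution_fixingD involution_inverse)

lemma involution_power: "involution_fixing u \<tau> \<Longrightarrow> \<tau> (a ^ n) = \<tau> a ^ n"
  using involution_fixingD(3)[of u \<tau> 1] by (induction n) (simp_all add: involution_fixingD hom_one)

lemma involution_ev: "involution_fixing u \<tau> \<Longrightarrow> \<tau> (ev u p) = ev u p"
  by (induction p) (simp_all add: involution_0 involution_fixingD)

lemma involution_sum: "involution_fixing u \<tau> \<Longrightarrow> \<tau> (\<Sum>i\<in>J. v i) = (\<Sum>i\<in>J. \<tau> (v i))"
  by (induction J rule: infinite_finite_induct) (simp_all add: involution_0 involution_fixingD)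

lemma involution_valuation_ring:
  assumes \<tau>: "involution_fixing u \<tau>" and R: "valuation_ring R"
  shows "valuation_ring (\<tau> -` R)"
proof -
  note D = involution_fixingD[OF \<tau>]
  have sub: "subring R"
    using valuation_ring_subring[OF R] .
  have rg: "range \<kappa> \<subseteq> \<tau> -` R"
    using subring_hom[OF sub] D(3) by auto
  obtain a b where ab: "a \<in> R" "a \<notin> range \<kappa>" "b \<notin> R"
    using R unfolding valuation_ring_def by blast
  have "\<tau> a \<noteq> \<kappa> c" for c
    using ab(2) D(3)[of c] D(5)[of a] by auto
  then have "\<tau> a \<in> \<tau> -` R" "\<tau> a \<notin> range \<kappa>" "\<tau> b \<notin> \<tau> -` R"
    using ab D(5) by auto
  moreover have "v \<noteq> 0 \<Longrightarrow> v \<in> \<tau> -` R \<or> inverse v \<in> \<tau> -` R" for v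
    using valuation_ring_cases[OF R, of "\<tau> v"] involution_inverse[OF \<tau>] involution_eq_iff[OF \<tau>, of v 0]
      involution_0[OF \<tau>] by simp
  moreover have "v + v' \<in> \<tau> -` R" "v - v' \<in> \<tau> -` R" "v * v' \<in> \<tau> -` R"
    if "v \<in> \<tau> -` R" "v' \<in> \<tau> -` R" for v v'
    using that subring_add[OF sub] subring_diff[OF sub] subring_mult[OF sub] D
    by (simp_all add: involution_diff[OF \<tau>])
  moreover have "range \<kappa> \<subset> \<tau> -` R" "\<tau> -` R \<subset> UNIV"
    using rg calculation(1-3) by blast+
  ultimately show ?thesis
    unfolding valuation_ring_def by simp
qed

end

section \<open>Components with respect to the basis of square roots\<close>

context multiquadratic
begin

lemma D_neq_0: "i \<in> I \<Longrightarrow> D i \<noteq> 0"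
  using D_squarefree[of i "[:0, 1:]"] by (auto simp: is_unit_pCons_iff)

lemma w_neq_0: "i \<in> I \<Longrightarrow> w i \<noteq> 0"
  using w_square[of i] D_neq_0[of i] by (metis ev_eq_0_iff zero_power2)

lemma involution_Kx: "involution_fixing x \<tau> \<Longrightarrow> r \<in> Kx \<Longrightarrow> \<tau> r = r"
  by (elim KxE) (simp add: involution_divide involution_ev)

text \<open>For an involution that separates i from j, the average of u and
  \<open>s i * \<tau> u\<close> keeps exactly the components with the same sign as i. It stays in S
  and loses component j, so repetition isolates component i.\<close>

lemma component_mem:
  assumes S: "subspace S" "\<And>\<tau> u. involution_fixing x \<tau> \<Longrightarrow> u \<in> S \<Longrightarrow> \<tau> u \<in> S"
    and J: "J \<subseteq> I" "\<And>i. i \<in> J \<Longrightarrow> h i \<in> Kx" "(\<Sum>i\<in>J. h i * w i) \<in> S" and i: "i \<in> J"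
  shows "h i * w i \<in> S"
  using J i
proof (induction "card J" arbitrary: J rule: less_induct)
  case less
  have fJ: "finite J"
    using less.prems(1) finite_I finite_subset by blast
  show ?case
  proof (cases "J = {i}")
    case True
    then show ?thesis
      using less.prems by simp
  next
    case False
    then obtain j where j: "j \<in> J" "j \<noteq> i"
      using less.prems(4) by blast
    have "i \<in> I" "j \<in> I"
      using j less.prems by auto
    then obtain \<tau> s where \<tau>: "involution_fixing x \<tau>" and
      s': "\<forall>k\<in>I. s k \<in> {1, - 1} \<and> \<tau> (w k) = s k * w k" "s i \<noteq> s j"
      using separating[of i j] j(2) by auto
    note s = bspec[OF s'(1)] s'(2)
    define u where "u = (\<Sum>i\<in>J. h i * w i)"
    have \<tau>u: "\<tau> u = (\<Sum>k\<in>J. s k * (h k * w k))"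
      unfolding u_def involution_sum[OF \<tau>]
    proof (intro sum.cong refl)
      fix k assume k: "k \<in> J"
      then have "k \<in> I"
        using less.prems(1) by blast
      then show "\<tau> (h k * w k) = s k * (h k * w k)"
        using s(1)[of k] involution_Kx[OF \<tau> less.prems(2)[OF k]]
        by (simp add: involution_fixingD(2)[OF \<tau>])
    qed
    have "s i * \<tau> u \<in> S"
    proof -
      have "\<tau> u \<in> S"
        using S(2)[OF \<tau>] less.prems(3) u_def by simp
      then show ?thesis
        using s(1)[OF \<open>i \<in> I\<close>] subspace_neg[OF S(1), of "\<tau> u"] by auto
    qed
    then have "u + s i * \<tau> u \<in> S"
      using subspace_add[OF S(1)] less.prems(3) u_def by blast
    then have "\<kappa> (inverse 2) * (u + s i * \<tau> u) \<in> S"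
      by (rule subspace_scale[OF S(1)])
    also have "\<kappa> (inverse 2) * (u + s i * \<tau> u) = (\<Sum>k\<in>{k\<in>J. s k = s i}. h k * w k)"
    proof -
      have two: "\<kappa> (inverse 2) * 2 = 1"
      proof -
        have "\<kappa> 2 = 2"
          using hom_add[of 1 1] by (simp add: hom_one)
        moreover have "\<kappa> (inverse 2) * \<kappa> 2 = \<kappa> (inverse 2 * 2)"
          by (rule hom_mult[symmetric])
        ultimately show ?thesis
          using two_neq_0 hom_one by simp
      qed
      have "\<kappa> (inverse 2) * (u + s i * \<tau> u) = (\<Sum>k\<in>J. \<kappa> (inverse 2) * (1 + s i * s k) * (h k * w k))"
        unfolding \<tau>u unfolding u_def by (simp add: sum_distrib_left sum.distrib algebra_simps)
      also have "\<dots> = (\<Sum>k\<in>J. if s k = s i then h k * w k else 0)"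
      proof (intro sum.cong refl)
        fix k assume "k \<in> J"
        then have "s k \<in> {1, -1}" "s i \<in> {1, -1}"
          using s(1) less.prems by blast+
        then consider "s k = s i" "s i * s k = 1" | "s k \<noteq> s i" "s i * s k = - 1"
          by (cases "s k = s i") auto
        then show "\<kappa> (inverse 2) * (1 + s i * s k) * (h k * w k) = (if s k = s i then h k * w k else 0)"
          using two by cases simp_all
      qed
      finally show ?thesis
        using fJ by (simp add: sum.inter_filter)
    qed
    finally have mem: "(\<Sum>k\<in>{k\<in>J. s k = s i}. h k * w k) \<in> S" .
    have "j \<notin> {k\<in>J. s k = s i}"
      using s(2) by simp
    then have "{k\<in>J. s k = s i} \<subset> J"
      using j(1) by blast
    then have "card {k\<in>J. s k = s i} < card J"
      using fJ by (rule psubset_card_mono[rotated])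
    then show ?thesis
      by (rule less.hyps) (use less.prems mem in auto)
  qed
qed

lemma component_eq_0:
  assumes "\<And>i. i \<in> I \<Longrightarrow> h i \<in> Kx" "(\<Sum>i\<in>I. h i * w i) = 0" "i \<in> I"
  shows "h i = 0"
proof -
  have "h i * w i \<in> {0}"
  proof (rule component_mem[where J = I and h = h])
    show "subspace {0}"
      by (simp add: subspace_def)
  qed (use assms in \<open>auto simp: involution_0\<close>)
  then show ?thesis
    using w_neq_0[OF assms(3)] by simp
qed

text \<open>Write r = p / q in lowest terms. The Bezout identity expresses 1 / q through r and
  polynomials, so 1 / q lies in every valuation ring that contains x. By
  \<open>exists_valuation_ring\<close> this is possible only if 1 / q is a polynomial.\<close>

lemma Kx_integral:
  assumes r: "r \<in> Kx" and int: "\<And>R. valuation_ring R \<Longrightarrow> x \<in> R \<Longrightarrow> r \<in> R"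
  shows "\<exists>p. r = ev x p"
proof -
  obtain p q s t where pq: "q \<noteq> 0" "r = ev x p / ev x q" "s * p + t * q = 1"
    using Kx_coprime[OF r] by blast
  have eq: "inverse (ev x q) = ev x s * r + ev x t"
  proof -
    have "ev x s * ev x p + ev x t * ev x q = 1"
      using arg_cong[OF pq(3), of "ev x"] by simp
    then have "inverse (ev x q) = (ev x s * ev x p + ev x t * ev x q) / ev x q"
      by (simp add: inverse_eq_divide)
    then show ?thesis
      using pq(1,2) by (simp add: add_divide_distrib)
  qed
  have "inverse (ev x q) \<in> range (ev x)"
  proof (rule ccontr)
    assume "inverse (ev x q) \<notin> range (ev x)"
    then obtain R where R: "valuation_ring R" "range (ev x) \<subseteq> R" "inverse (ev x q) \<notin> R"
      using exists_valuation_ring[OF subring_range_ev, of "ev x q" x] pq(1) by auto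
    have "x = ev x [:0, 1:]"
      by (simp add: hom_zero hom_one)
    then have "x \<in> R"
      using R(2) by blast
    then have "r \<in> R"
      using int R(1) by blast
    then have "ev x s * r + ev x t \<in> R"
      using R(2) subringD[OF valuation_ring_subring[OF R(1)]] by (meson rangeI subsetD)
    then show False
      using R(3) eq by simp
  qed
  then obtain b where "inverse (ev x q) = ev x b" by blast
  then have "r = ev x (p * b)"
    using pq(2) by (simp add: divide_inverse)
  then show ?thesis by blast
qed

text \<open>One notion for two situations: for T = \<open>places\<close> it is a Riemann-Roch space,
  for finite T it leaves all other places free, and only then are the dimension jumps exactly the
  degrees.\<close>

definition val_space :: "'f set set \<Rightarrow> ('f set \<Rightarrow> int) \<Rightarrow> 'f set" where
  "val_space T m = {u. \<forall>P\<in>T. u \<in> ideal_power P (m P)}"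

lemma subspace_val_space: "T \<subseteq> places \<Longrightarrow> subspace (val_space T m)"
  using subspace_ideal_power unfolding val_space_def subspace_def by blast

lemma val_space_mono:
  "(\<And>P. P \<in> T \<Longrightarrow> m P \<le> m' P) \<Longrightarrow> T \<subseteq> places \<Longrightarrow> val_space T m' \<subseteq> val_space T m"
  unfolding val_space_def using ideal_power_mono by blast

text \<open>The approximation is u a, where a is congruent to 1 at P and so divisible at the other
  places of T that it compensates every deficit of u there.\<close>

lemma val_space_approx:
  assumes T: "T \<subseteq> places" "finite T" and P: "P \<in> T" and u: "u \<in> ideal_power P (m P)"
  shows "\<exists>s\<in>val_space T m. u - s \<in> ideal_power P (m P + 1)"
proof (cases "u = 0")
  case True
  then show ?thesis
    by (intro bexI[of _ 0]) (auto simp: val_space_def ideal_power_def)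
next
  case False
  have PP: "P \<in> places"
    using P T by blast
  define N where "N = nat (\<Sum>Q\<in>T. \<bar>m Q - valuation Q u\<bar>)"
  have N: "m Q - valuation Q u \<le> int N" if "Q \<in> T" for Q
  proof -
    have "\<bar>m Q - valuation Q u\<bar> \<le> (\<Sum>Q\<in>T. \<bar>m Q - valuation Q u\<bar>)"
      using that T(2) by (intro member_le_sum) auto
    then show ?thesis
      unfolding N_def by linarith
  qed
  obtain a where a: "a - 1 \<in> P" "\<And>Q. Q \<in> T - {P} \<Longrightarrow> a \<in> ideal_power Q (int N)"
    using approximate_one[OF PP, of "T - {P}" N] T by blast
  have "a - 1 + 1 \<in> place_ring P"
    using a(1) place_subset[OF PP] subringD[OF subring_place_ring[OF PP]] by blast
  then have "a \<in> ideal_power P 0"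
    by (simp add: ideal_power_0[OF PP])
  then have "u * a \<in> ideal_power P (m P)"
    using ideal_power_mult[OF PP u] by fastforce
  moreover have "u * a \<in> ideal_power Q (m Q)" if Q: "Q \<in> T - {P}" for Q
  proof -
    have QP: "Q \<in> places"
      using Q T by blast
    have "u \<in> ideal_power Q (valuation Q u)"
      by (simp add: ideal_power_def)
    then have "u * a \<in> ideal_power Q (valuation Q u + int N)"
      using ideal_power_mult[OF QP _ a(2)[OF Q]] by blast
    moreover have "m Q \<le> valuation Q u + int N"
      using N[of Q] Q by auto
    ultimately show ?thesis
      using ideal_power_mono[OF QP] by blast
  qed
  ultimately have "u * a \<in> val_space T m"
    unfolding val_space_def by (intro CollectI ballI) (metis Diff_iff singletonD)
  moreover have "u * (- (a - 1)) \<in> ideal_power P (m P + 1)"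
    using ideal_power_mult[OF PP u, of "- (a - 1)" 1] place_minus[OF PP a(1)]
    by (simp add: ideal_power_1[OF PP])
  then have "u - u * a \<in> ideal_power P (m P + 1)"
    by (simp add: algebra_simps)
  ultimately show ?thesis by blast
qed

text \<open>Raising the bound at P by one intersects the pair of consecutive ideal powers of P with
  the conditions at the other places. The quotient embeds into one of dimension
  \<open>place_degree P\<close>, and for finite T approximation makes this onto.\<close>

lemma codim_val_space_step:
  assumes T: "T \<subseteq> places" and P: "P \<in> T"
  shows "\<exists>k\<le>place_degree P. codim (val_space T m) (val_space T (m(P := m P + 1))) k \<and>
    (finite T \<longrightarrow> k = place_degree P)"
proof -
  have PP: "P \<in> places"
    using P T by blast
  define S where "S = val_space (T - {P}) m"
  have S: "subspace S"
    unfolding S_def using T by (intro subspace_val_space) blast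
  have eq: "val_space T m = ideal_power P (m P) \<inter> S"
    "val_space T (m(P := m P + 1)) = ideal_power P (m P + 1) \<inter> S"
    unfolding S_def val_space_def using P by auto
  note ip = subspace_ideal_power[OF PP, of "m P"] subspace_ideal_power[OF PP, of "m P + 1"]
  show ?thesis
  proof (cases "finite T")
    case True
    have "codim (ideal_power P (m P) \<inter> S) (ideal_power P (m P + 1) \<inter> S) (place_degree P)"
      using val_space_approx[OF T True P, of _ m] unfolding eq(1)
      by (intro codim_Int_eq ip S codim_ideal_power[OF PP]) blast
    then show ?thesis
      unfolding eq by blast
  next
    case False
    then show ?thesis
      using codim_Int[OF ip S codim_ideal_power[OF PP]] unfolding eq by blast
  qed
qed

lemma codim_val_space_single:
  assumes T: "T \<subseteq> places" and P: "P \<in> T"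
  shows "\<exists>k\<le>n * place_degree P. codim (val_space T m) (val_space T (m(P := m P + int n))) k \<and>
    (finite T \<longrightarrow> k = n * place_degree P)"
proof (induction n)
  case 0
  then show ?case
    using codim_refl[OF subspace_val_space[OF T], of m] by simp
next
  case (Suc n)
  let ?m = "m(P := m P + int n)"
  obtain k where k: "k \<le> n * place_degree P" "codim (val_space T m) (val_space T ?m) k"
    "finite T \<longrightarrow> k = n * place_degree P"
    using Suc by blast
  obtain l where l: "l \<le> place_degree P"
    "codim (val_space T ?m) (val_space T (?m(P := ?m P + 1))) l" "finite T \<longrightarrow> l = place_degree P"
    using codim_val_space_step[OF T P, of ?m] by blast
  have eq: "?m(P := ?m P + 1) = m(P := m P + int (Suc n))"
    by (auto simp: fun_eq_iff)
  have "codim (val_space T m) (val_space T (m(P := m P + int (Suc n)))) (k + l)"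
    using k(2) l(2) unfolding eq
    by (intro codim_trans[of _ "val_space T ?m"] subspace_val_space T val_space_mono) auto
  moreover have "k + l \<le> Suc n * place_degree P" "finite T \<longrightarrow> k + l = Suc n * place_degree P"
    using k l by auto
  ultimately show ?case
    by (intro exI[of _ "k + l"] conjI)
qed

lemma codim_val_space:
  assumes T: "T \<subseteq> places" and X: "finite X" "X \<subseteq> T"
  shows "\<exists>k\<le>\<Sum>P\<in>X. d P * place_degree P.
    codim (val_space T m) (val_space T (\<lambda>P. m P + (if P \<in> X then int (d P) else 0))) k \<and>
    (finite T \<longrightarrow> k = (\<Sum>P\<in>X. d P * place_degree P))"
  using X
proof (induction X rule: finite_induct)
  case empty
  then show ?case
    using codim_refl[OF subspace_val_space[OF T], of m] by simp
next
  case (insert P X)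
  let ?m = "\<lambda>X P. m P + (if P \<in> X then int (d P) else 0)"
  obtain k where k: "k \<le> (\<Sum>P\<in>X. d P * place_degree P)" "codim (val_space T m) (val_space T (?m X)) k"
    "finite T \<longrightarrow> k = (\<Sum>P\<in>X. d P * place_degree P)"
    using insert by auto
  obtain l where l: "l \<le> d P * place_degree P"
    "codim (val_space T (?m X)) (val_space T ((?m X)(P := ?m X P + int (d P)))) l"
    "finite T \<longrightarrow> l = d P * place_degree P"
    using codim_val_space_single[OF T, of P "d P" "?m X"] insert.prems by blast
  have eq: "(?m X)(P := ?m X P + int (d P)) = ?m (insert P X)"
    using insert.hyps by (auto simp: fun_eq_iff)
  have "codim (val_space T m) (val_space T (?m (insert P X))) (k + l)"
    using k(2) l(2) unfolding eq
    by (intro codim_trans[of _ "val_space T (?m X)"] subspace_val_space T val_space_mono) auto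
  then show ?case
    using k l insert.hyps by (intro exI[of _ "k + l"]) auto
qed

lemma val_space_image:
  assumes T: "T \<subseteq> places" and r: "r \<noteq> 0"
  shows "(*) r ` val_space T m = val_space T (\<lambda>P. m P + valuation P r)"
proof (intro equalityI subsetI)
  fix u assume "u \<in> (*) r ` val_space T m"
  then show "u \<in> val_space T (\<lambda>P. m P + valuation P r)"
    unfolding val_space_def using T ideal_power_image[OF _ r] by blast
next
  fix u assume u: "u \<in> val_space T (\<lambda>P. m P + valuation P r)"
  have "u / r \<in> ideal_power P (m P)" if P: "P \<in> T" for P
  proof -
    have "u \<in> (*) r ` ideal_power P (m P)"
      using u P T ideal_power_image[OF _ r, of P "m P"] unfolding val_space_def by blast
    then show ?thesis
      using r by auto
  qed
  then have "r * (u / r) \<in> (*) r ` val_space T m"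
    unfolding val_space_def by blast
  then show "u \<in> (*) r ` val_space T m"
    using r by simp
qed

text \<open>Let S consist of the functions without poles in T. Multiplication by r raises every
  bound by the valuation of r, so the sum is the dimension of S modulo r S, which
  \<open>indep_mod_rational_bound\<close> controls.\<close>

lemma zero_degree_bound:
  assumes T: "T \<subseteq> places" "finite T" "\<And>P. P \<in> T \<Longrightarrow> r \<in> P"
    and r: "r = ev x p / ev x q" "p \<noteq> 0" "q \<noteq> 0" "degree p \<le> n" "degree q \<le> n"
  shows "(\<Sum>P\<in>T. nat (valuation P r) * place_degree P) \<le> card I * n"
proof -
  let ?S = "val_space T (\<lambda>_. 0)"
  have r0: "r \<noteq> 0"
    using r by simp
  have pos: "0 < valuation P r" if "P \<in> T" for P
    using place_iff_valuation[of P r] r0 T that by blast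
  obtain k where k: "codim ?S (val_space T (\<lambda>P. 0 + (if P \<in> T then int (nat (valuation P r)) else 0))) k"
    "k = (\<Sum>P\<in>T. nat (valuation P r) * place_degree P)"
    using codim_val_space[OF T(1,2) subset_refl, of "\<lambda>P. nat (valuation P r)" "\<lambda>_. 0"] T(2) by blast
  have eq: "val_space T (\<lambda>P. 0 + (if P \<in> T then int (nat (valuation P r)) else 0)) = (*) r ` ?S"
    unfolding val_space_image[OF T(1) r0] unfolding val_space_def using pos by force
  obtain v where v: "v ` {..<k} \<subseteq> ?S" "indep_mod ((*) r ` ?S) {..<k} v"
    using k(1) unfolding eq codim_def by blast
  have "(*) r ` ?S \<subseteq> ?S"
    unfolding val_space_image[OF T(1) r0] using pos T(1) by (intro val_space_mono) force
  then have "card {..<k} \<le> card I * n"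
    using indep_mod_rational_bound[OF subspace_val_space[OF T(1)] _ r _ v] by blast
  then show ?thesis
    using k(2) by simp
qed

lemma finite_zeros:
  assumes r: "r \<in> Kx" "r \<noteq> 0"
  shows "finite {P \<in> places. r \<in> P}"
proof (rule ccontr)
  obtain p q where pq: "q \<noteq> 0" "r = ev x p / ev x q"
    using r(1) by (elim KxE)
  let ?n = "degree p + degree q"
  assume inf: "infinite {P \<in> places. r \<in> P}"
  obtain T where T: "T \<subseteq> {P \<in> places. r \<in> P}" "finite T" "card T = Suc (card I * ?n)"
    using infinite_arbitrarily_large[OF inf, of "Suc (card I * ?n)"] by auto
  have "1 \<le> nat (valuation P r) * place_degree P" if "P \<in> T" for P
  proof -
    have "P \<in> places" "r \<in> P"
      using T(1) that by auto
    then show ?thesis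
      using place_iff_valuation[of P r] place_degree_pos[of P] r(2) by simp
  qed
  then have "(\<Sum>P\<in>T. 1) \<le> (\<Sum>P\<in>T. nat (valuation P r) * place_degree P)"
    by (intro sum_mono)
  also have "\<dots> \<le> card I * ?n"
    using T(1,2) pq r(2) by (intro zero_degree_bound[of T r p q]) auto
  finally show False
    using T(3) by simp
qed

end

section \<open>Riemann-Roch spaces of the pole divisor\<close>

context multiquadratic
begin

text \<open>\<open>pole_space n\<close> is the Riemann-Roch space of \<open>n\<close> times the pole divisor of \<open>x\<close>.\<close>

definition pole :: "'f set \<Rightarrow> nat" where
  "pole P = nat (- valuation P x)"

definition infinite_places :: "'f set set" where
  "infinite_places = {P \<in> places. x \<notin> place_ring P}"

definition pole_space :: "nat \<Rightarrow> 'f set" where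
  "pole_space n = val_space places (\<lambda>P. - int (n * pole P))"

lemma infinite_placesD: "P \<in> infinite_places \<Longrightarrow> P \<in> places" "P \<in> infinite_places \<Longrightarrow> x \<notin> place_ring P"
  unfolding infinite_places_def by auto

lemma pole_finite: "P \<in> places \<Longrightarrow> P \<notin> infinite_places \<Longrightarrow> pole P = 0"
  using place_ring_iff_valuation[of P x] x_neq_0 unfolding infinite_places_def pole_def by simp

lemma pole_infinite: "P \<in> infinite_places \<Longrightarrow> 0 < pole P \<and> valuation P x = - int (pole P)"
  using place_ring_iff_valuation[of P x] x_neq_0 unfolding infinite_places_def pole_def by simp

lemma finite_infinite_places: "finite infinite_places"
proof (rule finite_subset)
  have "ev x [:0, 1:] = x"
    by (simp add: hom_zero hom_one)
  then have "inverse x \<in> Kx"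
    using Kx_inverse ev_in_Kx by metis
  then show "finite {P \<in> places. inverse x \<in> P}"
    using x_neq_0 by (intro finite_zeros) auto
  show "infinite_places \<subseteq> {P \<in> places. inverse x \<in> P}"
    using place_ring_cases[of _ x] x_neq_0 unfolding infinite_places_def by blast
qed

lemma subspace_pole_space: "subspace (pole_space n)"
  unfolding pole_space_def by (intro subspace_val_space order_refl)

lemma pole_space_mult: "u \<in> pole_space m \<Longrightarrow> v \<in> pole_space n \<Longrightarrow> u * v \<in> pole_space (m + n)"
  unfolding pole_space_def val_space_def
proof (intro CollectI ballI)
  fix P assume P: "P \<in> places" "u \<in> {u. \<forall>P\<in>places. u \<in> ideal_power P (- int (m * pole P))}"
    "v \<in> {u. \<forall>P\<in>places. u \<in> ideal_power P (- int (n * pole P))}"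
  then have "u * v \<in> ideal_power P (- int (m * pole P) + - int (n * pole P))"
    by (intro ideal_power_mult) auto
  then show "u * v \<in> ideal_power P (- int ((m + n) * pole P))"
    by (simp add: algebra_simps)
qed

lemma pole_space_mono: "m \<le> n \<Longrightarrow> pole_space m \<subseteq> pole_space n"
  unfolding pole_space_def by (intro val_space_mono) (auto simp: mult_right_mono)

lemma hom_in_pole_space: "\<kappa> c \<in> pole_space 0"
  unfolding pole_space_def val_space_def ideal_power_def
  using valuation_hom by (cases "c = 0") auto

lemma x_in_pole_space: "x \<in> pole_space 1"
  unfolding pole_space_def val_space_def ideal_power_def pole_def by auto

lemma ev_in_pole_space: "ev x p \<in> pole_space (degree p)"
proof (induction p)
  case 0
  then show ?case
    using hom_in_pole_space[of 0] by (simp add: hom_zero)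
next
  case (pCons a p)
  have "x * ev x p \<in> pole_space (degree (pCons a p))"
  proof (cases "p = 0")
    case True
    then show ?thesis
      using subspace_pole_space unfolding subspace_def by simp
  next
    case False
    then show ?thesis
      using pole_space_mult[OF x_in_pole_space pCons.IH] by simp
  qed
  then show ?case
    using subsetD[OF pole_space_mono hom_in_pole_space[of a], of "degree (pCons a p)"]
    by (simp only: ev_pCons subspace_add[OF subspace_pole_space])
qed

lemma w_in_pole_space: assumes i: "i \<in> I" shows "w i \<in> pole_space (g i)"
  unfolding pole_space_def val_space_def
proof (intro CollectI ballI)
  fix P assume P: "P \<in> places"
  have "ev x (D i) \<in> ideal_power P (- int (2 * g i * pole P))"
    using ev_in_pole_space[of "D i"] P degree_D[OF i] unfolding pole_space_def val_space_def by simp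
  moreover have "ev x (D i) \<noteq> 0"
    using D_neq_0[OF i] by simp
  ultimately have "- int (2 * g i * pole P) \<le> valuation P (w i ^ 2)"
    unfolding w_square[OF i] ideal_power_def by simp
  then show "w i \<in> ideal_power P (- int (g i * pole P))"
    using valuation_power[OF P w_neq_0[OF i], of 2] unfolding ideal_power_def by simp
qed

text \<open>The condition is freed from valuations and expressed by membership in valuation rings
  alone. In this form it is visibly invariant under automorphisms fixing x and fits
  \<open>Kx_integral\<close>.\<close>

lemma pole_space_iff:
  "u \<in> pole_space n \<longleftrightarrow> (\<forall>R. valuation_ring R \<longrightarrow> (x \<in> R \<longrightarrow> u \<in> R) \<and> (x \<notin> R \<longrightarrow> u / x ^ n \<in> R))"
proof -
  have *: "u \<in> ideal_power P (- int (n * pole P)) \<longleftrightarrow>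
      (x \<in> place_ring P \<longrightarrow> u \<in> place_ring P) \<and> (x \<notin> place_ring P \<longrightarrow> u / x ^ n \<in> place_ring P)"
    if P: "P \<in> places" for P
  proof (cases "u = 0")
    case True
    then show ?thesis
      using subring_0[OF subring_place_ring[OF P]] by (simp add: ideal_power_def)
  next
    case False
    show ?thesis
    proof (cases "P \<in> infinite_places")
      case True
      then have "valuation P (u / x ^ n) = valuation P u + int (n * pole P)"
        using valuation_divide[OF P False, of "x ^ n"] valuation_power[OF P x_neq_0, of n] x_neq_0
          pole_infinite by simp
      then show ?thesis
        using False place_ring_iff_valuation[OF P, of "u / x ^ n"] x_neq_0 infinite_placesD[OF True]
        by (auto simp: ideal_power_def)
    next
      case False
      then show ?thesis
        using pole_finite[OF P False] P ideal_power_0[OF P] unfolding infinite_places_def by simp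
    qed
  qed
  show ?thesis
  proof
    assume u: "u \<in> pole_space n"
    show "\<forall>R. valuation_ring R \<longrightarrow> (x \<in> R \<longrightarrow> u \<in> R) \<and> (x \<notin> R \<longrightarrow> u / x ^ n \<in> R)"
    proof (intro allI impI)
      fix R assume R: "valuation_ring R"
      show "(x \<in> R \<longrightarrow> u \<in> R) \<and> (x \<notin> R \<longrightarrow> u / x ^ n \<in> R)"
        using *[OF nonunits_in_places[OF R]] u nonunits_in_places[OF R] place_ring_nonunits[OF R]
        unfolding pole_space_def val_space_def by simp
    qed
  next
    assume "\<forall>R. valuation_ring R \<longrightarrow> (x \<in> R \<longrightarrow> u \<in> R) \<and> (x \<notin> R \<longrightarrow> u / x ^ n \<in> R)"
    then show "u \<in> pole_space n"
      using * place_valuation_ring unfolding pole_space_def val_space_def by simp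
  qed
qed

lemma involution_pole_space:
  assumes \<tau>: "involution_fixing x \<tau>" and u: "u \<in> pole_space n"
  shows "\<tau> u \<in> pole_space n"
  unfolding pole_space_iff
proof (intro allI impI)
  fix R assume R: "valuation_ring R"
  show "(x \<in> R \<longrightarrow> \<tau> u \<in> R) \<and> (x \<notin> R \<longrightarrow> \<tau> u / x ^ n \<in> R)"
    using u[unfolded pole_space_iff, rule_format, OF involution_valuation_ring[OF \<tau> R]]
    by (simp add: involution_fixingD(4)[OF \<tau>] involution_divide[OF \<tau>] involution_power[OF \<tau>])
qed

text \<open>x is not a polynomial in 1/x, so some valuation ring contains 1/x and omits x.\<close>

lemma exists_infinite_place: "infinite_places \<noteq> {}"
proof -
  let ?y = "inverse x"
  have "x \<notin> range (ev ?y)"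
  proof
    assume "x \<in> range (ev ?y)"
    then obtain p where p: "x = ev ?y p" by blast
    let ?d = "degree p"
    \<comment> \<open>The reversed polynomial x^d p(1/x) with d = degree p. It would have to equal
      x^(d+1), which exceeds its degree.\<close>
    define q where "q = (\<Sum>i\<le>?d. monom (coeff p i) (?d - i))"
    have "ev ?y p * x ^ ?d = (\<Sum>i\<le>?d. \<kappa> (coeff p i) * x ^ (?d - i))"
      unfolding ev_altdef sum_distrib_right
      using x_neq_0 by (intro sum.cong refl) (simp add: power_diff power_inverse field_simps)
    also have "\<dots> = ev x q"
      unfolding q_def by (simp add: ev_sum)
    finally have "ev x (monom 1 (Suc ?d)) = ev x q"
      using p by (simp add: hom_one)
    then have "monom 1 (Suc ?d) = q"
      using ev_eq_iff by blast
    moreover have "degree q \<le> ?d"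
      unfolding q_def by (intro degree_sum_le) (auto intro: order_trans[OF degree_monom_le])
    ultimately show False
      using degree_monom_eq[of "1::'k" "Suc ?d"] by simp
  qed
  moreover have "?y \<in> range (ev ?y)"
    by (rule range_eqI[of _ _ "[:0, 1:]"]) (simp add: hom_zero hom_one)
  ultimately obtain R where "valuation_ring R" "x \<notin> R"
    using exists_valuation_ring[OF subring_range_ev, of ?y ?y] x_neq_0 by auto
  then show ?thesis
    using nonunits_in_places place_ring_nonunits unfolding infinite_places_def by blast
qed

lemma valuation_add_eq:
  assumes P: "P \<in> places" and ab: "a \<noteq> 0" "b \<noteq> 0" "valuation P a < valuation P b"
  shows "a + b \<noteq> 0" "valuation P (a + b) = valuation P a"
proof -
  let ?n = "valuation P a"
  have b: "b \<in> ideal_power P (?n + 1)"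
    using ab by (simp add: ideal_power_def)
  have notin: "a + b \<notin> ideal_power P (?n + 1)"
  proof
    assume "a + b \<in> ideal_power P (?n + 1)"
    then have "(a + b) - b \<in> ideal_power P (?n + 1)"
      using b subspace_diff[OF subspace_ideal_power[OF P]] by blast
    then show False
      using ab(1) by (simp add: ideal_power_def)
  qed
  then show "a + b \<noteq> 0"
    by (auto simp: ideal_power_def)
  have "a + b \<in> ideal_power P ?n"
    using ab by (intro subspace_add[OF subspace_ideal_power[OF P]]) (auto simp: ideal_power_def)
  then show "valuation P (a + b) = ?n"
    using notin by (auto simp: ideal_power_def)
qed

text \<open>At a pole of u the leading term dominates. The statement is for arbitrary u, since it
  also shows that elements algebraic over K have no poles.\<close>

lemma valuation_ev_pole:
  assumes P: "P \<in> places" and u: "u \<noteq> 0" "valuation P u < 0" and p: "p \<noteq> 0"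
  shows "ev u p \<noteq> 0 \<and> valuation P (ev u p) = int (degree p) * valuation P u"
  using p
proof (induction p)
  case (pCons a p)
  show ?case
  proof (cases "p = 0")
    case True
    then show ?thesis
      using valuation_hom[OF P] pCons by simp
  next
    case False
    then have nz: "u * ev u p \<noteq> 0"
      using pCons.IH u(1) by simp
    have v: "valuation P (u * ev u p) = int (degree (pCons a p)) * valuation P u"
      using pCons.IH False valuation_mult[OF P u(1), of "ev u p"] by (simp add: algebra_simps)
    show ?thesis
    proof (cases "a = 0")
      case True
      then show ?thesis
        using v nz by (simp add: hom_zero)
    next
      case a: False
      have "int (degree (pCons a p)) * valuation P u < 0"
        using u(2) False by (intro mult_pos_neg) auto
      then have "valuation P (u * ev u p) < valuation P (\<kappa> a)"
        unfolding v valuation_hom[OF P a] .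
      then have "u * ev u p + \<kappa> a \<noteq> 0"
        "valuation P (u * ev u p + \<kappa> a) = valuation P (u * ev u p)"
        using valuation_add_eq[OF P nz, of "\<kappa> a"] a by simp_all
      then show ?thesis
        using v by (simp add: add.commute)
    qed
  qed
qed simp

lemma valuation_ev_infinite:
  assumes P: "P \<in> infinite_places" and p: "p \<noteq> 0"
  shows "valuation P (ev x p) = - int (degree p * pole P)"
  using valuation_ev_pole[OF infinite_placesD(1)[OF P] x_neq_0 _ p] pole_infinite[OF P] by simp

lemma ev_in_pole_space_iff: "p \<noteq> 0 \<Longrightarrow> ev x p \<in> pole_space n \<longleftrightarrow> degree p \<le> n"
proof
  assume p: "p \<noteq> 0" "ev x p \<in> pole_space n"
  obtain P where P: "P \<in> infinite_places"
    using exists_infinite_place by blast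
  then have "- int (n * pole P) \<le> valuation P (ev x p)"
    using p infinite_placesD(1) unfolding pole_space_def val_space_def ideal_power_def by auto
  then have "int (degree p * pole P) \<le> int (n * pole P)"
    unfolding valuation_ev_infinite[OF P p(1)] by simp
  then have "degree p * pole P \<le> n * pole P"
    by (simp only: of_nat_le_iff)
  then show "degree p \<le> n"
    using pole_infinite[OF P] by simp
qed (use ev_in_pole_space pole_space_mono in blast)

text \<open>The square of \<open>h * w i\<close> is a rational function of x without finite poles,
  hence a polynomial; \<open>Kx_square_integral\<close> makes h itself a polynomial, and the degree
  of the square gives the bound.\<close>

lemma component_in_pole_space:
  assumes i: "i \<in> I" and h: "h \<in> Kx" "h \<noteq> 0" "h * w i \<in> pole_space n"
  shows "\<exists>p. h = ev x p \<and> degree p + g i \<le> n"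
proof -
  have "(h * w i) * (h * w i) \<in> pole_space (n + n)"
    using pole_space_mult h(3) by blast
  then have mem: "h ^ 2 * ev x (D i) \<in> pole_space (2 * n)"
    unfolding w_square[OF i, symmetric] mult_2[of n] by (simp add: power2_eq_square mult_ac)
  have "\<exists>m. h ^ 2 * ev x (D i) = ev x m"
  proof (rule Kx_integral)
    show "h ^ 2 * ev x (D i) \<in> Kx"
      using h(1) ev_in_Kx by (simp add: power2_eq_square Kx_mult)
  qed (use mem pole_space_iff in blast)
  then obtain m where m: "h ^ 2 * ev x (D i) = ev x m" by blast
  obtain p where p: "h = ev x p"
    using Kx_square_integral[OF h(1) D_squarefree[OF i] m] by blast
  have p0: "p \<noteq> 0"
    using h(2) p by auto
  have "ev x (p ^ 2 * D i) \<in> pole_space (2 * n)"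
    using mem p by simp
  then have "degree (p ^ 2 * D i) \<le> 2 * n"
    using ev_in_pole_space_iff[of "p ^ 2 * D i"] p0 D_neq_0[OF i] by simp
  moreover have "degree (p ^ 2 * D i) = 2 * degree p + 2 * g i"
    using p0 D_neq_0[OF i] degree_D[OF i] by (simp add: degree_mult_eq degree_power_eq)
  ultimately show ?thesis
    using p by (intro exI[of _ p]) simp
qed

lemma pole_space_repr:
  assumes "u \<in> pole_space n"
  shows "\<exists>h. u = (\<Sum>i\<in>I. ev x (h i) * w i) \<and> (\<forall>i\<in>I. h i \<noteq> 0 \<longrightarrow> degree (h i) + g i \<le> n)"
proof -
  obtain h where h: "\<forall>i\<in>I. h i \<in> Kx" "u = (\<Sum>i\<in>I. h i * w i)"
    using spanning by blast
  have "\<exists>p. h i = ev x p \<and> (p \<noteq> 0 \<longrightarrow> degree p + g i \<le> n)" if i: "i \<in> I" for i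
  proof (cases "h i = 0")
    case True
    then show ?thesis
      by (intro exI[of _ 0]) simp
  next
    case False
    have "h i * w i \<in> pole_space n"
      using h assms involution_pole_space i
      by (intro component_mem[OF subspace_pole_space, where J = I]) auto
    then show ?thesis
      using component_in_pole_space[OF i _ False] h(1) i by blast
  qed
  then obtain p where "\<And>i. i \<in> I \<Longrightarrow> h i = ev x (p i) \<and> (p i \<noteq> 0 \<longrightarrow> degree (p i) + g i \<le> n)"
    by metis
  then show ?thesis
    unfolding h(2) by (intro exI[of _ p]) auto
qed

lemma pole_space_0: "(\<And>i. i \<in> I \<Longrightarrow> g i = 0 \<Longrightarrow> w i \<in> range \<kappa>) \<Longrightarrow> pole_space 0 = range \<kappa>"
proof (intro equalityI subsetI)
  assume w0: "\<And>i. i \<in> I \<Longrightarrow> g i = 0 \<Longrightarrow> w i \<in> range \<kappa>"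
  fix u assume "u \<in> pole_space 0"
  then obtain h where h: "u = (\<Sum>i\<in>I. ev x (h i) * w i)" "\<forall>i\<in>I. h i \<noteq> 0 \<longrightarrow> degree (h i) + g i \<le> 0"
    using pole_space_repr by blast
  have "\<exists>c. ev x (h i) * w i = \<kappa> c" if i: "i \<in> I" for i
  proof (cases "h i = 0")
    case True
    then show ?thesis
      by (intro exI[of _ 0]) (simp add: hom_zero)
  next
    case False
    then have "degree (h i) = 0" "g i = 0"
      using h(2) i by auto
    then obtain a b where "h i = [:a:]" "w i = \<kappa> b"
      using w0[OF i] degree_eq_zeroE by blast
    then show ?thesis
      by (intro exI[of _ "a * b"]) (simp add: hom_mult)
  qed
  then obtain c where "\<And>i. i \<in> I \<Longrightarrow> ev x (h i) * w i = \<kappa> (c i)"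
    by metis
  then have "u = \<kappa> (\<Sum>i\<in>I. c i)"
    unfolding h(1) hom_sum by (intro sum.cong) auto
  then show "u \<in> range \<kappa>" by blast
qed (use hom_in_pole_space in blast)

text \<open>A basis consists of the products x^j \<open>w i\<close> with j + \<open>g i\<close>
  \<le> n: they are independent by \<open>component_eq_0\<close> and span by
  \<open>pole_space_repr\<close>.\<close>

lemma codim_pole_space:
  assumes n: "\<And>i. i \<in> I \<Longrightarrow> g i \<le> n + 1"
  shows "codim (pole_space n) {0} (\<Sum>i\<in>I. n + 1 - g i)"
proof -
  define J where "J = (SIGMA i:I. {..<n + 1 - g i})"
  define v where "v = (\<lambda>(i, j). x ^ j * w i)"
  have fin: "finite J"
    unfolding J_def using finite_I by blast
  have sumJ: "(\<Sum>z\<in>J. \<kappa> (c z) * v z) = (\<Sum>i\<in>I. ev x (\<Sum>j<n + 1 - g i. monom (c (i, j)) j) * w i)" for c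
  proof -
    have "(\<Sum>z\<in>J. \<kappa> (c z) * v z) = (\<Sum>i\<in>I. \<Sum>j<n + 1 - g i. \<kappa> (c (i, j)) * (x ^ j * w i))"
      unfolding J_def v_def using finite_I by (subst sum.Sigma) (auto simp: case_prod_beta)
    then show ?thesis
      by (simp add: ev_sum sum_distrib_right mult.assoc)
  qed
  have "codim (pole_space n) {0} (card J)"
  proof (rule codim_of_family[OF fin])
    show "v ` J \<subseteq> pole_space n"
    proof clarify
      fix i j assume ij: "(i, j) \<in> J"
      then have i: "i \<in> I" "j + g i \<le> n"
        using n unfolding J_def by auto
      have "x ^ j = ev x (monom 1 j)"
        by (simp add: hom_one)
      then have "x ^ j \<in> pole_space j"
        using ev_in_pole_space[of "monom 1 j"] by (simp add: degree_monom_eq)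
      then have "x ^ j * w i \<in> pole_space (j + g i)"
        using pole_space_mult w_in_pole_space[OF i(1)] by blast
      then show "v (i, j) \<in> pole_space n"
        using pole_space_mono[OF i(2)] unfolding v_def by auto
    qed
    show "indep_mod {0} J v"
      unfolding indep_mod_def
    proof (intro allI impI ballI)
      fix c z assume s: "(\<Sum>z\<in>J. \<kappa> (c z) * v z) \<in> {0}" and z: "z \<in> J"
      obtain i j where ij: "z = (i, j)" "i \<in> I" "j < n + 1 - g i"
        using z unfolding J_def by auto
      have "ev x (\<Sum>j<n + 1 - g i. monom (c (i, j)) j) = 0"
        using s ij(2) unfolding sumJ
        by (intro component_eq_0[where h = "\<lambda>i. ev x (\<Sum>j<n + 1 - g i. monom (c (i, j)) j)"])
           (auto intro: ev_in_Kx)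
      then have "(\<Sum>j<n + 1 - g i. monom (c (i, j)) j) = 0"
        by simp
      then have "coeff (\<Sum>j<n + 1 - g i. monom (c (i, j)) j) j = 0"
        by simp
      then show "c z = 0"
        using ij by (simp add: coeff_sum)
    qed
    fix u assume "u \<in> pole_space n"
    then obtain h where h: "u = (\<Sum>i\<in>I. ev x (h i) * w i)" "\<forall>i\<in>I. h i \<noteq> 0 \<longrightarrow> degree (h i) + g i \<le> n"
      using pole_space_repr by blast
    have "(\<Sum>j<n + 1 - g i. monom (coeff (h i) j) j) = h i" if i: "i \<in> I" for i
    proof (rule poly_eqI)
      fix k
      have "coeff (h i) k = 0" if "\<not> k < n + 1 - g i"
        using h(2) i that by (cases "h i = 0") (auto intro!: coeff_eq_0)
      then show "coeff (\<Sum>j<n + 1 - g i. monom (coeff (h i) j) j) k = coeff (h i) k"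
        by (auto simp: coeff_sum)
    qed
    then have "u = (\<Sum>z\<in>J. \<kappa> (case z of (i, j) \<Rightarrow> coeff (h i) j) * v z)"
      unfolding sumJ h(1) by simp
    then show "\<exists>c. u - (\<Sum>z\<in>J. \<kappa> (c z) * v z) \<in> {0}"
      by (intro exI[of _ "\<lambda>z. case z of (i, j) \<Rightarrow> coeff (h i) j"]) simp
  qed
  then show ?thesis
    unfolding J_def using finite_I by (simp add: card_SigmaI)
qed

text \<open>The bound on \<open>g i\<close> makes the truncated subtraction n + 1 -
  \<open>g i\<close> exact, so the dimension becomes linear in n.\<close>

lemma codim_pole_space_int:
  assumes n: "\<And>i. i \<in> I \<Longrightarrow> g i \<le> n + 1" and k: "codim (pole_space n) {0} k"
  shows "int k = int (card I) * (int n + 1) - int (\<Sum>i\<in>I. g i)"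
proof -
  have "k = (\<Sum>i\<in>I. n + 1 - g i)"
    using codim_unique[OF _ k codim_pole_space[OF n]] by (simp add: subspace_def)
  also have "int \<dots> = (\<Sum>i\<in>I. int n + 1 - int (g i))"
    unfolding of_nat_sum using n by (intro sum.cong refl) (simp add: of_nat_diff)
  finally show ?thesis
    by (simp add: sum_subtractf)
qed

end

section \<open>The genus\<close>

context field_extension
begin

lemma subspace_zero: "subspace {0}"
  by (simp add: subspace_def)

lemma codim_subspace:
  assumes "codim U {0} n" "subspace U" "subspace S" "S \<subseteq> U"
  shows "\<exists>m\<le>n. codim S {0} m"
proof -
  have "U \<inter> S = S" "{0} \<inter> S = {0}"
    using assms(3,4) by (auto simp: subspace_def)
  then show ?thesis
    using codim_Int[OF assms(2) subspace_zero assms(3,1)] by simp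
qed

end

context multiquadratic
begin

lemma val_space_cong: "(\<And>P. P \<in> T \<Longrightarrow> m P = m' P) \<Longrightarrow> val_space T m = val_space T m'"
  unfolding val_space_def by auto

abbreviation "total_genus \<equiv> \<Sum>i\<in>I. g i"

lemma g_le: "i \<in> I \<Longrightarrow> g i \<le> total_genus"
  using finite_I by (intro member_le_sum) auto

text \<open>The inequality \<le> counts the zeros of 1/x. For \<ge>, the dimension of
  \<open>pole_space n\<close> grows by card I with each n, whereas allowing n-fold poles raises the
  dimension of \<open>pole_space 0\<close> by at most n times the degree of the pole
  divisor.\<close>

lemma pole_degree: "(\<Sum>P\<in>infinite_places. pole P * place_degree P) = card I"
proof (rule antisym)
  have "(\<Sum>P\<in>infinite_places. nat (valuation P (inverse x)) * place_degree P) \<le> card I * 1"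
  proof (rule zero_degree_bound[of _ _ 1 "[:0, 1:]"])
    show "inverse x = ev x 1 / ev x [:0, 1:]"
      by (simp add: hom_zero hom_one inverse_eq_divide)
    show "inverse x \<in> P" if "P \<in> infinite_places" for P
      using place_ring_cases[OF infinite_placesD(1)[OF that] x_neq_0] infinite_placesD(2)[OF that] by blast
  qed (use finite_infinite_places infinite_placesD in auto)
  moreover have "nat (valuation P (inverse x)) = pole P" if "P \<in> infinite_places" for P
    using valuation_inverse[OF infinite_placesD(1)[OF that] x_neq_0] unfolding pole_def by simp
  ultimately show "(\<Sum>P\<in>infinite_places. pole P * place_degree P) \<le> card I"
    by simp
next
  define \<delta> where "\<delta> = (\<Sum>P\<in>infinite_places. pole P * place_degree P)"
  have "pole_space 0 \<subseteq> pole_space total_genus"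
    by (intro pole_space_mono) simp
  moreover have "codim (pole_space total_genus) {0} (\<Sum>i\<in>I. total_genus + 1 - g i)"
    using g_le by (intro codim_pole_space) (simp add: le_SucI)
  ultimately obtain l where l: "codim (pole_space 0) {0} l"
    using codim_subspace[OF _ subspace_pole_space subspace_pole_space] by blast
  \<comment> \<open>If \<delta> were smaller than card I, the dimension formula would force n + card
    I \<le> l + \<open>total_genus\<close>; this n excludes that.\<close>
  define n where "n = total_genus + l + 1"
  obtain k where k: "k \<le> (\<Sum>P\<in>infinite_places. n * pole P * place_degree P)"
    "codim (pole_space n)
      (val_space places (\<lambda>P. - int (n * pole P) + (if P \<in> infinite_places then int (n * pole P) else 0))) k"
    using codim_val_space[OF order_refl finite_infinite_places, of "\<lambda>P. n * pole P" "\<lambda>P. - int (n * pole P)"]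
      infinite_placesD(1) unfolding pole_space_def by blast
  have "val_space places (\<lambda>P. - int (n * pole P) + (if P \<in> infinite_places then int (n * pole P) else 0)) =
      pole_space 0"
    unfolding pole_space_def using pole_finite by (intro val_space_cong) auto
  then have "codim (pole_space n) {0} (k + l)"
    using k(2) l hom_in_pole_space[of 0] pole_space_mono[of 0 n]
    by (intro codim_trans[OF subspace_pole_space subspace_pole_space[of 0] subspace_zero]) (auto simp: hom_zero)
  moreover have "g i \<le> n + 1" if "i \<in> I" for i
    using g_le[OF that] by (simp add: n_def)
  ultimately have eq: "int (k + l) = int (card I) * (int n + 1) - int total_genus"
    by (intro codim_pole_space_int)
  have "k \<le> n * \<delta>"
    using k(1) by (simp add: \<delta>_def sum_distrib_left mult.assoc)
  then have "int k \<le> int (n * \<delta>)"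
    by (rule of_nat_mono)
  then have "int k \<le> int n * int \<delta>"
    by (simp only: of_nat_mult)
  then have le: "int (card I) * (int n + 1) \<le> int n * int \<delta> + int l + int total_genus"
    using eq by simp
  show "card I \<le> (\<Sum>P\<in>infinite_places. pole P * place_degree P)"
    unfolding \<delta>_def[symmetric]
  proof (rule ccontr)
    assume "\<not> card I \<le> \<delta>"
    then have "int n * (int \<delta> + 1) \<le> int n * int (card I)"
      by (intro mult_left_mono) auto
    then have "int n + int (card I) \<le> int l + int total_genus"
      using le by (simp add: algebra_simps)
    then show False
      by (simp add: n_def)
  qed
qed

section \<open>Riemann's inequality and the value of the genus\<close>

lemma riemann_roch_val_space:
  "riemann_roch_space A = val_space places (\<lambda>P. - Poly_Mapping.lookup A P)"
  unfolding riemann_roch_space_def val_space_def ideal_power_def by auto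

lemma zero_in_finite_place:
  assumes P: "P \<in> places" "x \<in> place_ring P"
  shows "\<exists>p. p \<noteq> 0 \<and> ev x p \<in> P"
proof -
  obtain r where r: "r \<in> Kx" "r \<in> P" "r \<noteq> 0"
    using rational_in_place[OF P(1)] by blast
  obtain p q where pq: "q \<noteq> 0" "r = ev x p / ev x q"
    using r(1) by (elim KxE)
  have "ev x q * r \<in> P"
    using place_mult[OF P(1) subring_ev[OF subring_place_ring[OF P(1)] P(2)] r(2)] .
  then show ?thesis
    using pq r(3) by (intro exI[of _ p]) auto
qed

text \<open>A polynomial in x that clears all finite poles allowed by a divisor, so that only
  conditions over infinity remain to be compared with multiples of the pole divisor.\<close>

lemma effective_denominator:
  assumes S: "finite S" "S \<subseteq> places"
  shows "\<exists>h. h \<noteq> 0 \<and> (\<forall>P\<in>S - infinite_places. int (e P) \<le> valuation P (ev x h))"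
proof -
  let ?S = "S - infinite_places"
  have "\<exists>p. p \<noteq> 0 \<and> ev x p \<in> P" if "P \<in> ?S" for P
    using that S(2) zero_in_finite_place[of P] unfolding infinite_places_def by blast
  then obtain f where f: "\<And>P. P \<in> ?S \<Longrightarrow> f P \<noteq> 0 \<and> ev x (f P) \<in> P"
    by metis
  define h where "h = (\<Prod>P\<in>?S. f P ^ e P)"
  have "int (e P) \<le> valuation P (ev x h)" if P: "P \<in> ?S" for P
  proof -
    have PP: "P \<in> places" "x \<in> place_ring P"
      using P S(2) unfolding infinite_places_def by auto
    define h' where "h' = (\<Prod>Q\<in>?S - {P}. f Q ^ e Q)"
    have h': "h = f P ^ e P * h'"
      unfolding h_def h'_def using P S(1) by (intro prod.remove) auto
    have nz: "ev x (f P) \<noteq> 0" "ev x h' \<noteq> 0"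
      using f P S(1) unfolding h'_def by auto
    have "0 \<le> valuation P (ev x h')"
      using place_ring_iff_valuation[OF PP(1) nz(2)] subring_ev[OF subring_place_ring[OF PP(1)] PP(2)] by blast
    moreover have "1 \<le> valuation P (ev x (f P))"
      using place_iff_valuation[OF PP(1) nz(1)] f[OF P] by simp
    then have "int (e P) * 1 \<le> int (e P) * valuation P (ev x (f P))"
      by (intro mult_left_mono) auto
    ultimately show ?thesis
      unfolding h' using valuation_mult[OF PP(1), of "ev x (f P) ^ e P" "ev x h'"]
        valuation_power[OF PP(1) nz(1), of "e P"] nz by simp
  qed
  moreover have "h \<noteq> 0"
    unfolding h_def using f S(1) by auto
  ultimately show ?thesis by blast
qed

text \<open>The half of "principal divisors have degree 0" that is available so far: by
  \<open>pole_degree\<close> the poles of h contribute exactly -(degree h) * card I, and by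
  \<open>zero_degree_bound\<close> the zeros at most its negative.\<close>

lemma valuation_ev_sum_le:
  assumes h: "h \<noteq> 0" and X: "finite X" "infinite_places \<subseteq> X" "X \<subseteq> places"
  shows "(\<Sum>P\<in>X. valuation P (ev x h) * int (place_degree P)) \<le> 0"
proof -
  let ?Z = "{P \<in> X - infinite_places. ev x h \<in> P}"
  have ev: "ev x h \<noteq> 0"
    using h by simp
  have fin: "x \<in> place_ring P" if "P \<in> X - infinite_places" for P
    using that X(3) unfolding infinite_places_def by blast
  have "(\<Sum>P\<in>infinite_places. valuation P (ev x h) * int (place_degree P)) =
      (\<Sum>P\<in>infinite_places. - (int (degree h) * int (pole P * place_degree P)))"
    using valuation_ev_infinite[OF _ h] by (intro sum.cong refl) simp
  also have "\<dots> = - (int (degree h) * int (\<Sum>P\<in>infinite_places. pole P * place_degree P))"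
    unfolding of_nat_sum sum_distrib_left sum_negf ..
  finally have inf: "(\<Sum>P\<in>infinite_places. valuation P (ev x h) * int (place_degree P)) =
      - (int (degree h) * int (card I))"
    unfolding pole_degree .
  have "(\<Sum>P\<in>X - infinite_places. valuation P (ev x h) * int (place_degree P)) =
      (\<Sum>P\<in>?Z. valuation P (ev x h) * int (place_degree P))"
  proof (rule sum.mono_neutral_right)
    show "\<forall>P\<in>X - infinite_places - ?Z. valuation P (ev x h) * int (place_degree P) = 0"
    proof
      fix P assume P: "P \<in> X - infinite_places - ?Z"
      then have PP: "P \<in> places" "ev x h \<notin> P"
        using X(3) by auto
      have "ev x h \<in> place_ring P"
        using P subring_ev[OF subring_place_ring[OF PP(1)] fin] by blast
      then have "valuation P (ev x h) = 0"
        using PP place_iff_valuation[OF PP(1) ev] place_ring_iff_valuation[OF PP(1) ev] by simp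
      then show "valuation P (ev x h) * int (place_degree P) = 0" by simp
    qed
  qed (use X in auto)
  also have "\<dots> = int (\<Sum>P\<in>?Z. nat (valuation P (ev x h)) * place_degree P)"
    unfolding of_nat_sum
  proof (intro sum.cong refl)
    fix P assume "P \<in> ?Z"
    then have "0 < valuation P (ev x h)"
      using place_iff_valuation[OF _ ev] X(3) by blast
    then show "valuation P (ev x h) * int (place_degree P) = int (nat (valuation P (ev x h)) * place_degree P)"
      by simp
  qed
  also have "\<dots> \<le> int (card I * degree h)"
    using X h by (intro of_nat_mono zero_degree_bound[of ?Z "ev x h" h 1]) auto
  finally have "(\<Sum>P\<in>X - infinite_places. valuation P (ev x h) * int (place_degree P)) \<le> int (card I * degree h)" .
  then show ?thesis
    using inf sum.subset_diff[OF X(2,1), of "\<lambda>P. valuation P (ev x h) * int (place_degree P)"]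
    by (simp add: mult.commute)
qed

text \<open>Multiplication by h embeds the Riemann-Roch space of A into \<open>pole_space n\<close>,
  as the functions with valuation at least \<open>b P\<close>. Its codimension there is at most n *
  card I - deg A, and the dimension of \<open>pole_space n\<close> is known.\<close>

lemma riemann_inequality:
  assumes A: "A \<in> divisors"
  shows "divisor_degree A - int (dim (riemann_roch_space A)) + 1 \<le> 1 + int total_genus - int (card I)"
proof -
  define S where "S = Poly_Mapping.keys A"
  define a where "a = Poly_Mapping.lookup A"
  have S: "finite S" "S \<subseteq> places"
    using A unfolding S_def divisors_def by auto
  have a0: "a P = 0" if "P \<notin> S" for P
    using that unfolding a_def S_def by (simp add: in_keys_iff)
  obtain h where h: "h \<noteq> 0" "\<And>P. P \<in> S - infinite_places \<Longrightarrow> int (nat \<bar>a P\<bar>) \<le> valuation P (ev x h)"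
    using effective_denominator[OF S, of "\<lambda>P. nat \<bar>a P\<bar>"] by blast
  have ev: "ev x h \<noteq> 0"
    using h(1) by simp
  define s where "s = (\<Sum>P\<in>S. nat \<bar>a P\<bar>)"
  have s: "\<bar>a P\<bar> \<le> int s" for P
  proof (cases "P \<in> S")
    case True
    then have "nat \<bar>a P\<bar> \<le> s"
      unfolding s_def using S(1) by (intro member_le_sum) auto
    then show ?thesis by simp
  qed (simp add: a0)
  \<comment> \<open>The three summands pay for the poles of h over infinity, for the part of A over
    infinity, and for the range in which the dimension formula holds.\<close>
  define n where "n = degree h + s + total_genus"
  define b where "b P = valuation P (ev x h) - a P" for P
  define Z where "Z = {P \<in> places. ev x h \<in> P}"
  define X where "X = infinite_places \<union> S \<union> Z"
  have X: "finite X" "X \<subseteq> places" "infinite_places \<subseteq> X"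
    unfolding X_def Z_def using finite_infinite_places S finite_zeros[OF ev_in_Kx ev] infinite_placesD(1) by auto
  have fin: "ev x h \<in> place_ring P" if "P \<in> places" "P \<notin> infinite_places" for P
    using subring_ev[OF subring_place_ring] that unfolding infinite_places_def by blast
  have b_pos: "0 \<le> b P + int (n * pole P)" if P: "P \<in> places" for P
  proof (cases "P \<in> infinite_places")
    case True
    have "int s * 1 \<le> int s * int (pole P)"
      using pole_infinite[OF True] by (intro mult_left_mono) auto
    moreover have "0 \<le> int total_genus * int (pole P)"
      by (simp only: of_nat_0_le_iff flip: of_nat_mult)
    ultimately have "a P \<le> int s * int (pole P) + int total_genus * int (pole P)"
      using s[of P] by linarith
    then show ?thesis
      unfolding b_def valuation_ev_infinite[OF True h(1)] n_def by (simp add: algebra_simps)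
  next
    case False
    then have "a P \<le> valuation P (ev x h)"
      using h(2)[of P] a0[of P] fin[OF P False] place_ring_iff_valuation[OF P ev] by (cases "P \<in> S") auto
    then show ?thesis
      unfolding b_def by simp
  qed
  have b_zero: "b P + int (n * pole P) = 0" if P: "P \<in> places" "P \<notin> X" for P
  proof -
    have "P \<notin> infinite_places" "P \<notin> S" "ev x h \<notin> P"
      using P unfolding X_def Z_def by auto
    then show ?thesis
      using fin[OF P(1)] place_ring_iff_valuation[OF P(1) ev] place_iff_valuation[OF P(1) ev]
        pole_finite[OF P(1)] a0[of P] unfolding b_def by simp
  qed
  let ?d = "\<lambda>P. nat (b P + int (n * pole P))"
  obtain k where k: "k \<le> (\<Sum>P\<in>X. ?d P * place_degree P)"
    "codim (pole_space n) (val_space places (\<lambda>P. - int (n * pole P) + (if P \<in> X then int (?d P) else 0))) k"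
    using codim_val_space[OF order_refl X(1,2), of ?d "\<lambda>P. - int (n * pole P)"]
    unfolding pole_space_def by blast
  have "val_space places (\<lambda>P. - int (n * pole P) + (if P \<in> X then int (?d P) else 0)) = val_space places b"
  proof (rule val_space_cong)
    fix P assume "P \<in> places"
    then show "- int (n * pole P) + (if P \<in> X then int (?d P) else 0) = b P"
      using b_pos[of P] b_zero[of P] by (cases "P \<in> X") auto
  qed
  then have cod_k: "codim (pole_space n) (val_space places b) k"
    using k(2) by simp
  have k_le: "int k \<le> int n * int (card I) - divisor_degree A"
  proof -
    have "int k \<le> int (\<Sum>P\<in>X. ?d P * place_degree P)"
      using k(1) by (rule of_nat_mono)
    also have "\<dots> = (\<Sum>P\<in>X. (b P + int (n * pole P)) * int (place_degree P))"
      unfolding of_nat_sum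
    proof (intro sum.cong refl)
      fix P assume "P \<in> X"
      then show "int (?d P * place_degree P) = (b P + int (n * pole P)) * int (place_degree P)"
        using b_pos[of P] X(2) by auto
    qed
    also have "\<dots> = (\<Sum>P\<in>X. valuation P (ev x h) * int (place_degree P)) -
        (\<Sum>P\<in>X. a P * int (place_degree P)) + int n * int (\<Sum>P\<in>X. pole P * place_degree P)"
      unfolding b_def of_nat_sum sum_distrib_left
      by (simp add: algebra_simps flip: sum.distrib sum_subtractf)
    also have "(\<Sum>P\<in>X. a P * int (place_degree P)) = divisor_degree A"
      unfolding divisor_degree_def S_def[symmetric] a_def[symmetric]
      using X(1) a0 unfolding X_def by (intro sum.mono_neutral_right) auto
    also have "(\<Sum>P\<in>X. pole P * place_degree P) = card I"
      unfolding pole_degree[symmetric] using X pole_finite by (intro sum.mono_neutral_right) auto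
    finally show ?thesis
      using valuation_ev_sum_le[OF h(1) X(1,3,2)] by simp
  qed
  have sub: "val_space places b \<subseteq> pole_space n"
    unfolding pole_space_def using b_pos by (intro val_space_mono) force+
  have gn: "g i \<le> n + 1" if "i \<in> I" for i
    using g_le[OF that] by (simp add: n_def)
  obtain j where j: "codim (val_space places b) {0} j"
    using codim_subspace[OF codim_pole_space[OF gn] subspace_pole_space subspace_val_space sub] by auto
  have "codim (pole_space n) {0} (k + j)"
    using subspace_val_space[of places b]
    by (intro codim_trans[OF subspace_pole_space _ subspace_zero _ sub cod_k j]) (auto simp: subspace_def)
  then have kj: "int (k + j) = int (card I) * (int n + 1) - int total_genus"
    using gn by (intro codim_pole_space_int)
  have img: "(*) (inverse (ev x h)) ` val_space places b = riemann_roch_space A"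
    unfolding riemann_roch_val_space
    using val_space_image[OF order_refl, of "inverse (ev x h)" b] ev valuation_inverse[OF _ ev]
    unfolding b_def a_def by (auto intro!: val_space_cong)
  have "codim (riemann_roch_space A) {0} j"
    using codim_mult_image[OF _ j, of "inverse (ev x h)"] ev unfolding img by simp
  moreover have "subspace (riemann_roch_space A)"
    unfolding riemann_roch_val_space by (intro subspace_val_space order_refl)
  ultimately have "dim (riemann_roch_space A) = j"
    by (intro dim_eq_codim)
  then show ?thesis
    using kj k_le by (simp add: algebra_simps)
qed

text \<open>The upper bound is \<open>riemann_inequality\<close>. It is attained at
  \<open>total_genus\<close> times the pole divisor of x, whose Riemann-Roch space is a
  \<open>pole_space\<close> of known dimension.\<close>

theorem genus_eq: "genus = 1 + int total_genus - int (card I)"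
  unfolding genus_def
proof (rule cSup_eq_maximum)
  let ?n = "total_genus"
  define f where "f P = (if P \<in> infinite_places then int (?n * pole P) else 0)" for P
  define A where "A = Abs_poly_mapping f"
  have "finite {P. f P \<noteq> 0}"
    using finite_infinite_places by (rule rev_finite_subset) (auto simp: f_def)
  then have lookup: "Poly_Mapping.lookup A = f"
    unfolding A_def by (simp add: Abs_poly_mapping_inverse)
  have keys: "Poly_Mapping.keys A \<subseteq> infinite_places"
    by (auto simp: in_keys_iff lookup f_def split: if_splits)
  then have AD: "A \<in> divisors"
    using infinite_placesD(1) unfolding divisors_def by blast
  have "divisor_degree A = (\<Sum>P\<in>infinite_places. f P * int (place_degree P))"
    unfolding divisor_degree_def lookup using keys finite_infinite_places
    by (intro sum.mono_neutral_left) (auto simp: in_keys_iff lookup)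
  also have "\<dots> = int ?n * int (\<Sum>P\<in>infinite_places. pole P * place_degree P)"
    unfolding of_nat_sum sum_distrib_left by (intro sum.cong refl) (simp add: f_def)
  finally have deg: "divisor_degree A = int ?n * int (card I)"
    unfolding pole_degree .
  have "riemann_roch_space A = pole_space ?n"
    unfolding riemann_roch_val_space pole_space_def lookup
    using pole_finite by (intro val_space_cong) (auto simp: f_def)
  moreover have gn: "g i \<le> ?n + 1" if "i \<in> I" for i
    using g_le[OF that] by simp
  moreover have "dim (pole_space ?n) = (\<Sum>i\<in>I. ?n + 1 - g i)"
    using dim_eq_codim[OF subspace_pole_space codim_pole_space[OF gn]] .
  ultimately have "int (dim (riemann_roch_space A)) = int (card I) * (int ?n + 1) - int ?n"
    using codim_pole_space_int[OF gn codim_pole_space[OF gn]] by simp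
  then have "1 + int total_genus - int (card I) = divisor_degree A - int (dim (riemann_roch_space A)) + 1"
    unfolding deg by (simp add: algebra_simps)
  then show "1 + int total_genus - int (card I)
      \<in> (\<lambda>A. divisor_degree A - int (dim (riemann_roch_space A)) + 1) ` divisors"
    using AD by blast
next
  fix y assume "y \<in> (\<lambda>A. divisor_degree A - int (dim (riemann_roch_space A)) + 1) ` divisors"
  then show "y \<le> 1 + int total_genus - int (card I)"
    using riemann_inequality by blast
qed

section \<open>Function field and constant field\<close>

lemma rational_functions_adjoin: "Kx \<subseteq> adjoin {x}"
  unfolding adjoin_def
proof (intro subsetI InterI)
  fix r M assume r: "r \<in> Kx" and "M \<in> {M. intermediate_field M \<and> {x} \<subseteq> M}"
  then have M: "intermediate_field M" "x \<in> M" by auto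
  then have "subring M"
    unfolding intermediate_field_def subring_def by blast
  obtain p q where pq: "r = ev x p / ev x q"
    using r by (elim KxE)
  have "ev x p \<in> M" "ev x q \<in> M"
    using subring_ev[OF \<open>subring M\<close> M(2)] by auto
  then have "ev x p * inverse (ev x q) \<in> M"
    using M(1) unfolding intermediate_field_def by blast
  then show "r \<in> M"
    using pq by (simp add: divide_inverse)
qed

lemma Kx_sum: "(\<And>j. j \<in> J \<Longrightarrow> h j \<in> Kx) \<Longrightarrow> (\<Sum>j\<in>J. h j) \<in> Kx"
  using ev_in_Kx[of 0] by (induction J rule: infinite_finite_induct) (auto intro: Kx_add)

lemma function_field: function_field
  unfolding function_field_def
proof (intro exI[of _ x] exI[of _ "w ` I"] conjI allI)
  fix u
  obtain h where h: "\<forall>i\<in>I. h i \<in> Kx" "u = (\<Sum>i\<in>I. h i * w i)"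
    using spanning by blast
  \<comment> \<open>The definition of a function field sums over a set of generators, so the
    coefficients of indices with the same \<open>w i\<close> are collected.\<close>
  define c where "c b = (\<Sum>i\<in>{i \<in> I. w i = b}. h i)" for b
  have "u = (\<Sum>b\<in>w ` I. \<Sum>i\<in>{i \<in> I. w i = b}. h i * w i)"
    unfolding h(2) using finite_I by (rule sum.image_gen)
  also have "\<dots> = (\<Sum>b\<in>w ` I. c b * b)"
    unfolding c_def sum_distrib_right by (intro sum.cong refl) auto
  finally have "u = (\<Sum>b\<in>w ` I. c b * b)" .
  moreover have "\<forall>b\<in>w ` I. c b \<in> adjoin {x}"
    unfolding c_def using h(1) by (intro ballI subsetD[OF rational_functions_adjoin] Kx_sum) simp
  ultimately show "\<exists>c. (\<forall>b\<in>w ` I. c b \<in> adjoin {x}) \<and> u = (\<Sum>b\<in>w ` I. c b * b)"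
    by (intro exI[of _ c] conjI)
qed (use finite_I transcendental_x in auto)

text \<open>An element algebraic over K has no poles by \<open>valuation_ev_pole\<close>, so it lies
  in \<open>pole_space 0\<close>, which consists of the constants.\<close>

lemma full_constant_field:
  assumes "\<And>i. i \<in> I \<Longrightarrow> g i = 0 \<Longrightarrow> w i \<in> range \<kappa>"
  shows full_constant_field
  unfolding full_constant_field_def
proof (intro equalityI subsetI)
  fix u assume "u \<in> {u. \<not> transcendental u}"
  then obtain p where p: "p \<noteq> 0" "ev u p = 0"
    unfolding transcendental_def ev_def by blast
  have "u \<in> ideal_power P (- int (0 * pole P))" if P: "P \<in> places" for P
    using valuation_ev_pole[OF P, of u p] p unfolding ideal_power_def 
    by (cases "u = 0"; cases "valuation P u < 0") auto
  then have "u \<in> pole_space 0"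
    unfolding pole_space_def val_space_def by blast
  then show "u \<in> range \<kappa>"
    using pole_space_0[OF assms] by blast
next
  fix u assume "u \<in> range \<kappa>"
  then obtain c where c: "u = \<kappa> c" by blast
  have "ev u [:- c, 1:] = 0"
    by (simp add: c hom_minus hom_one)
  then show "u \<in> {u. \<not> transcendental u}"
    using transcendental_ev_eq_0_iff[of u "[:- c, 1:]"] by auto
qed

end

section \<open>Quadratic towers and places over a point\<close>

context field_extension
begin

lemma involution_place:
  assumes \<tau>: "involution_fixing u \<tau>" and P: "P \<in> places"
  shows "\<tau> -` P \<in> places"
proof -
  let ?R = "place_ring P"
  have V: "valuation_ring (\<tau> -` ?R)"
    using involution_valuation_ring[OF \<tau> place_valuation_ring[OF P]] .
  have "\<tau> -` P = \<tau> -` ?R - ring_units (\<tau> -` ?R)"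
  proof (rule set_eqI)
    fix v
    show "v \<in> \<tau> -` P \<longleftrightarrow> v \<in> \<tau> -` ?R - ring_units (\<tau> -` ?R)"
      using place_iff[OF P, of "\<tau> v"] ring_units_iff[OF V, of v] involution_inverse[OF \<tau>, of v]
        involution_eq_iff[OF \<tau>, of v 0] involution_0[OF \<tau>] subring_0[OF subring_place_ring[OF P]]
      by auto
  qed
  then show ?thesis
    using nonunits_in_places[OF V] by simp
qed

text \<open>The class of 1 is nonzero in the one-dimensional quotient, so it can replace the unknown
  basis vector.\<close>

lemma rational_residue:
  assumes "codim U W 1" "subspace W" "1 \<in> U" "1 \<notin> W" "u \<in> U"
  shows "\<exists>c. u - \<kappa> c \<in> W"
proof -
  obtain v where v: "\<forall>u\<in>U. \<exists>c. u - (\<Sum>i<1::nat. \<kappa> (c i) * v i) \<in> W"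
    using assms(1) unfolding codim_def by blast
  have rep: "\<exists>c. u - \<kappa> c * v 0 \<in> W" if "u \<in> U" for u
    using bspec[OF v that] by auto
  obtain d where d: "1 - \<kappa> d * v 0 \<in> W"
    using rep[OF assms(3)] by blast
  obtain c where c: "u - \<kappa> c * v 0 \<in> W"
    using rep[OF assms(5)] by blast
  have "d \<noteq> 0"
    using d assms(4) by (auto simp: hom_zero)
  have "\<kappa> (c / d) * (1 - \<kappa> d * v 0) \<in> W"
    using subspace_scale[OF assms(2) d] .
  then have mem: "(u - \<kappa> c * v 0) - \<kappa> (c / d) * (1 - \<kappa> d * v 0) \<in> W"
    using subspace_diff[OF assms(2) c] by blast
  have cd: "\<kappa> (c / d) * \<kappa> d = \<kappa> c"
    using \<open>d \<noteq> 0\<close> by (simp flip: hom_mult)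
  have "(u - \<kappa> c * v 0) - \<kappa> (c / d) * (1 - \<kappa> d * v 0) = u - \<kappa> c * v 0 - \<kappa> (c / d) + (\<kappa> (c / d) * \<kappa> d) * v 0"
    by (simp add: algebra_simps)
  then have "(u - \<kappa> c * v 0) - \<kappa> (c / d) * (1 - \<kappa> d * v 0) = u - \<kappa> (c / d)"
    unfolding cd by simp
  then show ?thesis
    using mem by (intro exI[of _ "c / d"]) (simp only:)
qed

section \<open>Towers of quadratic extensions\<close>

definition quadratic_closure :: "'f set \<Rightarrow> 'f \<Rightarrow> 'f set" where
  "quadratic_closure M w = {p + q * w | p q. p \<in> M \<and> q \<in> M}"

definition nonsquare :: "'f set \<Rightarrow> 'f \<Rightarrow> bool" where
  "nonsquare M e \<longleftrightarrow> (\<forall>r\<in>M. r ^ 2 \<noteq> e)"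

lemma intermediate_fieldD:
  assumes "intermediate_field M"
  shows "a \<in> M \<Longrightarrow> b \<in> M \<Longrightarrow> a + b \<in> M" "a \<in> M \<Longrightarrow> b \<in> M \<Longrightarrow> a - b \<in> M"
    "a \<in> M \<Longrightarrow> b \<in> M \<Longrightarrow> a * b \<in> M" "a \<in> M \<Longrightarrow> inverse a \<in> M" "\<kappa> c \<in> M" "0 \<in> M" "1 \<in> M"
    "a \<in> M \<Longrightarrow> - a \<in> M"
proof -
  show *: "a \<in> M \<Longrightarrow> b \<in> M \<Longrightarrow> a + b \<in> M" "a \<in> M \<Longrightarrow> b \<in> M \<Longrightarrow> a - b \<in> M"
    "a \<in> M \<Longrightarrow> b \<in> M \<Longrightarrow> a * b \<in> M" "a \<in> M \<Longrightarrow> inverse a \<in> M" "\<kappa> c \<in> M" for a b c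
    using assms unfolding intermediate_field_def by blast+
  show 0: "0 \<in> M" and "1 \<in> M"
    using *(5)[of 0] *(5)[of 1] by (simp_all add: hom_zero hom_one)
  show "a \<in> M \<Longrightarrow> - a \<in> M"
    using *(2)[OF 0, of a] by simp
qed

context
  fixes M w
  assumes M: "intermediate_field M" and w: "w ^ 2 \<in> M" "w \<notin> M"
begin

lemma quadratic_coeffs_unique:
  assumes "p \<in> M" "q \<in> M" "p' \<in> M" "q' \<in> M" "p + q * w = p' + q' * w"
  shows "p = p' \<and> q = q'"
proof -
  have eq: "(q - q') * w = p' - p"
    using assms(5) by (simp add: algebra_simps)
  have "q = q'"
  proof (rule ccontr)
    assume "q \<noteq> q'"
    then have "w = inverse (q - q') * (p' - p)"
      unfolding eq[symmetric] by simp
    also have "\<dots> \<in> M"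
      using assms(1-4) by (intro intermediate_fieldD[OF M])
    finally show False
      using w(2) by blast
  qed
  then show ?thesis
    using eq by simp
qed

lemma quadratic_closureI: "p \<in> M \<Longrightarrow> q \<in> M \<Longrightarrow> p + q * w \<in> quadratic_closure M w"
  unfolding quadratic_closure_def by blast

lemma quadratic_closureE:
  assumes "u \<in> quadratic_closure M w"
  obtains p q where "p \<in> M" "q \<in> M" "u = p + q * w"
  using assms unfolding quadratic_closure_def by blast

lemma quadratic_closure_base: "M \<subseteq> quadratic_closure M w" "w \<in> quadratic_closure M w"
  using quadratic_closureI[of _ 0] quadratic_closureI[of 0 1] intermediate_fieldD(6,7)[OF M] by auto

lemma quadratic_closure_mult:
  "(p + q * w) * (p' + q' * w) = (p * p' + q * q' * w ^ 2) + (p * q' + q * p') * w"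
  by (simp add: algebra_simps power2_eq_square)

text \<open>Thus the set is the field M(w). Inverses exist because the norm n = (p + q w) (p - q w)
  lies in M and is nonzero for u \<noteq> 0.\<close>

lemma intermediate_field_quadratic_closure: "intermediate_field (quadratic_closure M w)"
  unfolding intermediate_field_def[of "quadratic_closure M w"]
proof (intro conjI ballI)
  show "range \<kappa> \<subseteq> quadratic_closure M w"
    using quadratic_closure_base(1) intermediate_fieldD(5)[OF M] by blast
  fix u v assume "u \<in> quadratic_closure M w" "v \<in> quadratic_closure M w"
  then obtain p q p' q' where u: "p \<in> M" "q \<in> M" "u = p + q * w"
    and v: "p' \<in> M" "q' \<in> M" "v = p' + q' * w"
    by (elim quadratic_closureE)
  have "u + v = (p + p') + (q + q') * w" "u - v = (p - p') + (q - q') * w"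
    using u v by (simp_all add: algebra_simps)
  then show "u + v \<in> quadratic_closure M w" "u - v \<in> quadratic_closure M w"
    using u v by (simp_all only: quadratic_closureI intermediate_fieldD(1,2)[OF M])
  have "u * v = (p * p' + q * q' * w ^ 2) + (p * q' + q * p') * w"
    unfolding u v quadratic_closure_mult ..
  then show "u * v \<in> quadratic_closure M w"
    using u v w(1) by (simp only: quadratic_closureI intermediate_fieldD(1,3)[OF M])
  show "inverse u \<in> quadratic_closure M w"
  proof (cases "u = 0")
    case True
    then show ?thesis
      using quadratic_closure_base(1) intermediate_fieldD(6)[OF M] by auto
  next
    case False
    define n where "n = p * p - q * q * w ^ 2"
    have n: "n = u * (p - q * w)"
      unfolding u(3) n_def by (simp add: algebra_simps power2_eq_square)
    have "p - q * w \<noteq> 0"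
    proof
      assume "p - q * w = 0"
      then have "p + (- q) * w = 0 + 0 * w"
        by simp
      then have "p = 0 \<and> - q = 0"
        using u intermediate_fieldD(6,8)[OF M] by (intro quadratic_coeffs_unique) auto
      then show False
        using False u(3) by simp
    qed
    then have "inverse u = inverse n * (p - q * w)"
      using False unfolding n by simp
    also have "\<dots> = p * inverse n + (- q * inverse n) * w"
      by (simp add: algebra_simps)
    finally have "inverse u = p * inverse n + (- q * inverse n) * w" .
    moreover have "inverse n \<in> M"
      unfolding n_def using u w(1) by (intro intermediate_fieldD[OF M])
    ultimately show ?thesis
      using u by (simp only: quadratic_closureI intermediate_fieldD(3,8)[OF M])
  qed
qed

text \<open>If (p + q w)^2 = e then 2 p q = 0. Either e = p^2, or e = q^2 w^2 and then e w^2 is the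
  square of q w^2; both are excluded.\<close>

lemma nonsquare_quadratic_closure:
  assumes "(2::'k) \<noteq> 0" "e \<in> M" "nonsquare M e" "nonsquare M (e * w ^ 2)"
  shows "nonsquare (quadratic_closure M w) e"
  unfolding nonsquare_def
proof (intro ballI notI)
  fix r assume "r \<in> quadratic_closure M w" "r ^ 2 = e"
  then obtain p q where r: "p \<in> M" "q \<in> M" "r = p + q * w" by (elim quadratic_closureE)
  have two: "(2::'f) \<noteq> 0"
    using hom_add[of 1 1] assms(1) hom_eq_0_iff[of 2] by (simp add: hom_one)
  have "(p * p + q * q * w ^ 2) + (p * q + q * p) * w = e + 0 * w"
    using \<open>r ^ 2 = e\<close> unfolding r(3) power2_eq_square[of "p + q * w"] quadratic_closure_mult by simp
  then have "p * p + q * q * w ^ 2 = e \<and> p * q + q * p = 0"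
    using r assms(2) w(1) by (intro quadratic_coeffs_unique intermediate_fieldD[OF M])
  then have eq: "p * p + q * q * w ^ 2 = e" "p = 0 \<or> q = 0"
    using two by (auto simp: mult.commute mult_2[symmetric])
  show False
  proof (cases "q = 0")
    case True
    then show False
      using eq(1) assms(3) r(1) unfolding nonsquare_def by (auto simp: power2_eq_square)
  next
    case False
    then have "e = q * q * w ^ 2"
      using eq by simp
    then have "(q * w ^ 2) ^ 2 = e * w ^ 2"
      by (simp add: power2_eq_square algebra_simps)
    moreover have "q * w ^ 2 \<in> M"
      using r w(1) by (intro intermediate_fieldD[OF M])
    ultimately show False
      using assms(4) unfolding nonsquare_def by blast
  qed
qed

lemma quadratic_involution:
  assumes univ: "quadratic_closure M w = UNIV" and "u \<in> M"
  shows "\<exists>\<tau>. involution_fixing u \<tau> \<and> (\<forall>v\<in>M. \<tau> v = v) \<and> \<tau> w = - w"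
proof -
  have "\<exists>p q. p \<in> M \<and> q \<in> M \<and> v = p + q * w" for v
    using univ unfolding quadratic_closure_def by blast
  then obtain p q where pq: "\<And>v. p v \<in> M \<and> q v \<in> M \<and> v = p v + q v * w"
    by metis
  define \<tau> where "\<tau> v = p v - q v * w" for v
  have \<tau>: "\<tau> (a + b * w) = a - b * w" if "a \<in> M" "b \<in> M" for a b
    using quadratic_coeffs_unique[of a b "p (a + b * w)" "q (a + b * w)"] pq[of "a + b * w"] that
    unfolding \<tau>_def by simp
  have fix_M: "\<tau> v = v" if "v \<in> M" for v
    using \<tau>[OF that intermediate_fieldD(6)[OF M]] by simp
  have rep: "\<exists>p q. p \<in> M \<and> q \<in> M \<and> v = p + q * w" for v
    using pq by blast
  have "\<tau> (a + b) = \<tau> a + \<tau> b \<and> \<tau> (a * b) = \<tau> a * \<tau> b" for a b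
  proof -
    obtain p q p' q' where ab: "p \<in> M" "q \<in> M" "a = p + q * w" "p' \<in> M" "q' \<in> M" "b = p' + q' * w"
      using rep[of a] rep[of b] by blast
    have sum: "a + b = (p + p') + (q + q') * w"
      using ab by (simp add: algebra_simps)
    have 1: "\<tau> (a + b) = (p + p') - (q + q') * w"
      unfolding sum using ab by (intro \<tau> intermediate_fieldD[OF M])
    have prod: "a * b = (p * p' + q * q' * w ^ 2) + (p * q' + q * p') * w"
      unfolding ab quadratic_closure_mult ..
    have 2: "\<tau> (a * b) = (p * p' + q * q' * w ^ 2) - (p * q' + q * p') * w"
      unfolding prod using ab w(1) by (intro \<tau> intermediate_fieldD[OF M])
    have 3: "\<tau> a = p - q * w" "\<tau> b = p' - q' * w"
      using ab \<tau> by simp_all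
    show ?thesis
      unfolding 1 2 3 by (simp add: algebra_simps power2_eq_square)
  qed
  moreover have "\<tau> (\<kappa> k) = \<kappa> k" for k
    using fix_M intermediate_fieldD(5)[OF M] by blast
  moreover have "\<tau> (\<tau> a) = a" for a
  proof -
    obtain p q where a: "p \<in> M" "q \<in> M" "a = p + q * w"
      using rep[of a] by blast
    then have "\<tau> a = p + (- q) * w"
      using \<tau> by simp
    then show ?thesis
      using a \<tau>[of p "- q"] intermediate_fieldD(8)[OF M] by simp
  qed
  moreover have "\<tau> w = - w"
    using \<tau>[of 0 1] intermediate_fieldD(6,7)[OF M] by simp
  ultimately show ?thesis
    unfolding involution_fixing_def using fix_M assms(2) by (intro exI[of _ \<tau>]) simp
qed

end

text \<open>The hypotheses concern the seven nonempty products of the three squares. By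
  \<open>nonsquare_quadratic_closure\<close>, adjoining a leaves three nonsquare conditions over
  M(a), and adjoining b leaves one over M(a, b). The last generator c is then negated by
  conjugation.\<close>

lemma triquadratic:
  assumes two: "(2::'k) \<noteq> 0" and M: "intermediate_field M" "u \<in> M"
    and sq: "a ^ 2 \<in> M" "b ^ 2 \<in> M" "c ^ 2 \<in> M"
    and ns: "nonsquare M (a ^ 2)" "nonsquare M (b ^ 2)" "nonsquare M (c ^ 2)"
      "nonsquare M (b ^ 2 * a ^ 2)" "nonsquare M (c ^ 2 * a ^ 2)" "nonsquare M (c ^ 2 * b ^ 2)"
      "nonsquare M (c ^ 2 * b ^ 2 * a ^ 2)"
    and gen: "\<And>L. intermediate_field L \<Longrightarrow> M \<subseteq> L \<Longrightarrow> a \<in> L \<Longrightarrow> b \<in> L \<Longrightarrow> c \<in> L \<Longrightarrow> L = UNIV"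
  shows "\<exists>\<tau>. involution_fixing u \<tau> \<and> (\<forall>v\<in>M. \<tau> v = v) \<and> \<tau> a = a \<and> \<tau> b = b \<and> \<tau> c = - c"
    and "quadratic_closure (quadratic_closure (quadratic_closure M a) b) c = UNIV"
proof -
  define M1 where "M1 = quadratic_closure M a"
  define M2 where "M2 = quadratic_closure M1 b"
  note D = intermediate_fieldD
  have a: "a \<notin> M"
    using ns(1) unfolding nonsquare_def by blast
  have M1: "intermediate_field M1" "M \<subseteq> M1" "a \<in> M1"
    unfolding M1_def using intermediate_field_quadratic_closure[OF M(1) sq(1) a]
      quadratic_closure_base[OF M(1) sq(1) a] by auto
  have step1: "nonsquare M1 e" if "e \<in> M" "nonsquare M e" "nonsquare M (e * a ^ 2)" for e
    unfolding M1_def using nonsquare_quadratic_closure[OF M(1) sq(1) a two that] .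
  have sq1: "b ^ 2 \<in> M1" "c ^ 2 \<in> M1"
    using sq M1(2) by auto
  have ns1: "nonsquare M1 (b ^ 2)" "nonsquare M1 (c ^ 2)" "nonsquare M1 (c ^ 2 * b ^ 2)"
    using ns sq D(3)[OF M(1)] by (auto intro: step1)
  have b: "b \<notin> M1"
    using ns1(1) unfolding nonsquare_def by blast
  have M2: "intermediate_field M2" "M1 \<subseteq> M2" "b \<in> M2"
    unfolding M2_def using intermediate_field_quadratic_closure[OF M1(1) sq1(1) b]
      quadratic_closure_base[OF M1(1) sq1(1) b] by auto
  have "nonsquare M2 (c ^ 2)"
    unfolding M2_def using nonsquare_quadratic_closure[OF M1(1) sq1(1) b two sq1(2) ns1(2,3)] .
  then have c: "c \<notin> M2"
    unfolding nonsquare_def by blast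
  have sq2: "c ^ 2 \<in> M2"
    using sq1 M2 by blast
  have univ: "quadratic_closure M2 c = UNIV"
    using intermediate_field_quadratic_closure[OF M2(1) sq2 c] quadratic_closure_base[OF M2(1) sq2 c] M1 M2
    by (intro gen) auto
  then show "quadratic_closure (quadratic_closure (quadratic_closure M a) b) c = UNIV"
    unfolding M2_def M1_def .
  have "u \<in> M2"
    using M(2) M1 M2 by blast
  then obtain \<tau> where "involution_fixing u \<tau>" "\<forall>v\<in>M2. \<tau> v = v" "\<tau> c = - c"
    using quadratic_involution[OF M2(1) sq2 c univ, of u] by blast
  then show "\<exists>\<tau>. involution_fixing u \<tau> \<and> (\<forall>v\<in>M. \<tau> v = v) \<and> \<tau> a = a \<and> \<tau> b = b \<and> \<tau> c = - c"
    using M1 M2 by (intro exI[of _ \<tau>]) auto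
qed

end

section \<open>Places over a point of the affine line and over infinity\<close>

context multiquadratic
begin

definition fiber :: "'k \<Rightarrow> 'f set set" where
  "fiber s = {P \<in> places. x - \<kappa> s \<in> P}"

lemma fiberD: "P \<in> fiber s \<Longrightarrow> P \<in> places" "P \<in> fiber s \<Longrightarrow> x - \<kappa> s \<in> P"
  unfolding fiber_def by auto

lemma ev_linear: "ev x [:- s, 1:] = x - \<kappa> s"
  by (simp add: hom_minus hom_one)

lemma x_minus_hom_neq_0: "x - \<kappa> s \<noteq> 0"
  using ev_eq_0_iff[of "[:- s, 1:]"] unfolding ev_linear by simp

lemma finite_fiber: "finite (fiber s)"
  unfolding fiber_def using finite_zeros[OF ev_in_Kx[of "[:- s, 1:]"]] x_minus_hom_neq_0[of s]
  unfolding ev_linear by blast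

text \<open>x - s is not a unit of K[x], so a valuation ring containing K[x] exists in which it is
  still not a unit.\<close>

lemma fiber_nonempty: "fiber s \<noteq> {}"
proof -
  let ?m = "ev x [:- s, 1:]"
  have m0: "?m \<noteq> 0"
    unfolding ev_linear by (rule x_minus_hom_neq_0)
  have "inverse ?m \<notin> range (ev x)"
  proof
    assume "inverse ?m \<in> range (ev x)"
    then obtain p where p: "inverse ?m = ev x p" by blast
    have "ev x ([:- s, 1:] * p) = ?m * inverse ?m"
      unfolding p by (rule ev_mult)
    also have "\<dots> = ev x 1"
      by (simp only: right_inverse[OF m0] ev_1)
    finally have "1 = [:- s, 1:] * p"
      unfolding ev_eq_iff by (rule sym)
    then have "[:- s, 1:] dvd 1"
      by (rule dvdI)
    then show False
      by (simp add: is_unit_pCons_iff)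
  qed
  then obtain R where R: "valuation_ring R" "range (ev x) \<subseteq> R" "inverse ?m \<notin> R"
    using exists_valuation_ring[OF subring_range_ev _ m0] by blast
  then have "?m \<in> R - ring_units R"
    using ring_units_iff[OF R(1), of ?m] by blast
  then show ?thesis
    using nonunits_in_places[OF R(1)] unfolding fiber_def ev_linear by blast
qed

lemma fiber_x: "P \<in> fiber s \<Longrightarrow> x \<in> place_ring P"
proof -
  assume P: "P \<in> fiber s"
  have "x - \<kappa> s + \<kappa> s \<in> place_ring P"
    using fiberD[OF P] place_subset[of P] subringD[OF subring_place_ring[OF fiberD(1)[OF P]]] by blast
  then show ?thesis by simp
qed

lemma fiber_ev: "P \<in> fiber s \<Longrightarrow> ev x p \<in> place_ring P"
  using subring_ev[OF subring_place_ring] fiberD(1) fiber_x by blast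

lemma fiber_residue: assumes P: "P \<in> fiber s" shows "ev x p - \<kappa> (poly p s) \<in> P"
proof -
  have "[:- s, 1:] dvd p - [:poly p s:]"
    by (simp add: dvd_iff_poly_eq_0)
  then obtain q where q: "p - [:poly p s:] = [:- s, 1:] * q" by (elim dvdE)
  have "ev x p - \<kappa> (poly p s) = ev x (p - [:poly p s:])"
    by simp
  also have "\<dots> = ev x q * (x - \<kappa> s)"
    unfolding q ev_mult ev_linear by (rule mult.commute)
  finally show ?thesis
    using place_mult[OF fiberD(1)[OF P] fiber_ev[OF P] fiberD(2)[OF P]] by simp
qed

lemma fiber_sqrt_in_ring:
  assumes P: "P \<in> fiber s" and \<beta>: "\<beta> ^ 2 = ev x p" shows "\<beta> \<in> place_ring P"
  using square_in_place_ring[OF fiberD(1)[OF P], of \<beta>] \<beta> fiber_ev[OF P] by simp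

lemma fiber_sqrt_residue:
  assumes P: "P \<in> fiber s" and \<beta>: "\<beta> ^ 2 = ev x p" and d: "d ^ 2 = poly p s"
  shows "\<beta> - \<kappa> d \<in> P \<or> \<beta> - \<kappa> (- d) \<in> P"
proof -
  note PP = fiberD(1)[OF P]
  have "(\<beta> - \<kappa> d) * (\<beta> - \<kappa> (- d)) = ev x p - \<kappa> (poly p s)"
    unfolding \<beta>[symmetric] d[symmetric] by (simp add: hom_minus hom_mult algebra_simps power2_eq_square)
  then have "(\<beta> - \<kappa> d) * (\<beta> - \<kappa> (- d)) \<in> P"
    using fiber_residue[OF P] by simp
  moreover have "\<beta> - \<kappa> d \<in> place_ring P"
    using fiber_sqrt_in_ring[OF P \<beta>] subringD[OF subring_place_ring[OF PP]] by blast
  ultimately show ?thesis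
    using place_prime[OF PP] by blast
qed

lemma rational_place_residue:
  assumes P: "P \<in> places" "place_degree P = 1" "u \<in> place_ring P"
  shows "\<exists>c. u - \<kappa> c \<in> P"
  using codim_place[OF P(1)] P subspace_place[OF P(1)] subring_1[OF subring_place_ring[OF P(1)]]
    one_notin_place[OF P(1)] by (intro rational_residue[of "place_ring P"]) simp_all

lemma rational_place_square:
  assumes P: "P \<in> places" "place_degree P = 1" and u: "u ^ 2 - \<kappa> e \<in> P"
  shows "\<exists>d. d ^ 2 = e"
proof -
  note sr = subring_place_ring[OF P(1)]
  have "u ^ 2 - \<kappa> e + \<kappa> e \<in> place_ring P"
    using u place_subset[OF P(1)] subringD[OF sr] by blast
  then have uR: "u \<in> place_ring P"
    using square_in_place_ring[OF P(1), of u] by simp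
  then obtain d where d: "u - \<kappa> d \<in> P"
    using rational_place_residue[OF P] by blast
  have "(u + \<kappa> d) * (u - \<kappa> d) \<in> P"
    using d uR subringD[OF sr] by (intro place_mult[OF P(1)]) auto
  then have "(u ^ 2 - \<kappa> e) - (u + \<kappa> d) * (u - \<kappa> d) \<in> P"
    using u place_diff[OF P(1)] by blast
  moreover have "(u ^ 2 - \<kappa> e) - (u + \<kappa> d) * (u - \<kappa> d) = \<kappa> (d ^ 2 - e)"
    by (simp add: hom_diff hom_mult power2_eq_square algebra_simps)
  ultimately have "\<kappa> (d ^ 2 - e) \<in> P"
    by simp
  then have "d ^ 2 - e = 0"
    using hom_in_place_iff[OF P(1)] by blast
  then show ?thesis
    by (intro exI[of _ d]) simp
qed

lemma rational_fiber_square: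
  assumes P: "P \<in> fiber s" "place_degree P = 1" and \<beta>: "\<beta> ^ 2 = ev x p"
  shows "\<exists>d. d ^ 2 = poly p s"
  using rational_place_square[OF fiberD(1)[OF P(1)] P(2), of \<beta>] fiber_residue[OF P(1), of p] \<beta> by simp

text \<open>Since \<open>D i\<close> has degree 2 * \<open>g i\<close>, the square of
  \<open>w i / x ^ g i\<close> is \<open>D i\<close> divided by its power of x. At infinity this has
  the leading coefficient as residue, which must be a square if the residue field is K.\<close>

lemma rational_infinite_square:
  assumes P: "P \<in> infinite_places" "place_degree P = 1" and i: "i \<in> I"
  shows "\<exists>d. d ^ 2 = lead_coeff (D i)"
proof (rule rational_place_square[OF infinite_placesD(1)[OF P(1)] P(2)])
  note PP = infinite_placesD(1)[OF P(1)]
  let ?d = "degree (D i)"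
  define p where "p = D i - monom (lead_coeff (D i)) ?d"
  have "ev x p / x ^ ?d \<in> P"
  proof (cases "p = 0")
    case True
    then show ?thesis
      using place_iff[OF PP, of 0] by simp
  next
    case False
    have "coeff p ?d = 0"
      by (simp add: p_def)
    moreover have "degree p \<le> ?d"
      unfolding p_def by (intro degree_diff_le degree_monom_le) simp
    ultimately have deg: "degree p < ?d"
      using False eq_zero_or_degree_less by blast
    have "valuation P (ev x p / x ^ ?d) = - int (degree p * pole P) + int (?d * pole P)"
      using valuation_divide[OF PP, of "ev x p" "x ^ ?d"] valuation_power[OF PP x_neq_0, of ?d] False x_neq_0
        valuation_ev_infinite[OF P(1) False] pole_infinite[OF P(1)] by simp
    moreover have "degree p * pole P < ?d * pole P"
      using deg pole_infinite[OF P(1)] by simp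
    then have "int (degree p * pole P) < int (?d * pole P)"
      by (simp only: of_nat_less_iff)
    ultimately have "0 < valuation P (ev x p / x ^ ?d)"
      by linarith
    then show ?thesis
      using place_iff_valuation[OF PP, of "ev x p / x ^ ?d"] False x_neq_0 by simp
  qed
  moreover have "ev x p / x ^ ?d = (w i / x ^ g i) ^ 2 - \<kappa> (lead_coeff (D i))"
  proof -
    have "(x ^ g i) ^ 2 = x ^ ?d"
      unfolding degree_D[OF i] by (simp add: mult.commute flip: power_mult)
    then have "(w i / x ^ g i) ^ 2 = ev x (D i) / x ^ ?d"
      using w_square[OF i] by (simp only: power_divide)
    then show ?thesis
      unfolding p_def using x_neq_0 by (simp add: diff_divide_distrib)
  qed
  ultimately show "(w i / x ^ g i) ^ 2 - \<kappa> (lead_coeff (D i)) \<in> P"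
    by simp
qed

lemma rational_place_cases:
  assumes P: "P \<in> places" "place_degree P = 1" "P \<notin> infinite_places"
  shows "\<exists>s. P \<in> fiber s"
  using rational_place_residue[OF P(1,2), of x] P unfolding infinite_places_def fiber_def by blast

lemma fiber_disjoint: assumes "s \<noteq> s'" shows "fiber s \<inter> fiber s' = {}"
proof -
  have False if P: "P \<in> fiber s" "P \<in> fiber s'" for P
  proof -
    have "(x - \<kappa> s') - (x - \<kappa> s) \<in> P"
      using place_diff[OF fiberD(1)[OF P(1)]] fiberD(2)[OF P(1)] fiberD(2)[OF P(2)] by blast
    then have "\<kappa> (s - s') \<in> P"
      by (simp add: hom_diff)
    then show False
      using hom_in_place_iff[OF fiberD(1)[OF P(1)]] assms by auto
  qed
  then show ?thesis by blast
qed

text \<open>The zeros of x - s, weighted with order and degree, amount to at most card I. The places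
  of T with order at least e already exhaust this, so there are no others and all degrees are
  1.\<close>

lemma fiber_full:
  assumes e: "0 < e" "\<And>P. P \<in> fiber s \<Longrightarrow> int e \<le> valuation P (x - \<kappa> s)"
    and T: "T \<subseteq> fiber s" "card T * e = card I"
  shows "card (fiber s) = card T \<and> fiber s \<subseteq> rational_places"
proof -
  let ?v = "\<lambda>P. nat (valuation P (x - \<kappa> s))"
  have "(\<Sum>P\<in>fiber s. ?v P * place_degree P) \<le> card I * 1"
  proof (rule zero_degree_bound[of _ _ "[:- s, 1:]" 1])
    show "x - \<kappa> s = ev x [:- s, 1:] / ev x 1"
      unfolding ev_linear by simp
  qed (use finite_fiber fiberD in auto)
  then have bound: "(\<Sum>P\<in>fiber s. ?v P * place_degree P) \<le> card T * e"
    using T(2) by simp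
  have ge: "e * place_degree P \<le> ?v P * place_degree P" if "P \<in> fiber s" for P
    using e(2)[OF that] by (intro mult_le_mono1) simp
  have deg: "1 \<le> place_degree P" if "P \<in> fiber s" for P
    using place_degree_pos[OF fiberD(1)[OF that]] by simp
  have "e * (\<Sum>P\<in>fiber s. place_degree P) \<le> (\<Sum>P\<in>fiber s. ?v P * place_degree P)"
    unfolding sum_distrib_left using ge by (intro sum_mono)
  then have "e * (\<Sum>P\<in>fiber s. place_degree P) \<le> e * card T"
    using bound unfolding mult.commute[of e "card T"] by (rule order_trans)
  then have le: "(\<Sum>P\<in>fiber s. place_degree P) \<le> card T"
    using e(1) by simp
  have "(\<Sum>P\<in>fiber s. 1) \<le> (\<Sum>P\<in>fiber s. place_degree P)"
    using deg by (intro sum_mono)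
  then have c: "card (fiber s) = card T" "(\<Sum>P\<in>fiber s. place_degree P) = (\<Sum>P\<in>fiber s. 1)"
    using le card_mono[OF finite_fiber T(1)] by simp_all
  have "place_degree P = 1" if P: "P \<in> fiber s" for P
  proof (rule ccontr)
    assume "place_degree P \<noteq> 1"
    then have "1 < place_degree P"
      using deg[OF P] by simp
    then have "(\<Sum>P\<in>fiber s. 1) < (\<Sum>P\<in>fiber s. place_degree P)"
      using deg P by (intro sum_strict_mono_ex1[OF finite_fiber]) auto
    then show False
      using c(2) by simp
  qed
  then show ?thesis
    using c fiberD(1) unfolding rational_places_def by blast
qed

text \<open>The squarefree \<open>D i\<close> has a simple zero at s, so the square of
  \<open>w i\<close> is x - s times a unit. The valuation of x - s is therefore even as well as
  positive.\<close>

lemma fiber_ramified: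
  assumes i: "i \<in> I" "poly (D i) s = 0" and P: "P \<in> fiber s"
  shows "2 \<le> valuation P (x - \<kappa> s)"
proof -
  note PP = fiberD(1)[OF P]
  obtain q where q: "D i = [:- s, 1:] * q"
    using i(2) unfolding poly_eq_0_iff_dvd by (elim dvdE)
  have qs: "poly q s \<noteq> 0"
  proof
    assume "poly q s = 0"
    then obtain q' where "q = [:- s, 1:] * q'"
      unfolding poly_eq_0_iff_dvd by (elim dvdE)
    then have "D i = [:- s, 1:] ^ 2 * q'"
      unfolding q power2_eq_square by (simp only: mult.assoc)
    then have "[:- s, 1:] dvd 1"
      by (intro D_squarefree[OF i(1)] dvdI)
    then show False
      by (simp add: is_unit_pCons_iff)
  qed
  have qP: "ev x q \<notin> P"
  proof
    assume "ev x q \<in> P"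
    then have "ev x q - (ev x q - \<kappa> (poly q s)) \<in> P"
      using fiber_residue[OF P] place_diff[OF PP] by blast
    then show False
      using hom_in_place_iff[OF PP] qs by simp
  qed
  have q0: "ev x q \<noteq> 0"
    using qP place_iff[OF PP, of 0] by auto
  have "0 \<le> valuation P (ev x q)"
    using place_ring_iff_valuation[OF PP q0] fiber_ev[OF P] by blast
  then have vq: "valuation P (ev x q) = 0"
    using place_iff_valuation[OF PP q0] qP by simp
  have "w i ^ 2 = (x - \<kappa> s) * ev x q"
    using w_square[OF i(1)] unfolding q ev_mult ev_linear .
  then have "2 * valuation P (w i) = valuation P (x - \<kappa> s)"
    using valuation_power[OF PP w_neq_0[OF i(1)], of 2] valuation_mult[OF PP x_minus_hom_neq_0 q0, of s] vq by simp
  moreover have "0 < valuation P (x - \<kappa> s)"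
    using place_iff_valuation[OF PP x_minus_hom_neq_0] fiberD(2)[OF P] by blast
  ultimately show ?thesis by presburger
qed

text \<open>An involution that negates \<open>\<beta>\<close> moves the places at which \<open>\<beta>\<close> has residue \<open>d\<close> to
  those where it has residue \<open>- d\<close>, so it doubles a set of such places.\<close>

lemma fiber_double:
  assumes \<tau>: "involution_fixing x \<tau>" "\<tau> \<beta> = - \<beta>" and d: "d \<noteq> 0"
    and T: "T \<subseteq> fiber s" "\<forall>P\<in>T. \<beta> - \<kappa> d \<in> P"
  shows "T \<union> (vimage \<tau>) ` T \<subseteq> fiber s" "card (T \<union> (vimage \<tau>) ` T) = 2 * card T"
    "\<And>\<gamma> c. \<tau> \<gamma> = \<gamma> \<Longrightarrow> \<forall>P\<in>T. \<gamma> - \<kappa> c \<in> P \<Longrightarrow> \<forall>P\<in>T \<union> (vimage \<tau>) ` T. \<gamma> - \<kappa> c \<in> P"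
proof -
  note D = involution_fixingD[OF \<tau>(1)] and diff = involution_diff[OF \<tau>(1)]
  have fin: "finite T"
    using T(1) finite_fiber finite_subset by blast
  have "\<tau> -` P \<in> fiber s" if "P \<in> T" for P
  proof -
    have "P \<in> fiber s"
      using T(1) that by (rule subsetD)
    moreover have "\<tau> (x - \<kappa> s) = x - \<kappa> s"
      by (simp only: diff D(3,4))
    ultimately show ?thesis
      using involution_place[OF \<tau>(1), of P] unfolding fiber_def by simp
  qed
  then show "T \<union> (vimage \<tau>) ` T \<subseteq> fiber s"
    using T(1) by (intro Un_least image_subsetI)
  have inj: "inj (vimage \<tau>)"
  proof (rule injI)
    fix A B assume AB: "\<tau> -` A = \<tau> -` B"
    show "A = B"
    proof (rule set_eqI)
      fix v
      have "\<tau> v \<in> \<tau> -` A \<longleftrightarrow> \<tau> v \<in> \<tau> -` B"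
        unfolding AB ..
      then show "v \<in> A \<longleftrightarrow> v \<in> B"
        by (simp add: D(5))
    qed
  qed
  have disj: "T \<inter> (vimage \<tau>) ` T = {}"
  proof -
    have False if Q: "Q \<in> T" "\<tau> -` Q \<in> T" for Q
    proof -
      have P: "\<tau> -` Q \<in> places"
        by (rule fiberD(1)[OF subsetD[OF T(1) Q(2)]])
      \<comment> \<open>At a place lying in both sets \<beta> would have the residues d and - d, and
        2 d \<noteq> 0.\<close>
      have "- \<beta> - \<kappa> d \<in> \<tau> -` Q"
        using bspec[OF T(2) Q(1)] \<tau>(2) D(3) by (simp add: diff involution_minus[OF \<tau>(1)])
      then have "(- \<beta> - \<kappa> d) + (\<beta> - \<kappa> d) \<in> \<tau> -` Q"
        by (rule place_add[OF P _ bspec[OF T(2) Q(2)]])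
      moreover have "(- \<beta> - \<kappa> d) + (\<beta> - \<kappa> d) = \<kappa> (- (2 * d))"
        unfolding mult_2 hom_minus hom_add by simp
      ultimately have "\<kappa> (- (2 * d)) \<in> \<tau> -` Q"
        by (simp only:)
      then have "- (2 * d) = 0"
        by (simp only: hom_in_place_iff[OF P])
      then show False
        using d two_neq_0 by simp
    qed
    then show ?thesis by blast
  qed
  show "card (T \<union> (vimage \<tau>) ` T) = 2 * card T"
    using card_Un_disjoint[OF fin finite_imageI[OF fin] disj] card_image[OF inj_on_subset[OF inj subset_UNIV]] by simp
  show "\<forall>P\<in>T \<union> (vimage \<tau>) ` T. \<gamma> - \<kappa> c \<in> P"
    if \<gamma>: "\<tau> \<gamma> = \<gamma>" "\<forall>P\<in>T. \<gamma> - \<kappa> c \<in> P" for \<gamma> c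
  proof
    fix P assume P: "P \<in> T \<union> (vimage \<tau>) ` T"
    show "\<gamma> - \<kappa> c \<in> P"
    proof (cases "P \<in> T")
      case True
      then show ?thesis using \<gamma>(2) by blast
    next
      case False
      then obtain Q where Q: "Q \<in> T" "P = \<tau> -` Q"
        using P by blast
      have "\<tau> (\<gamma> - \<kappa> c) = \<gamma> - \<kappa> c"
        using \<gamma>(1) D(3)[of c] by (simp add: diff)
      then show ?thesis
        unfolding Q(2) using bspec[OF \<gamma>(2) Q(1)] by simp
    qed
  qed
qed

end

section \<open>Arithmetic in the field with 121 elements\<close>

text \<open>
  The pair \<open>(i, j)\<close> with entries in \<open>{0..10}\<close> stands for \<open>i + j \<alpha>\<close> in \<open>F_{121}\<close>. It is a square if and only if its norm
  \<open>i\<^sup>2 + j\<^sup>2\<close> is a square in \<open>F_{11}\<close>.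
\<close>

definition gadd :: "int \<times> int \<Rightarrow> int \<times> int \<Rightarrow> int \<times> int" where
  "gadd u v = ((fst u + fst v) mod 11, (snd u + snd v) mod 11)"

definition gmul :: "int \<times> int \<Rightarrow> int \<times> int \<Rightarrow> int \<times> int" where
  "gmul u v = ((fst u * fst v - snd u * snd v) mod 11, (fst u * snd v + snd u * fst v) mod 11)"

definition gelems :: "(int \<times> int) list" where
  "gelems = List.product [0..10] [0..10]"

definition gsquare :: "int \<times> int \<Rightarrow> bool" where
  "gsquare u \<longleftrightarrow> List.member [0, 1, 3, 4, 5, 9] ((fst u * fst u + snd u * snd u) mod 11)"

definition gsix :: "int \<times> int \<Rightarrow> int \<times> int" where
  "gsix u = (let v = gmul u (gmul u u) in gmul v v)"

definition gF :: "int \<times> int \<Rightarrow> int \<times> int" where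
  "gF u = gmul (gadd u (1, 0)) (gadd (gadd (gmul u u) u) (1, 0))"

definition gG :: "int \<times> int \<Rightarrow> int \<times> int" where
  "gG u = gmul (gadd u (10, 0)) (gadd (gadd (gmul u u) (gmul (10, 0) u)) (1, 0))"

text \<open>
  The values of the polynomials \<open>D i\<close> defined below: \<open>gA\<close>, \<open>gB\<close>, \<open>gC\<close> for the squares of \<open>a\<close>, \<open>b\<close>, \<open>z\<close>, and
  \<open>gAC\<close>, \<open>gBC\<close> for those of \<open>a z\<close>, \<open>b z\<close> after removal of the square factor.
\<close>

definition gA :: "int \<times> int \<Rightarrow> int \<times> int" where
  "gA u = gadd (2, 0) (gmul (2, 0) (gsix u))"

definition gB :: "int \<times> int \<Rightarrow> int \<times> int" where
  "gB u = gadd (2, 0) (gmul (9, 0) (gsix u))"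

definition gC :: "int \<times> int \<Rightarrow> int \<times> int" where
  "gC u = gmul (1, 1) (gmul (gF u) (gF (gmul (0, 1) u)))"

definition gAC :: "int \<times> int \<Rightarrow> int \<times> int" where
  "gAC u = gmul (9, 9) (gmul (gF u) (gG (gmul (0, 1) u)))"

definition gBC :: "int \<times> int \<Rightarrow> int \<times> int" where
  "gBC u = gmul (9, 9) (gmul (gG u) (gF (gmul (0, 1) u)))"

definition gunit_square :: "int \<times> int \<Rightarrow> bool" where
  "gunit_square u \<longleftrightarrow> u \<noteq> (0, 0) \<and> gsquare u"

definition gsplit :: "int \<times> int \<Rightarrow> bool" where
  "gsplit u \<longleftrightarrow> gunit_square (gA u) \<and> gunit_square (gB u) \<and> gunit_square (gC u)"

definition gramified :: "int \<times> int \<Rightarrow> bool" where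
  "gramified u \<longleftrightarrow> gA u = (0, 0) \<or> gB u = (0, 0)"

lemma gsquare_gmul: "\<forall>v\<in>set gelems. gsquare (gmul v v)"
  by code_simp

text \<open>A square root for each of the 61 squares, in the order of \<open>gelems\<close>. It
  certifies that the norm criterion \<open>gsquare\<close> is sufficient;
  \<open>gsquare_gmul\<close> is the necessity.\<close>

lemma gsquare_roots: "filter gsquare gelems = map (\<lambda>v. gmul v v)
   [(0, 0), (4, 7), (1, 1), (2, 9), (3, 8), (5, 6), (5, 5), (3, 3), (2, 2), (1, 10), (4, 4),
    (1, 0), (2, 6), (4, 2), (4, 9), (2, 5), (0, 3), (5, 10), (4, 6), (4, 5), (5, 1), (5, 0),
    (2, 1), (1, 8), (1, 3), (2, 10), (2, 0), (3, 4), (4, 10), (4, 1), (3, 7), (4, 0), (3, 2),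
    (5, 8), (5, 3), (3, 9), (0, 4), (2, 3), (3, 6), (3, 5), (2, 8), (0, 2), (4, 3), (1, 7),
    (1, 4), (4, 8), (0, 5), (1, 2), (3, 10), (3, 1), (1, 9), (3, 0), (1, 6), (5, 7), (5, 4),
    (1, 5), (0, 1), (5, 9), (2, 4), (2, 7), (5, 2)]"
  by code_simp

lemma gsplit_count: "length (filter gsplit gelems) = 56"
  by code_simp

lemma gramified_count: "length (filter gramified gelems) = 12"
  by code_simp

text \<open>The zeros of the squares of a, b, z all satisfy s^12 = 1. Where a^2 vanishes, b^2 = 4,
  and the third square root that remains a unit is z or, if z^2 vanishes too, a z divided by the
  common factor of a^2 and z^2; similarly with a and b exchanged.\<close>

lemma gramified_squares:
  "\<forall>u\<in>set gelems. (gC u = (0, 0) \<longrightarrow> gramified u) \<and>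
     (gA u = (0, 0) \<longrightarrow> gunit_square (gB u) \<and> (gunit_square (gC u) \<or> gunit_square (gAC u))) \<and>
     (gB u = (0, 0) \<longrightarrow> gunit_square (gA u) \<and> (gunit_square (gC u) \<or> gunit_square (gBC u)))"
  by code_simp

lemma nonsquare_at_infinity: "\<not> gsquare (1, 10)"
  by code_simp

text \<open>-1 is not a square modulo 11, so the norm form is anisotropic. The range is that of
  differences of entries from 0 to 10.\<close>

lemma gnorm_eq_0: "\<forall>c\<in>set [-10..10]. \<forall>d\<in>set [-10..10]. (c * c + d * d) mod 11 = (0::int) \<longrightarrow> c = 0 \<and> d = 0"
  by code_simp

lemma inverse_mod_11: "\<forall>r\<in>set [1..10]. \<exists>s\<in>set [1..10]. r * s mod 11 = (1::int)"
  by code_simp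

section \<open>The field with 121 elements and the polynomials over it\<close>

locale field_121 =
  fixes \<alpha> :: "'k::field"
  assumes card_field: "card (UNIV :: 'k set) = 11 ^ 2" and \<alpha>_square: "\<alpha> ^ 2 = - 1"
begin

lemma finite_field: "finite (UNIV :: 'k set)"
  using card_field by (intro card_ge_0_finite) simp

text \<open>The translation by 1 permutes the field, so comparing the sums of all elements gives 121
  = 0.\<close>

lemma eleven_eq_0: "(11 :: 'k) = 0"
proof -
  have "(\<Sum>u\<in>(UNIV :: 'k set). u + 1) = (\<Sum>u\<in>(UNIV :: 'k set). u)"
    by (rule sum.reindex_bij_witness[of _ "\<lambda>u. u - 1" "\<lambda>u. u + 1"]) auto
  then have "of_nat (card (UNIV :: 'k set)) = (0 :: 'k)"
    by (simp add: sum.distrib)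
  then have "(11 :: 'k) * 11 = 0"
    unfolding card_field by simp
  then have "(11 :: 'k) = 0 \<or> (11 :: 'k) = 0"
    by (simp only: mult_eq_0_iff)
  then show ?thesis by blast
qed

lemma two_neq_0: "(2 :: 'k) \<noteq> 0"
proof
  assume "(2 :: 'k) = 0"
  then have "(11 :: 'k) - 5 * 2 = 0"
    using eleven_eq_0 by simp
  then show False by simp
qed

lemma of_int_mod_11: "of_int (n mod 11) = (of_int n :: 'k)"
proof -
  have "(of_int n :: 'k) = of_int (11 * (n div 11) + n mod 11)"
    by simp
  also have "\<dots> = 11 * of_int (n div 11) + of_int (n mod 11)"
    by (simp only: of_int_add of_int_mult of_int_numeral)
  finally show ?thesis
    by (simp add: eleven_eq_0)
qed

definition \<phi> :: "int \<times> int \<Rightarrow> 'k" where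
  "\<phi> u = of_int (fst u) + of_int (snd u) * \<alpha>"

lemma \<phi>_gadd: "\<phi> (gadd u v) = \<phi> u + \<phi> v"
  by (simp add: \<phi>_def gadd_def of_int_mod_11 algebra_simps)

lemma \<phi>_gmul: "\<phi> (gmul u v) = \<phi> u * \<phi> v"
proof -
  have "\<phi> u * \<phi> v = of_int (fst u) * of_int (fst v) +
      (of_int (fst u) * of_int (snd v) + of_int (snd u) * of_int (fst v)) * \<alpha> +
      of_int (snd u) * of_int (snd v) * \<alpha> ^ 2"
    by (simp add: \<phi>_def algebra_simps power2_eq_square)
  then show ?thesis
    unfolding \<alpha>_square by (simp add: \<phi>_def gmul_def of_int_mod_11 algebra_simps)
qed

lemma of_int_eq_0_imp: assumes "of_int n = (0 :: 'k)" shows "n mod 11 = 0"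
proof (rule ccontr)
  assume "n mod 11 \<noteq> 0"
  moreover have "0 \<le> n mod 11" "n mod 11 < 11"
    by simp_all
  ultimately have "n mod 11 \<in> set [1..10]"
    by auto
  then obtain s where s: "n mod 11 * s mod 11 = 1"
    using inverse_mod_11 by blast
  have "(1 :: 'k) = of_int (n mod 11 * s mod 11)"
    by (simp only: s of_int_1)
  also have "\<dots> = 0"
    by (simp add: of_int_mod_11 assms)
  finally show False by simp
qed

lemma gelems_iff: "u \<in> set gelems \<longleftrightarrow> fst u \<in> {0..10} \<and> snd u \<in> {0..10}"
  by (cases u) (simp add: gelems_def)

lemma gmul_in_gelems: "gmul u v \<in> set gelems" and gadd_in_gelems: "gadd u v \<in> set gelems"
proof -
  have "n mod 11 \<le> 10" for n :: int
    using pos_mod_bound[of 11 n] by linarith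
  then show "gmul u v \<in> set gelems" "gadd u v \<in> set gelems"
    unfolding gelems_iff gmul_def gadd_def by simp_all
qed

lemma \<phi>_inj: "inj_on \<phi> (set gelems)"
proof (rule inj_onI)
  fix u v assume u: "u \<in> set gelems" and v: "v \<in> set gelems" and eq: "\<phi> u = \<phi> v"
  define c where "c = fst u - fst v"
  define d where "d = snd u - snd v"
  \<comment> \<open>Multiplication by the conjugate turns the equation into a vanishing norm modulo
    11.\<close>
  have "(of_int c + of_int d * \<alpha>) * (of_int c - of_int d * \<alpha>) = 0"
    using eq by (simp add: \<phi>_def c_def d_def algebra_simps)
  moreover have "(of_int c + of_int d * \<alpha>) * (of_int c - of_int d * \<alpha>) =
      of_int c * of_int c - of_int d * of_int d * \<alpha> ^ 2"
    by (simp add: algebra_simps power2_eq_square)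
  ultimately have "of_int (c * c + d * d) = (0 :: 'k)"
    unfolding \<alpha>_square by simp
  then have "(c * c + d * d) mod 11 = 0"
    by (rule of_int_eq_0_imp)
  moreover have cd: "c \<in> set [-10..10]" "d \<in> set [-10..10]"
    using u v unfolding gelems_iff c_def d_def by auto
  ultimately have "c = 0 \<and> d = 0"
    by (intro mp[OF bspec[OF bspec[OF gnorm_eq_0 cd(1)] cd(2)]])
  then show "u = v"
    unfolding c_def d_def by (simp add: prod_eq_iff)
qed

lemma distinct_gelems: "distinct gelems"
  unfolding gelems_def by (intro distinct_product) simp_all

lemma length_gelems: "length gelems = 121"
  by (simp add: gelems_def)

lemma \<phi>_surj: "\<phi> ` set gelems = UNIV"
proof (rule card_subset_eq[OF finite_field])
  show "card (\<phi> ` set gelems) = card (UNIV :: 'k set)"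
    using card_image[OF \<phi>_inj] distinct_card[OF distinct_gelems] length_gelems card_field by simp
qed simp

lemma \<phi>_eq_iff: "u \<in> set gelems \<Longrightarrow> v \<in> set gelems \<Longrightarrow> \<phi> u = \<phi> v \<longleftrightarrow> u = v"
  using \<phi>_inj by (auto dest: inj_onD)

lemma \<phi>_0: "\<phi> (0, 0) = 0"
  by (simp add: \<phi>_def)

lemma \<phi>_eq_0_iff: "u \<in> set gelems \<Longrightarrow> \<phi> u = 0 \<longleftrightarrow> u = (0, 0)"
  using \<phi>_eq_iff[of u "(0, 0)"] \<phi>_0 by (simp add: gelems_iff)

lemma square_iff: assumes u: "u \<in> set gelems" shows "(\<exists>d. d ^ 2 = \<phi> u) \<longleftrightarrow> gsquare u"
proof
  assume "\<exists>d. d ^ 2 = \<phi> u"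
  then obtain v where v: "v \<in> set gelems" "\<phi> v ^ 2 = \<phi> u"
    using \<phi>_surj by (metis UNIV_I imageE)
  then have "\<phi> (gmul v v) = \<phi> u"
    by (simp add: \<phi>_gmul power2_eq_square)
  then have "gmul v v = u"
    using \<phi>_eq_iff[OF gmul_in_gelems u] by blast
  then show "gsquare u"
    using gsquare_gmul v(1) by blast
next
  assume "gsquare u"
  then have "u \<in> set (filter gsquare gelems)"
    using u by simp
  then obtain v where "u = gmul v v"
    unfolding gsquare_roots set_map by blast
  then show "\<exists>d. d ^ 2 = \<phi> u"
    by (intro exI[of _ "\<phi> v"]) (simp add: \<phi>_gmul power2_eq_square)
qed

text \<open>\<open>F\<^sub>1\<close> is f and \<open>G\<^sub>1\<close> is - f(- X), its cofactor in
  X^6 - 1. Substituting \<alpha> X gives the factorization of - X^6 - 1 into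
  \<open>F\<^sub>2\<close> and \<open>G\<^sub>2\<close>. All branch points of G over K(x) are roots
  of these four polynomials.\<close>

definition F\<^sub>1 :: "'k poly" where "F\<^sub>1 = [:1, 1:] * [:1, 1, 1:]"
definition G\<^sub>1 :: "'k poly" where "G\<^sub>1 = [:- 1, 1:] * [:1, - 1, 1:]"
definition F\<^sub>2 :: "'k poly" where "F\<^sub>2 = pcompose F\<^sub>1 [:0, \<alpha>:]"
definition G\<^sub>2 :: "'k poly" where "G\<^sub>2 = pcompose G\<^sub>1 [:0, \<alpha>:]"

lemma \<alpha>_neq_0: "\<alpha> \<noteq> 0"
  using \<alpha>_square by auto

lemma F\<^sub>1_eq: "F\<^sub>1 = [:1, 2, 2, 1:]"
  by (simp add: F\<^sub>1_def)

lemma G\<^sub>1_eq: "G\<^sub>1 = [:- 1, 2, - 2, 1:]"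
  by (simp add: G\<^sub>1_def)

lemma FG\<^sub>1: "F\<^sub>1 * G\<^sub>1 = [:- 1, 0, 0, 0, 0, 0, 1:]"
  by (simp add: F\<^sub>1_eq G\<^sub>1_eq)

lemma FG\<^sub>2: "F\<^sub>2 * G\<^sub>2 = [:- 1, 0, 0, 0, 0, 0, - 1:]"
proof -
  have "F\<^sub>2 * G\<^sub>2 = pcompose (F\<^sub>1 * G\<^sub>1) [:0, \<alpha>:]"
    unfolding F\<^sub>2_def G\<^sub>2_def pcompose_mult ..
  also have "\<dots> = [:- 1, 0, 0, 0, 0, 0, (\<alpha> ^ 2) ^ 3:]"
    unfolding FG\<^sub>1 by (simp add: pcompose_pCons eval_nat_numeral mult_ac)
  finally show ?thesis
    unfolding \<alpha>_square by simp
qed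

lemma degree_FG: "degree F\<^sub>1 = 3" "degree G\<^sub>1 = 3" "degree F\<^sub>2 = 3" "degree G\<^sub>2 = 3"
  using \<alpha>_neq_0 unfolding F\<^sub>2_def G\<^sub>2_def degree_pcompose F\<^sub>1_eq G\<^sub>1_eq by simp_all

lemma FG_neq_0: "F\<^sub>1 \<noteq> 0" "G\<^sub>1 \<noteq> 0" "F\<^sub>2 \<noteq> 0" "G\<^sub>2 \<noteq> 0"
  using degree_FG by auto

lemma \<alpha>_plus_1_neq_0: "\<alpha> + 1 \<noteq> 0"
proof
  assume "\<alpha> + 1 = 0"
  then have "\<alpha> = - 1"
    by (simp add: eq_neg_iff_add_eq_0)
  then have "(1 :: 'k) = - 1"
    using \<alpha>_square by simp
  then have "(2 :: 'k) = 0"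
    by (metis one_add_one add.right_inverse)
  then show False
    using two_neq_0 by blast
qed

text \<open>The product is N = 1 - X^12, and N - X N' = 1 + 11 X^12 = 1 in characteristic 11. A
  repeated factor of N divides both N and N'.\<close>

lemma squarefree_product:
  assumes "q ^ 2 dvd F\<^sub>1 * G\<^sub>1 * (F\<^sub>2 * G\<^sub>2)" shows "q dvd 1"
proof -
  let ?N = "F\<^sub>1 * G\<^sub>1 * (F\<^sub>2 * G\<^sub>2)"
  obtain m where m: "?N = q * q * m"
    using assms by (auto simp: power2_eq_square)
  have "?N - [:0, 1:] * pderiv ?N = [:1:] + smult 11 (monom 1 12)"
    unfolding FG\<^sub>1 FG\<^sub>2 by (simp add: pderiv_pCons eval_nat_numeral monom_Suc monom_0)
  then have one: "1 = ?N - [:0, 1:] * pderiv ?N"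
    by (simp add: eleven_eq_0 one_pCons)
  have "q dvd ?N"
    unfolding m by (simp add: mult.assoc)
  moreover have "q dvd pderiv ?N"
    unfolding m by (simp add: pderiv_mult algebra_simps)
  then have "q dvd [:0, 1:] * pderiv ?N"
    by (rule dvd_mult)
  ultimately have "q dvd ?N - [:0, 1:] * pderiv ?N"
    by (rule dvd_diff)
  then show ?thesis
    by (simp only: one[symmetric])
qed

text \<open>The triple records which of a, b, z occur in \<open>w i\<close>. Both a^2 and z^2
  contain \<open>F\<^sub>2\<close>, so it survives in the squarefree part only if exactly one of
  them occurs; likewise \<open>F\<^sub>1\<close> for b and z.\<close>

definition D :: "bool \<times> bool \<times> bool \<Rightarrow> 'k poly" where
  "D = (\<lambda>(i, j, k). smult ((if i then - 2 else 1) * (if j then - 2 else 1) * (if k then \<alpha> + 1 else 1))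
     ((if i \<noteq> k then F\<^sub>2 else 1) * (if i then G\<^sub>2 else 1) * (if j \<noteq> k then F\<^sub>1 else 1) * (if j then G\<^sub>1 else 1)))"

lemma D_simps:
  "D (False, False, False) = 1" "D (True, False, False) = smult (- 2) (F\<^sub>2 * G\<^sub>2)"
  "D (False, True, False) = smult (- 2) (F\<^sub>1 * G\<^sub>1)" "D (True, True, False) = smult 4 (F\<^sub>2 * G\<^sub>2 * F\<^sub>1 * G\<^sub>1)"
  "D (False, False, True) = smult (\<alpha> + 1) (F\<^sub>2 * F\<^sub>1)"
  "D (True, False, True) = smult (- 2 * (\<alpha> + 1)) (G\<^sub>2 * F\<^sub>1)"
  "D (False, True, True) = smult (- 2 * (\<alpha> + 1)) (F\<^sub>2 * G\<^sub>1)"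
  "D (True, True, True) = smult (4 * (\<alpha> + 1)) (G\<^sub>2 * G\<^sub>1)"
  by (simp_all add: D_def mult.assoc del: distrib_left_numeral distrib_right_numeral)

lemma D_dvd:
  shows "\<exists>c. c \<noteq> 0 \<and> D i dvd smult c (F\<^sub>1 * G\<^sub>1 * (F\<^sub>2 * G\<^sub>2))"
proof -
  obtain a b k where i: "i = (a, b, k)" by (cases i)
  let ?c = "(if a then - 2 else 1) * (if b then - 2 else 1) * (if k then \<alpha> + 1 else 1)"
  let ?E = "(if a \<noteq> k then 1 else F\<^sub>2) * (if a then 1 else G\<^sub>2) * (if b \<noteq> k then 1 else F\<^sub>1) * (if b then 1 else G\<^sub>1)"
  have "smult ?c (F\<^sub>1 * G\<^sub>1 * (F\<^sub>2 * G\<^sub>2)) = D i * ?E"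
    unfolding i D_def by (simp add: mult_ac)
  then have "D i dvd smult ?c (F\<^sub>1 * G\<^sub>1 * (F\<^sub>2 * G\<^sub>2))"
    by (rule dvdI)
  moreover have "?c \<noteq> 0"
    using two_neq_0 \<alpha>_plus_1_neq_0 by simp
  ultimately show ?thesis by blast
qed

lemma D_squarefree: assumes "q ^ 2 dvd D i" shows "q dvd 1"
proof -
  obtain c where c: "c \<noteq> 0" "D i dvd smult c (F\<^sub>1 * G\<^sub>1 * (F\<^sub>2 * G\<^sub>2))"
    using D_dvd by blast
  have "q ^ 2 dvd smult c (F\<^sub>1 * G\<^sub>1 * (F\<^sub>2 * G\<^sub>2))"
    using assms c(2) by (rule dvd_trans)
  then have "q ^ 2 dvd F\<^sub>1 * G\<^sub>1 * (F\<^sub>2 * G\<^sub>2)"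
    using c(1) by (rule dvd_smult_cancel)
  then show ?thesis
    by (rule squarefree_product)
qed

definition g :: "bool \<times> bool \<times> bool \<Rightarrow> nat" where
  "g i = (if i = (False, False, False) then 0 else if i = (True, True, False) then 6 else 3)"

lemma degree_D: "degree (D i) = 2 * g i"
proof -
  have four: "(4 :: 'k) \<noteq> 0"
    using two_neq_0 by (metis mult_eq_0_iff mult_2 numeral_Bit0 numeral_code(1) numeral_plus_numeral)
  obtain a b k where i: "i = (a, b, k)" by (cases i)
  show ?thesis
    unfolding i g_def using two_neq_0 four \<alpha>_plus_1_neq_0 FG_neq_0
    by (cases a; cases b; cases k) 
      (simp_all add: D_simps degree_mult_eq degree_FG del: distrib_left_numeral distrib_right_numeral)
qed

lemma poly_F\<^sub>2: "poly F\<^sub>2 s = poly F\<^sub>1 (\<alpha> * s)" and poly_G\<^sub>2: "poly G\<^sub>2 s = poly G\<^sub>1 (\<alpha> * s)"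
  unfolding F\<^sub>2_def G\<^sub>2_def poly_pcompose by (simp_all add: mult.commute)

lemma nine_eq: "(9 :: 'k) = - 2" and ten_eq: "(10 :: 'k) = - 1"
  using eleven_eq_0 by (simp_all add: eq_neg_iff_add_eq_0)

lemma \<phi>_consts: "\<phi> (2, 0) = 2" "\<phi> (9, 0) = - 2" "\<phi> (1, 1) = \<alpha> + 1" "\<phi> (9, 9) = - 2 * (\<alpha> + 1)"
  "\<phi> (1, 0) = 1" "\<phi> (10, 0) = - 1" "\<phi> (0, 1) = \<alpha>"
  by (simp_all add: \<phi>_def nine_eq ten_eq algebra_simps)

lemma \<phi>_gsix: "\<phi> (gsix u) = \<phi> u ^ 6"
  unfolding gsix_def Let_def \<phi>_gmul by (simp add: eval_nat_numeral mult_ac)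

lemma \<phi>_gF: "\<phi> (gF u) = poly F\<^sub>1 (\<phi> u)"
  unfolding gF_def \<phi>_gmul \<phi>_gadd \<phi>_consts F\<^sub>1_def by (simp add: algebra_simps)

lemma \<phi>_gG: "\<phi> (gG u) = poly G\<^sub>1 (\<phi> u)"
  unfolding gG_def \<phi>_gmul \<phi>_gadd \<phi>_consts G\<^sub>1_def by (simp add: algebra_simps)

lemma \<phi>_gA: "\<phi> (gA u) = poly (D (True, False, False)) (\<phi> u)"
  unfolding gA_def \<phi>_gmul \<phi>_gadd \<phi>_consts \<phi>_gsix D_simps FG\<^sub>2 by (simp add: algebra_simps eval_nat_numeral)

lemma \<phi>_gB: "\<phi> (gB u) = poly (D (False, True, False)) (\<phi> u)"
  unfolding gB_def \<phi>_gmul \<phi>_gadd \<phi>_consts \<phi>_gsix D_simps FG\<^sub>1 by (simp add: algebra_simps eval_nat_numeral)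

lemma \<phi>_gC: "\<phi> (gC u) = poly (D (False, False, True)) (\<phi> u)"
  unfolding gC_def \<phi>_gmul \<phi>_gF \<phi>_consts D_simps by (simp add: poly_F\<^sub>2 mult_ac)

lemma \<phi>_gAC: "\<phi> (gAC u) = poly (D (True, False, True)) (\<phi> u)"
  unfolding gAC_def \<phi>_gmul \<phi>_gF \<phi>_gG \<phi>_consts D_simps by (simp add: poly_G\<^sub>2 mult_ac)

lemma \<phi>_gBC: "\<phi> (gBC u) = poly (D (False, True, True)) (\<phi> u)"
  unfolding gBC_def \<phi>_gmul \<phi>_gF \<phi>_gG \<phi>_consts D_simps by (simp add: poly_F\<^sub>2 mult_ac)

definition unit_square :: "'k \<Rightarrow> bool" where
  "unit_square e \<longleftrightarrow> e \<noteq> 0 \<and> (\<exists>d. d ^ 2 = e)"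

lemma unit_square_iff: "u \<in> set gelems \<Longrightarrow> unit_square (\<phi> u) \<longleftrightarrow> gunit_square u"
  unfolding unit_square_def gunit_square_def using \<phi>_eq_0_iff square_iff by simp

lemma g_in_gelems: "gA u \<in> set gelems" "gB u \<in> set gelems" "gC u \<in> set gelems"
  "gAC u \<in> set gelems" "gBC u \<in> set gelems"
  unfolding gA_def gB_def gC_def gAC_def gBC_def by (rule gadd_in_gelems gmul_in_gelems)+

lemma lead_coeff_nonsquare: "d ^ 2 \<noteq> lead_coeff (D (False, False, True))"
proof -
  have F1: "lead_coeff F\<^sub>1 = 1"
    by (simp add: F\<^sub>1_eq)
  moreover have "lead_coeff F\<^sub>2 = \<alpha> ^ 3"
    using lead_coeff_comp[of "[:0, \<alpha>:]" F\<^sub>1] \<alpha>_neq_0 unfolding F\<^sub>2_def F1 degree_FG by (simp add: F\<^sub>1_eq eval_nat_numeral)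
  ultimately have "lead_coeff (D (False, False, True)) = (\<alpha> + 1) * \<alpha> ^ 3"
    unfolding D_simps lead_coeff_smult lead_coeff_mult by simp
  also have "\<alpha> ^ 3 = \<alpha> ^ 2 * \<alpha>"
    by (simp add: eval_nat_numeral)
  also have "(\<alpha> + 1) * (\<alpha> ^ 2 * \<alpha>) = \<phi> (1, 10)"
    unfolding \<alpha>_square using \<alpha>_square by (simp add: \<phi>_def ten_eq algebra_simps power2_eq_square)
  finally show ?thesis
    using square_iff[of "(1, 10)"] nonsquare_at_infinity by (auto simp: gelems_iff)
qed

end

section \<open>The function field\<close>

context transcendental_extension
begin

lemma intermediate_field_Kx: "intermediate_field Kx"
proof -
  have const: "\<kappa> c \<in> Kx" for c
    using ev_in_Kx[of "[:c:]"] by simp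
  have neg: "- a \<in> Kx" if "a \<in> Kx" for a
    using Kx_mult[OF const[of "- 1"] that] by (simp add: hom_minus hom_one)
  have "a - b \<in> Kx" if "a \<in> Kx" "b \<in> Kx" for a b
    using Kx_add[OF that(1) neg[OF that(2)]] by simp
  then show ?thesis
    unfolding intermediate_field_def using const Kx_add Kx_mult Kx_inverse by (simp add: image_subset_iff)
qed

lemma nonsquare_ev:
  assumes "\<And>q. q ^ 2 dvd D \<Longrightarrow> q dvd 1" "0 < degree D" shows "nonsquare Kx (ev x D)"
  unfolding nonsquare_def using ev_not_square[OF assms] by blast

lemma nonsquare_mult_square:
  assumes e: "nonsquare Kx e" and r: "r \<in> Kx" "r \<noteq> 0" shows "nonsquare Kx (e * r ^ 2)"
  unfolding nonsquare_def
proof (intro ballI notI)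
  fix s assume s: "s \<in> Kx" "s ^ 2 = e * r ^ 2"
  have "(s * inverse r) ^ 2 = e"
    using s(2) r(2) by (simp add: power_mult_distrib power_inverse)
  moreover have "s * inverse r \<in> Kx"
    using s r Kx_mult Kx_inverse by blast
  ultimately show False
    using e unfolding nonsquare_def by blast
qed

end

lemma sum_bool3:
  "(\<Sum>i\<in>UNIV. h i) = h (False, False, False) + h (True, False, False) + h (False, True, False) +
     h (True, True, False) + h (False, False, True) + h (True, False, True) + h (False, True, True) +
     h (True, True, True)" for h :: "bool \<times> bool \<times> bool \<Rightarrow> 'a::comm_monoid_add"
proof -
  have U: "(UNIV :: (bool \<times> bool \<times> bool) set) = {(False, False, False), (True, False, False), (False, True, False),
     (True, True, False), (False, False, True), (True, False, True), (False, True, True), (True, True, True)}"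
    by (auto simp: UNIV_bool)
  show ?thesis
    unfolding U by (simp add: add.assoc)
qed

locale curve = transcendental_extension \<kappa> x + field_121 \<alpha>
  for \<kappa> :: "'k::field \<Rightarrow> 'f::field" and x :: 'f and \<alpha> :: 'k +
  fixes y z :: 'f
  assumes y_eq: "(y ^ 2 - 1) ^ 2 = 1 - x ^ 12"
    and z_eq: "z ^ 2 = \<kappa> (\<alpha> + 1) * ev x F\<^sub>1 * ev x F\<^sub>2"
    and generated: "adjoin {x, y, z} = UNIV"
begin

text \<open>
  The quotients make every \<open>w i\<close> a square root of a squarefree polynomial; \<open>y = (a + b) / 2\<close>, so that
  the \<open>w i\<close> form a basis of the field over \<open>K(x)\<close>.
\<close>

definition a :: 'f where "a = y + x ^ 6 / y"
definition b :: 'f where "b = y - x ^ 6 / y"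

definition w :: "bool \<times> bool \<times> bool \<Rightarrow> 'f" where
  "w = (\<lambda>(i, j, k). (if i then a else 1) * (if j then b else 1) * (if k then z else 1) /
     ((if i \<and> k then ev x F\<^sub>2 else 1) * (if j \<and> k then ev x F\<^sub>1 else 1)))"

lemma w_simps:
  "w (False, False, False) = 1" "w (True, False, False) = a" "w (False, True, False) = b"
  "w (True, True, False) = a * b" "w (False, False, True) = z" "w (True, False, True) = a * z / ev x F\<^sub>2"
  "w (False, True, True) = b * z / ev x F\<^sub>1" "w (True, True, True) = a * b * z / (ev x F\<^sub>2 * ev x F\<^sub>1)"
  by (simp_all add: w_def)

lemma y_neq_0: "y \<noteq> 0"
  using y_eq x_neq_0 by auto

lemma hom_2: "\<kappa> 2 = 2"
  using hom_add[of 1 1] by (simp add: hom_one)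

lemma two_neq_0': "(2 :: 'f) \<noteq> 0"
  using hom_eq_0_iff[of 2] two_neq_0 by (simp add: hom_2)

text \<open>The equation for y reads y^4 + x^12 = 2 y^2; dividing by y^2 makes it symmetric in y and
  x^6 / y. Their sum and difference thus have squares in K(x).\<close>

lemma y_square: "y ^ 2 + (x ^ 6 / y) ^ 2 = 2"
proof -
  have "y ^ 4 + x ^ 12 = 2 * y ^ 2"
    using y_eq by (simp add: power2_eq_square algebra_simps eval_nat_numeral)
  then have "(y ^ 4 + x ^ 12) / y ^ 2 = 2"
    using y_neq_0 by simp
  moreover have "(y ^ 4 + x ^ 12) / y ^ 2 = y ^ 2 + (x ^ 6 / y) ^ 2"
    using y_neq_0 by (simp add: add_divide_distrib power_divide eval_nat_numeral)
  ultimately show ?thesis by simp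
qed

lemma a_square: "a ^ 2 = ev x (D (True, False, False))"
proof -
  have "a ^ 2 = (y ^ 2 + (x ^ 6 / y) ^ 2) + 2 * x ^ 6"
    unfolding a_def using y_neq_0 by (simp add: power2_sum)
  then show ?thesis
    unfolding y_square D_simps FG\<^sub>2 by (simp add: hom_minus hom_one hom_zero hom_2 algebra_simps eval_nat_numeral)
qed

lemma b_square: "b ^ 2 = ev x (D (False, True, False))"
proof -
  have "b ^ 2 = (y ^ 2 + (x ^ 6 / y) ^ 2) - 2 * x ^ 6"
    unfolding b_def using y_neq_0 by (simp add: power2_diff)
  then show ?thesis
    unfolding y_square D_simps FG\<^sub>1 by (simp add: hom_minus hom_one hom_zero hom_2 algebra_simps eval_nat_numeral)
qed

lemma z_square: "z ^ 2 = ev x (D (False, False, True))"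
  unfolding z_eq D_simps by (simp add: mult_ac)

lemma ev_F_neq_0: "ev x F\<^sub>1 \<noteq> 0" "ev x F\<^sub>2 \<noteq> 0" "ev x G\<^sub>1 \<noteq> 0" "ev x G\<^sub>2 \<noteq> 0"
  using FG_neq_0 by simp_all

lemma w_square: "w i ^ 2 = ev x (D i)"
proof -
  have four: "\<kappa> 4 = 4"
    using hom_add[of 2 2] by (simp add: hom_2)
  obtain p q k where i: "i = (p, q, k)" by (cases i)
  show ?thesis
    unfolding i
    by (cases p; cases q; cases k)
      (use ev_F_neq_0 in \<open>simp_all add: w_simps a_square b_square z_square power_mult_distrib power_divide,
        simp_all add: D_simps hom_minus hom_add hom_diff hom_one hom_mult hom_2 four power2_eq_square field_simps
          del: distrib_left_numeral distrib_right_numeral\<close>)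
qed

lemma nonsquare_D: "i \<noteq> (False, False, False) \<Longrightarrow> nonsquare Kx (ev x (D i))"
  using D_squarefree degree_D[of i] by (intro nonsquare_ev) (auto simp: g_def)

text \<open>Each product of a^2, b^2, z^2 differs from one of the squarefree \<open>D i\<close> only
  by the square of the denominator in \<open>w i\<close>.\<close>

lemma nonsquares:
  "nonsquare Kx (a ^ 2)" "nonsquare Kx (b ^ 2)" "nonsquare Kx (z ^ 2)"
  "nonsquare Kx (a ^ 2 * b ^ 2)" "nonsquare Kx (a ^ 2 * z ^ 2)" "nonsquare Kx (b ^ 2 * z ^ 2)"
  "nonsquare Kx (a ^ 2 * b ^ 2 * z ^ 2)"
proof -
  show "nonsquare Kx (a ^ 2)" "nonsquare Kx (b ^ 2)" "nonsquare Kx (z ^ 2)"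
    unfolding a_square b_square z_square by (intro nonsquare_D; simp)+
  have "a ^ 2 * b ^ 2 = w (True, True, False) ^ 2"
    by (simp add: w_simps power_mult_distrib)
  then show "nonsquare Kx (a ^ 2 * b ^ 2)"
    unfolding w_square by (simp only:) (intro nonsquare_D; simp)
  have "a ^ 2 * z ^ 2 = w (True, False, True) ^ 2 * ev x F\<^sub>2 ^ 2"
    using ev_F_neq_0 by (simp add: w_simps power_mult_distrib power_divide)
  then show "nonsquare Kx (a ^ 2 * z ^ 2)"
    unfolding w_square using ev_F_neq_0 ev_in_Kx nonsquare_D[of "(True, False, True)"]
    by (simp only:) (intro nonsquare_mult_square; simp)
  have "b ^ 2 * z ^ 2 = w (False, True, True) ^ 2 * ev x F\<^sub>1 ^ 2"
    using ev_F_neq_0 by (simp add: w_simps power_mult_distrib power_divide)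
  then show "nonsquare Kx (b ^ 2 * z ^ 2)"
    unfolding w_square using ev_F_neq_0 ev_in_Kx nonsquare_D[of "(False, True, True)"]
    by (simp only:) (intro nonsquare_mult_square; simp)
  have "a ^ 2 * b ^ 2 * z ^ 2 = w (True, True, True) ^ 2 * ev x (F\<^sub>2 * F\<^sub>1) ^ 2"
    using ev_F_neq_0 by (simp add: w_simps power_mult_distrib power_divide)
  then show "nonsquare Kx (a ^ 2 * b ^ 2 * z ^ 2)"
    unfolding w_square using FG_neq_0 ev_in_Kx nonsquare_D[of "(True, True, True)"]
    by (simp only:) (intro nonsquare_mult_square; simp del: ev_mult)
qed

lemma generated_abz:
  assumes L: "intermediate_field L" "Kx \<subseteq> L" "a \<in> L" "b \<in> L" "z \<in> L"
  shows "L = UNIV"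
proof -
  have "x = ev x [:0, 1:]"
    by (simp add: hom_zero hom_one)
  then have "x \<in> L"
    using L(2) ev_in_Kx[of "[:0, 1:]"] by auto
  moreover have "y = \<kappa> (inverse 2) * (a + b)"
    using two_neq_0' unfolding a_def b_def hom_inverse hom_2 by (simp flip: mult_2)
  then have "y \<in> L"
    using intermediate_fieldD(1,3,5)[OF L(1)] L(3,4) by metis
  ultimately have "adjoin {x, y, z} \<subseteq> L"
    unfolding adjoin_def using L by blast
  then show ?thesis
    using generated by blast
qed

lemma squares_in_Kx: "a ^ 2 \<in> Kx" "b ^ 2 \<in> Kx" "z ^ 2 \<in> Kx"
  unfolding a_square b_square z_square by (rule ev_in_Kx)+

lemma x_in_Kx: "x \<in> Kx"
  using ev_in_Kx[of "[:0, 1:]"] by (simp add: hom_zero hom_one)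

text \<open>\<open>triquadratic\<close> negates its last generator; permuting a, b, z gives the
  other two generators of the Galois group below.\<close>

lemma negate_z: "\<exists>\<tau>. involution_fixing x \<tau> \<and> (\<forall>v\<in>Kx. \<tau> v = v) \<and> \<tau> a = a \<and> \<tau> b = b \<and> \<tau> z = - z"
  and tower: "quadratic_closure (quadratic_closure (quadratic_closure Kx a) b) z = UNIV"
  using triquadratic[OF two_neq_0 intermediate_field_Kx x_in_Kx squares_in_Kx(1,2,3)] nonsquares generated_abz
  by (simp_all add: mult_ac)

lemma negate_b: "\<exists>\<tau>. involution_fixing x \<tau> \<and> (\<forall>v\<in>Kx. \<tau> v = v) \<and> \<tau> a = a \<and> \<tau> z = z \<and> \<tau> b = - b"
  using triquadratic(1)[OF two_neq_0 intermediate_field_Kx x_in_Kx squares_in_Kx(1,3,2)] nonsquares generated_abz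
  by (simp add: mult_ac)

lemma negate_a: "\<exists>\<tau>. involution_fixing x \<tau> \<and> (\<forall>v\<in>Kx. \<tau> v = v) \<and> \<tau> b = b \<and> \<tau> z = z \<and> \<tau> a = - a"
  using triquadratic(1)[OF two_neq_0 intermediate_field_Kx x_in_Kx squares_in_Kx(2,3,1)] nonsquares generated_abz
  by (simp add: mult_ac)

lemma involution_w:
  assumes \<tau>: "involution_fixing x \<tau>" "\<forall>v\<in>Kx. \<tau> v = v"
    and s: "\<tau> a = s\<^sub>1 * a" "\<tau> b = s\<^sub>2 * b" "\<tau> z = s\<^sub>3 * z"
  shows "\<tau> (w (i, j, k)) = ((if i then s\<^sub>1 else 1) * (if j then s\<^sub>2 else 1) * (if k then s\<^sub>3 else 1)) * w (i, j, k)"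
proof -
  have "\<tau> (ev x p) = ev x p" for p
    using \<tau>(2) ev_in_Kx by blast
  moreover have "\<tau> 1 = 1"
    using involution_fixingD(3)[OF \<tau>(1), of 1] by (simp add: hom_one)
  ultimately show ?thesis
    by (simp add: w_def involution_divide[OF \<tau>(1)] involution_fixingD(2)[OF \<tau>(1)] s)
qed

text \<open>\<open>spanning\<close> unfolds the three steps of \<open>tower\<close> into eight
  coefficients. For \<open>separating\<close>, two different triples differ in some entry, and the
  involution that negates the corresponding one of a, b, z tells them apart.\<close>

sublocale multiquadratic \<kappa> x "UNIV :: (bool \<times> bool \<times> bool) set" w D g
proof
  show "(2 :: 'k) \<noteq> 0"
    by (rule two_neq_0)
  show "\<exists>h. (\<forall>i\<in>UNIV. h i \<in> Kx) \<and> u = (\<Sum>i\<in>UNIV. h i * w i)" for u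
  proof -
    have "u \<in> quadratic_closure (quadratic_closure (quadratic_closure Kx a) b) z"
      unfolding tower ..
    then obtain u0 u1 where u01: "u0 \<in> quadratic_closure (quadratic_closure Kx a) b"
      "u1 \<in> quadratic_closure (quadratic_closure Kx a) b" "u = u0 + u1 * z"
      unfolding quadratic_closure_def[of _ z] by blast
    then obtain v0 v1 v2 v3 where v: "v0 \<in> quadratic_closure Kx a" "v1 \<in> quadratic_closure Kx a"
      "v2 \<in> quadratic_closure Kx a" "v3 \<in> quadratic_closure Kx a" "u0 = v0 + v1 * b" "u1 = v2 + v3 * b"
      unfolding quadratic_closure_def[of _ b] by blast
    obtain m0 m1 m2 m3 where m0: "m0 \<in> Kx" "m1 \<in> Kx" "m2 \<in> Kx" "m3 \<in> Kx"
      "v0 = m0 + m1 * a" "v1 = m2 + m3 * a"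
      using v(1,2) unfolding quadratic_closure_def[of _ a] by blast
    obtain m4 m5 m6 m7 where m4: "m4 \<in> Kx" "m5 \<in> Kx" "m6 \<in> Kx" "m7 \<in> Kx"
      "v2 = m4 + m5 * a" "v3 = m6 + m7 * a"
      using v(3,4) unfolding quadratic_closure_def[of _ a] by blast
    have u: "u = ((m0 + m1 * a) + (m2 + m3 * a) * b) + ((m4 + m5 * a) + (m6 + m7 * a) * b) * z"
      using u01(3) v(5,6) m0(5,6) m4(5,6) by simp
    \<comment> \<open>The extra factors cancel the denominators in \<open>w\<close>.\<close>
    define h where "h = (\<lambda>(i, j, k).
      if k then (if j then (if i then m7 * (ev x F\<^sub>2 * ev x F\<^sub>1) else m6 * ev x F\<^sub>1) else (if i then m5 * ev x F\<^sub>2 else m4))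
      else (if j then (if i then m3 else m2) else (if i then m1 else m0)))"
    have "u = (\<Sum>i\<in>UNIV. h i * w i)"
      unfolding sum_bool3 h_def w_simps u using ev_F_neq_0 by (simp add: algebra_simps)
    moreover have "\<forall>i\<in>UNIV. h i \<in> Kx"
      using m0 m4 ev_in_Kx Kx_mult unfolding h_def by (simp split: prod.split)
    ultimately show ?thesis
      by (intro exI[of _ h] conjI)
  qed
  fix i j :: "bool \<times> bool \<times> bool" assume "i \<noteq> j"
  obtain i1 i2 i3 j1 j2 j3 where ij: "i = (i1, i2, i3)" "j = (j1, j2, j3)"
    by (cases i, cases j)
  have ne: "(1 :: 'f) \<noteq> - 1"
    using two_neq_0' by (metis one_add_one add.right_inverse)
  have *: "\<exists>\<tau> s. involution_fixing x \<tau> \<and> (\<forall>k\<in>UNIV. s k \<in> {1, - 1} \<and> \<tau> (w k) = s k * w k) \<and> s i \<noteq> s j"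
    if \<tau>: "involution_fixing x \<tau>" "\<forall>v\<in>Kx. \<tau> v = v"
      and s: "\<tau> a = s\<^sub>1 * a" "\<tau> b = s\<^sub>2 * b" "\<tau> z = s\<^sub>3 * z" "s\<^sub>1 \<in> {1, - 1}" "s\<^sub>2 \<in> {1, - 1}" "s\<^sub>3 \<in> {1, - 1}"
      and neq: "(if i1 then s\<^sub>1 else 1) * (if i2 then s\<^sub>2 else 1) * (if i3 then s\<^sub>3 else 1) \<noteq>
        (if j1 then s\<^sub>1 else 1) * (if j2 then s\<^sub>2 else 1) * (if j3 then s\<^sub>3 else 1)"
    for \<tau> s\<^sub>1 s\<^sub>2 s\<^sub>3
  proof -
    let ?s = "\<lambda>(i, j, k). (if i then s\<^sub>1 else 1) * (if j then s\<^sub>2 else 1) * (if k then s\<^sub>3 else 1)"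
    have "?s k \<in> {1, - 1} \<and> \<tau> (w k) = ?s k * w k" for k
      using involution_w[OF \<tau> s(1-3), of "fst k" "fst (snd k)" "snd (snd k)"] s(4-6)
      by (cases k) auto
    moreover have "?s i \<noteq> ?s j"
      using neq unfolding ij by simp
    ultimately show ?thesis
      using \<tau>(1) by (intro exI[of _ \<tau>] exI[of _ ?s]) simp
  qed
  consider "i1 \<noteq> j1" | "i2 \<noteq> j2" | "i3 \<noteq> j3"
    using \<open>i \<noteq> j\<close> ij by blast
  then show "\<exists>\<tau> s. involution_fixing x \<tau> \<and> (\<forall>k\<in>UNIV. s k \<in> {1, - 1} \<and> \<tau> (w k) = s k * w k) \<and> s i \<noteq> s j"
  proof cases
    case 1
    obtain \<tau> where "involution_fixing x \<tau>" "\<forall>v\<in>Kx. \<tau> v = v" "\<tau> b = b" "\<tau> z = z" "\<tau> a = - a"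
      using negate_a by blast
    then show ?thesis
      using 1 ne by (intro *[of \<tau> "- 1" 1 1]) auto
  next
    case 2
    obtain \<tau> where "involution_fixing x \<tau>" "\<forall>v\<in>Kx. \<tau> v = v" "\<tau> a = a" "\<tau> z = z" "\<tau> b = - b"
      using negate_b by blast
    then show ?thesis
      using 2 ne by (intro *[of \<tau> 1 "- 1" 1]) auto
  next
    case 3
    obtain \<tau> where "involution_fixing x \<tau>" "\<forall>v\<in>Kx. \<tau> v = v" "\<tau> a = a" "\<tau> b = b" "\<tau> z = - z"
      using negate_z by blast
    then show ?thesis
      using 3 ne by (intro *[of \<tau> 1 1 "- 1"]) auto
  qed
qed (simp_all add: w_square degree_D D_squarefree)

text \<open>1 + 24 - 8. This is also the sum of the genera of the seven quadratic subfields K(x,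
  \<open>w i\<close>): one of genus 5 and six of genus 2.\<close>

lemma genus_17: "genus = 17"
  unfolding genus_eq sum_bool3 by (simp add: g_def card_UNIV_bool flip: UNIV_Times_UNIV)

lemma curve_full_constant_field: full_constant_field
proof (rule full_constant_field)
  fix i assume "g i = 0"
  then have "i = (False, False, False)"
    by (auto simp: g_def split: if_splits)
  then show "w i \<in> range \<kappa>"
    using range_eqI[of 1 \<kappa> 1] hom_one by (simp add: w_simps)
qed

end

section \<open>Rational places\<close>

context curve
begin

lemma fiber_root:
  assumes P: "P \<in> fiber s" and \<beta>: "\<beta> ^ 2 = ev x p" and us: "unit_square (poly p s)"
  shows "\<exists>d. d \<noteq> 0 \<and> \<beta> - \<kappa> d \<in> P"
proof -
  obtain d where d: "d ^ 2 = poly p s" "poly p s \<noteq> 0"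
    using us unfolding unit_square_def by blast
  then have "d \<noteq> 0" "- d \<noteq> 0"
    by auto
  then show ?thesis
    using fiber_sqrt_residue[OF P \<beta> d(1)] by blast
qed

text \<open>Two doublings of a single place. The final clause keeps the residue of every function
  fixed by both involutions, which a third doubling requires.\<close>

lemma fiber_four:
  assumes P: "P \<in> fiber s"
    and \<tau>\<^sub>1: "involution_fixing x \<tau>\<^sub>1" "\<tau>\<^sub>1 \<beta>\<^sub>1 = - \<beta>\<^sub>1" "\<tau>\<^sub>1 \<beta>\<^sub>2 = \<beta>\<^sub>2"
    and \<tau>\<^sub>2: "involution_fixing x \<tau>\<^sub>2" "\<tau>\<^sub>2 \<beta>\<^sub>2 = - \<beta>\<^sub>2"
    and d: "d\<^sub>1 \<noteq> 0" "\<beta>\<^sub>1 - \<kappa> d\<^sub>1 \<in> P" "d\<^sub>2 \<noteq> 0" "\<beta>\<^sub>2 - \<kappa> d\<^sub>2 \<in> P"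
  shows "\<exists>T\<subseteq>fiber s. card T = 4 \<and>
    (\<forall>\<gamma> c. \<tau>\<^sub>1 \<gamma> = \<gamma> \<longrightarrow> \<tau>\<^sub>2 \<gamma> = \<gamma> \<longrightarrow> \<gamma> - \<kappa> c \<in> P \<longrightarrow> (\<forall>Q\<in>T. \<gamma> - \<kappa> c \<in> Q))"
proof -
  have T0: "{P} \<subseteq> fiber s" "\<forall>Q\<in>{P}. \<beta>\<^sub>1 - \<kappa> d\<^sub>1 \<in> Q"
    using P d(2) by auto
  define T1 where "T1 = {P} \<union> (vimage \<tau>\<^sub>1) ` {P}"
  note double1 = fiber_double[OF \<tau>\<^sub>1(1,2) d(1) T0, folded T1_def]
  have T1: "\<forall>Q\<in>T1. \<beta>\<^sub>2 - \<kappa> d\<^sub>2 \<in> Q"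
    using d(4) by (intro double1(3)[OF \<tau>\<^sub>1(3)]) simp
  define T2 where "T2 = T1 \<union> (vimage \<tau>\<^sub>2) ` T1"
  note double2 = fiber_double[OF \<tau>\<^sub>2 d(3) double1(1) T1, folded T2_def]
  have card: "card T2 = 4"
    using double1(2) double2(2) by simp
  have fixed: "\<forall>\<gamma> c. \<tau>\<^sub>1 \<gamma> = \<gamma> \<longrightarrow> \<tau>\<^sub>2 \<gamma> = \<gamma> \<longrightarrow> \<gamma> - \<kappa> c \<in> P \<longrightarrow> (\<forall>Q\<in>T2. \<gamma> - \<kappa> c \<in> Q)"
  proof (intro allI impI)
    fix \<gamma> c assume \<gamma>: "\<tau>\<^sub>1 \<gamma> = \<gamma>" "\<tau>\<^sub>2 \<gamma> = \<gamma>" "\<gamma> - \<kappa> c \<in> P"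
    show "\<forall>Q\<in>T2. \<gamma> - \<kappa> c \<in> Q"
      using \<gamma>(3) by (intro double2(3)[OF \<gamma>(2)] double1(3)[OF \<gamma>(1)]) simp
  qed
  show ?thesis
    by (rule exI[of _ T2]) (rule conjI[OF double2(1) conjI[OF card fixed]])
qed

lemma card_index: "card (UNIV :: (bool \<times> bool \<times> bool) set) = 8"
  by (simp add: card_UNIV_bool flip: UNIV_Times_UNIV)

text \<open>The nonzero residues of a, b, z allow three doublings of one place. The resulting eight
  places fill the fiber already with order 1.\<close>

lemma fiber_split:
  assumes "unit_square (poly (D (True, False, False)) s)" "unit_square (poly (D (False, True, False)) s)"
    "unit_square (poly (D (False, False, True)) s)"
  shows "card (fiber s) = 8 \<and> fiber s \<subseteq> rational_places"
proof -
  obtain P where P: "P \<in> fiber s"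
    using fiber_nonempty by blast
  obtain d1 d2 d3 where d: "d1 \<noteq> 0" "a - \<kappa> d1 \<in> P" "d2 \<noteq> 0" "b - \<kappa> d2 \<in> P" "d3 \<noteq> 0" "z - \<kappa> d3 \<in> P"
    using fiber_root[OF P a_square assms(1)] fiber_root[OF P b_square assms(2)]
      fiber_root[OF P z_square assms(3)] by blast
  obtain \<tau>1 where \<tau>1: "involution_fixing x \<tau>1" "\<tau>1 b = b" "\<tau>1 z = z" "\<tau>1 a = - a"
    using negate_a by blast
  obtain \<tau>2 where \<tau>2: "involution_fixing x \<tau>2" "\<tau>2 z = z" "\<tau>2 b = - b"
    using negate_b by blast
  obtain \<tau>3 where \<tau>3: "involution_fixing x \<tau>3" "\<tau>3 z = - z"
    using negate_z by blast
  obtain T where T: "T \<subseteq> fiber s" "card T = 4 \<and>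
    (\<forall>\<gamma> c. \<tau>1 \<gamma> = \<gamma> \<longrightarrow> \<tau>2 \<gamma> = \<gamma> \<longrightarrow> \<gamma> - \<kappa> c \<in> P \<longrightarrow> (\<forall>Q\<in>T. \<gamma> - \<kappa> c \<in> Q))"
    using fiber_four[OF P \<tau>1(1,4,2) \<tau>2(1,3) d(1-4)] by blast
  define T' where "T' = T \<union> (vimage \<tau>3) ` T"
  have "\<forall>Q\<in>T. z - \<kappa> d3 \<in> Q"
    using T(2) \<tau>1(3) \<tau>2(2) d(6) by simp
  note double = fiber_double[OF \<tau>3 d(5) T(1) this, folded T'_def]
  have "card (fiber s) = card T' \<and> fiber s \<subseteq> rational_places"
  proof (rule fiber_full[of 1])
    show "int 1 \<le> valuation Q (x - \<kappa> s)" if "Q \<in> fiber s" for Q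
      using place_iff_valuation[OF fiberD(1)[OF that] x_minus_hom_neq_0] fiberD(2)[OF that] by simp
    show "card T' * 1 = card (UNIV :: (bool \<times> bool \<times> bool) set)"
      unfolding card_index double(2) using T(2) by simp
  qed (use double(1) in simp_all)
  then show ?thesis
    unfolding double(2) using T(2) by simp
qed

text \<open>Two doublings give four places, and with order at least 2 at each of them the total of 8
  is reached.\<close>

lemma fiber_ramified_four:
  assumes ram: "poly (D i) s = 0"
    and \<tau>\<^sub>1: "involution_fixing x \<tau>\<^sub>1" "\<tau>\<^sub>1 (w j) = - w j" "\<tau>\<^sub>1 (w k) = w k"
    and \<tau>\<^sub>2: "involution_fixing x \<tau>\<^sub>2" "\<tau>\<^sub>2 (w k) = - w k"
    and us: "unit_square (poly (D j) s)" "unit_square (poly (D k) s)"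
  shows "card (fiber s) = 4 \<and> fiber s \<subseteq> rational_places"
proof -
  obtain P where P: "P \<in> fiber s"
    using fiber_nonempty by blast
  obtain d1 d2 where d: "d1 \<noteq> 0" "w j - \<kappa> d1 \<in> P" "d2 \<noteq> 0" "w k - \<kappa> d2 \<in> P"
    using fiber_root[OF P _ us(1), of "w j"] fiber_root[OF P _ us(2), of "w k"] w_square by blast
  obtain T where T: "T \<subseteq> fiber s" "card T = 4"
    using fiber_four[OF P \<tau>\<^sub>1 \<tau>\<^sub>2 d] by blast
  have "card (fiber s) = card T \<and> fiber s \<subseteq> rational_places"
  proof (rule fiber_full[of 2])
    show "int 2 \<le> valuation Q (x - \<kappa> s)" if "Q \<in> fiber s" for Q
      using fiber_ramified[OF UNIV_I ram that] by simp
    show "card T * 2 = card (UNIV :: (bool \<times> bool \<times> bool) set)"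
      unfolding card_index T(2) by simp
  qed (use T in simp_all)
  then show ?thesis
    unfolding T(2) .
qed

text \<open>The index i selects z or, where z^2 vanishes together with a^2, the quotient of a z by
  \<open>F\<^sub>2\<close>. Both are fixed when b is negated and change sign with z.\<close>

lemma fiber_branch_a:
  assumes "poly (D (True, False, False)) s = 0" "unit_square (poly (D (False, True, False)) s)"
    "unit_square (poly (D (i, False, True)) s)"
  shows "card (fiber s) = 4 \<and> fiber s \<subseteq> rational_places"
proof -
  obtain \<tau> where \<tau>: "involution_fixing x \<tau>" "\<forall>v\<in>Kx. \<tau> v = v" "\<tau> a = 1 * a" "\<tau> b = - 1 * b" "\<tau> z = 1 * z"
    using negate_b by force
  obtain \<sigma> where \<sigma>: "involution_fixing x \<sigma>" "\<forall>v\<in>Kx. \<sigma> v = v" "\<sigma> a = 1 * a" "\<sigma> b = 1 * b" "\<sigma> z = - 1 * z"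
    using negate_z by force
  have "\<tau> (w (False, True, False)) = - w (False, True, False)" "\<tau> (w (i, False, True)) = w (i, False, True)"
    "\<sigma> (w (i, False, True)) = - w (i, False, True)"
    using involution_w[OF \<tau>] involution_w[OF \<sigma>] by simp_all
  then show ?thesis
    using fiber_ramified_four[OF assms(1) \<tau>(1) _ _ \<sigma>(1) _ assms(2,3)] by blast
qed

lemma fiber_branch_b:
  assumes "poly (D (False, True, False)) s = 0" "unit_square (poly (D (True, False, False)) s)"
    "unit_square (poly (D (False, i, True)) s)"
  shows "card (fiber s) = 4 \<and> fiber s \<subseteq> rational_places"
proof -
  obtain \<tau> where \<tau>: "involution_fixing x \<tau>" "\<forall>v\<in>Kx. \<tau> v = v" "\<tau> a = - 1 * a" "\<tau> b = 1 * b" "\<tau> z = 1 * z"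
    using negate_a by force
  obtain \<sigma> where \<sigma>: "involution_fixing x \<sigma>" "\<forall>v\<in>Kx. \<sigma> v = v" "\<sigma> a = 1 * a" "\<sigma> b = 1 * b" "\<sigma> z = - 1 * z"
    using negate_z by force
  have "\<tau> (w (True, False, False)) = - w (True, False, False)" "\<tau> (w (False, i, True)) = w (False, i, True)"
    "\<sigma> (w (False, i, True)) = - w (False, i, True)"
    using involution_w[OF \<tau>] involution_w[OF \<sigma>] by simp_all
  then show ?thesis
    using fiber_ramified_four[OF assms(1) \<tau>(1) _ _ \<sigma>(1) _ assms(2,3)] by blast
qed

lemma fiber_gsplit:
  assumes u: "u \<in> set gelems" "gsplit u"
  shows "card (fiber (\<phi> u)) = 8 \<and> fiber (\<phi> u) \<subseteq> rational_places"
  using u(2) unfolding gsplit_def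
  by (intro fiber_split) (simp_all add: g_in_gelems unit_square_iff flip: \<phi>_gA \<phi>_gB \<phi>_gC)

lemma fiber_gramified:
  assumes u: "u \<in> set gelems" "gramified u"
  shows "card (fiber (\<phi> u)) = 4 \<and> fiber (\<phi> u) \<subseteq> rational_places"
proof -
  note gr = bspec[OF gramified_squares u(1)]
  note conv = \<phi>_gA[symmetric] \<phi>_gB[symmetric] \<phi>_gC[symmetric] \<phi>_gAC[symmetric] \<phi>_gBC[symmetric]
    unit_square_iff g_in_gelems \<phi>_0
  show ?thesis
  proof (cases "gA u = (0, 0)")
    case True
    then consider "gunit_square (gC u)" | "gunit_square (gAC u)"
      using gr by blast
    then show ?thesis
      using gr True by cases (use fiber_branch_a[of "\<phi> u" False] fiber_branch_a[of "\<phi> u" True] in \<open>simp_all add: conv\<close>)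
  next
    case False
    then have B: "gB u = (0, 0)"
      using u(2) unfolding gramified_def by blast
    then consider "gunit_square (gC u)" | "gunit_square (gBC u)"
      using gr by blast
    then show ?thesis
      using gr B by cases (use fiber_branch_b[of "\<phi> u" False] fiber_branch_b[of "\<phi> u" True] in \<open>simp_all add: conv\<close>)
  qed
qed

lemma rational_places_eq:
  "rational_places = (\<Union>u\<in>{u \<in> set gelems. gsplit u \<or> gramified u}. fiber (\<phi> u))"
proof (intro equalityI subsetI)
  fix P assume "P \<in> rational_places"
  then have P: "P \<in> places" "place_degree P = 1"
    unfolding rational_places_def by auto
  have "P \<notin> infinite_places"
    using rational_infinite_square[OF _ P(2) UNIV_I, of "(False, False, True)"] lead_coeff_nonsquare by blast
  then obtain s where s: "P \<in> fiber s"
    using rational_place_cases[OF P] by blast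
  obtain u where u: "u \<in> set gelems" "s = \<phi> u"
    using \<phi>_surj by blast
  have sq: "\<exists>d. d ^ 2 = poly (D i) (\<phi> u)" for i
    using rational_fiber_square[OF s P(2) w_square] unfolding u(2) .
  have "gsquare (gA u)" "gsquare (gB u)" "gsquare (gC u)"
    using sq[of "(True, False, False)"] sq[of "(False, True, False)"] sq[of "(False, False, True)"]
    unfolding \<phi>_gA[symmetric] \<phi>_gB[symmetric] \<phi>_gC[symmetric] by (simp_all add: square_iff g_in_gelems)
  \<comment> \<open>If a^2 and b^2 do not vanish at the point, then neither does z^2, so all three
    values are nonzero squares.\<close>
  then have "gsplit u \<or> gramified u"
    using bspec[OF gramified_squares u(1)] unfolding gsplit_def gunit_square_def gramified_def by blast
  then show "P \<in> (\<Union>u\<in>{u \<in> set gelems. gsplit u \<or> gramified u}. fiber (\<phi> u))"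
    using s u by blast
qed (use fiber_gsplit fiber_gramified in blast)

lemma num_rational_places_eq: "finite rational_places" "num_rational_places = 496"
proof -
  let ?S = "set (filter gsplit gelems)" and ?R = "set (filter gramified gelems)"
  have U: "{u \<in> set gelems. gsplit u \<or> gramified u} = ?S \<union> ?R"
    by auto
  have disj: "?S \<inter> ?R = {}"
    by (auto simp: gsplit_def gramified_def gunit_square_def)
  show "finite rational_places"
    unfolding rational_places_eq U using finite_fiber by blast
  have "num_rational_places = (\<Sum>u\<in>?S \<union> ?R. card (fiber (\<phi> u)))"
    unfolding num_rational_places_def rational_places_eq U
  proof (rule card_UN_disjoint)
    show "\<forall>u\<in>?S \<union> ?R. \<forall>v\<in>?S \<union> ?R. u \<noteq> v \<longrightarrow> fiber (\<phi> u) \<inter> fiber (\<phi> v) = {}"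
    proof (intro ballI impI)
      fix u v assume "u \<in> ?S \<union> ?R" "v \<in> ?S \<union> ?R" "u \<noteq> v"
      then have "\<phi> u \<noteq> \<phi> v"
        using \<phi>_eq_iff[of u v] by auto
      then show "fiber (\<phi> u) \<inter> fiber (\<phi> v) = {}"
        by (rule fiber_disjoint)
    qed
  qed (use finite_fiber in auto)
  also have "\<dots> = (\<Sum>u\<in>?S. card (fiber (\<phi> u))) + (\<Sum>u\<in>?R. card (fiber (\<phi> u)))"
    using disj by (intro sum.union_disjoint) auto
  also have "(\<Sum>u\<in>?S. card (fiber (\<phi> u))) = (\<Sum>u\<in>?S. 8)"
    using fiber_gsplit by (intro sum.cong) auto
  also have "(\<Sum>u\<in>?R. card (fiber (\<phi> u))) = (\<Sum>u\<in>?R. 4)"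
    using fiber_gramified by (intro sum.cong) auto
  also have "(\<Sum>u\<in>?S. 8) + (\<Sum>u\<in>?R. 4) = card ?S * 8 + card ?R * 4"
    by simp
  also have "card ?S = 56"
    using distinct_card[OF distinct_filter[OF distinct_gelems], of gsplit] gsplit_count by simp
  also have "card ?R = 12"
    using distinct_card[OF distinct_filter[OF distinct_gelems], of gramified] gramified_count by simp
  finally show "num_rational_places = 496"
    by simp
qed

lemma curve_maximal: maximal_function_field
  unfolding maximal_function_field_def genus_17
  using finite_field function_field curve_full_constant_field num_rational_places_eq by (simp add: card_field)

end

theorem theorem2p3:
  fixes \<kappa> :: "'k::field \<Rightarrow> 'f::field"
    and \<alpha> :: 'k and f :: "'k poly" and x y z :: 'f
  assumes "card (UNIV :: 'k set) = 11 ^ 2"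
    and "field_extension \<kappa>"
    and "\<alpha> ^ 2 = -1"
    and "f = [:1, 1:] * [:1, 1, 1:]"
    and "field_extension.transcendental \<kappa> x"
    and "(y ^ 2 - 1) ^ 2 = 1 - x ^ 12"
    and "z ^ 2 = \<kappa> (\<alpha> + 1) * poly (map_poly \<kappa> f) x * poly (map_poly \<kappa> f) (\<kappa> \<alpha> * x)"
    and "field_extension.adjoin \<kappa> {x, y, z} = UNIV"
  shows "field_extension.maximal_function_field \<kappa> \<and>
    int (field_extension.num_rational_places \<kappa>) =
      11 ^ 2 + 1 + 2 * 11 * field_extension.genus \<kappa>"
proof -
  interpret field_121 \<alpha>
    using assms(1,3) by unfold_locales
  interpret transcendental_extension \<kappa> x
    using assms(2,5) by (simp add: transcendental_extension_def transcendental_extension_axioms_def)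
  have "f = F\<^sub>1"
    unfolding assms(4) F\<^sub>1_def ..
  moreover have "ev (\<kappa> \<alpha> * x) F\<^sub>1 = ev x F\<^sub>2"
    unfolding F\<^sub>2_def ev_pcompose by (simp add: hom_zero mult.commute)
  ultimately have "z ^ 2 = \<kappa> (\<alpha> + 1) * ev x F\<^sub>1 * ev x F\<^sub>2"
    using assms(7) by (simp add: ev_def)
  then interpret curve \<kappa> x \<alpha> y z
    using assms(6,8) by unfold_locales
  show ?thesis
    using curve_maximal num_rational_places_eq(2) genus_17 by simp
qed

end
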